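(* Let $r\ge 1$ and let $\lambda^1,\dots,\lambda^r$ be partitions. Then $$\prod_{I\subseteq[r]}\big(J^{(\alpha)}_{\lambda^I}\big)^{(-1)^{|I|}}=1+O(\alpha^{r-1})$$ when $\alpha\to0$.
   Context: Notation. $[r]=\{1,\dots,r\}$; $\lambda\oplus\mu=(\lambda_1+\mu_1,\lambda_2+\mu_2,\dots)$ is the entry-wise sum of partitions and $\lambda^I:=\bigoplus_{i\in I}\lambda^i$ for $I\subseteq[r]$ ($\lambda^\emptyset$ is the empty partition and $J^{(\alpha)}_{\lambda^\emptyset}=1$). $O$-notation. For a field $R$, a rational function $f\in R(\alpha)$ and an integer $k$, $f=O(\alpha^k)$ means that $f\cdot\alpha^{-k}$ has no pole at $\alpha=0$. Here symmetric functions are considered as rational functions of $\alpha$ with coefficients in the field of fractions of the ring of symmetric functions over $\mathbb{Q}$. Partitions. $|\lambda|$ and $\ell(\lambda)$ denote size and length; $\lambda^t$ is the conjugate partition; $b(\lambda)=\sum_i\binom{\lambda_i}{2}$. The Young diagram of $\lambda$ is $\{(i,j):1\le i\le\lambda_j,\ 1\le j\le\ell(\lambda)\}$. For a box $\square=(i,j)\in\lambda$, put $a(\square)=\lambda_j-i$ and $\ell(\square)=\lambda^t_i-j$; $\mathrm{hook}_\alpha(\lambda)=\prod_{\square\in\lambda}(\alpha\,a(\square)+\ell(\square)+1)$. Jack symmetric functions. On symmetric polynomials in $x_1,\dots,x_N$ over $\mathbb{Q}(\alpha)$, let $D_1=\sum_{i\le N}\sum_{j\ne i}\frac{x_i^2}{x_i-x_j}\frac{\partial}{\partial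 x_i}$, $D_2=\frac12\sum_{i\le N}x_i^2\frac{\partial^2}{\partial x_i^2}$ and $D_\alpha=D_1+\alpha D_2$. There is a unique family $J^{(\alpha)}_\lambda$, indexed by partitions with $\ell(\lambda)\le N$, such that (C1) $D_\alpha J^{(\alpha)}_\lambda=\big(\alpha b(\lambda)-b(\lambda^t)+(N-1)|\lambda|\big)J^{(\alpha)}_\lambda$, and (C2) $J^{(\alpha)}_\lambda=\mathrm{hook}_\alpha(\lambda)m_\lambda+\sum_{\nu<\lambda}a^\lambda_\nu m_\nu$ with $a^\lambda_\nu\in\mathbb{Q}(\alpha)$, where $m_\nu$ are monomial symmetric functions and $<$ is strict dominance order. These satisfy $J^{(\alpha)}_\lambda(x_1,\dots,x_N,0)=J^{(\alpha)}_\lambda(x_1,\dots,x_N)$, so they define symmetric functions $J^{(\alpha)}_\lambda$ in infinitely many variables. *)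

theory Defs
  imports
    "HOL-Computational_Algebra.Computational_Algebra"
    "HOL-Computational_Algebra.Field_as_Ring"
    "HOL-Library.Poly_Mapping"
begin

section \<open>Exponents and partitions\<close>

text \<open>
  Finitely supported functions \<^typ>\<open>nat \<Rightarrow>\<^sub>0 nat\<close> serve both as exponents of monomials in the
  variables $x_0, x_1, \ldots$ and as partitions. All indices are shifted by one: the part
  $\mu_j$ is \<open>lookup \<mu> (j - 1)\<close>, and the variable $x_i$ has index \<open>i - 1\<close>. The entry-wise sum
  of partitions is the sum \<open>+\<close> of this type, and the empty partition is \<open>0\<close>.
\<close>

abbreviation lookup where "lookup \<equiv> Poly_Mapping.lookup"
abbreviation keys where "keys \<equiv> Poly_Mapping.keys"
abbreviation single where "single \<equiv> Poly_Mapping.single"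

definition is_partition :: "(nat \<Rightarrow>\<^sub>0 nat) \<Rightarrow> bool" where
  "is_partition \<mu> \<longleftrightarrow> antimono (lookup \<mu>)"

definition part_size :: "(nat \<Rightarrow>\<^sub>0 nat) \<Rightarrow> nat" where
  "part_size \<mu> = (\<Sum>i\<in>keys \<mu>. lookup \<mu> i)"

definition part_length :: "(nat \<Rightarrow>\<^sub>0 nat) \<Rightarrow> nat" where
  "part_length \<mu> = card (keys \<mu>)"

lift_definition conjugate :: "(nat \<Rightarrow>\<^sub>0 nat) \<Rightarrow> (nat \<Rightarrow>\<^sub>0 nat)" is
  "\<lambda>\<mu> i. card {j. i < \<mu> j}"
proof -
  fix l :: "nat \<Rightarrow> nat"
  assume fin: "finite {x. l x \<noteq> 0}"
  have "{i. card {j. i < l j} \<noteq> 0} \<subseteq> (\<Union>j\<in>{x. l x \<noteq> 0}. {..<l j})"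
  proof
    fix i assume "i \<in> {i. card {j. i < l j} \<noteq> 0}"
    then have "{j. i < l j} \<noteq> {}" by force
    then obtain j where "i < l j" by blast
    moreover from this have "l j \<noteq> 0" by simp
    ultimately show "i \<in> (\<Union>j\<in>{x. l x \<noteq> 0}. {..<l j})" by blast
  qed
  then show "finite {i. card {j. i < l j} \<noteq> 0}"
    by (rule finite_subset) (use fin in blast)
qed

definition bstat :: "(nat \<Rightarrow>\<^sub>0 nat) \<Rightarrow> nat" where
  "bstat \<mu> = (\<Sum>i\<in>keys \<mu>. lookup \<mu> i choose 2)"

definition dominated :: "(nat \<Rightarrow>\<^sub>0 nat) \<Rightarrow> (nat \<Rightarrow>\<^sub>0 nat) \<Rightarrow> bool" where
  "dominated \<nu> \<mu> \<longleftrightarrow> part_size \<nu> = part_size \<mu> \<and>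
     (\<forall>k. (\<Sum>i<k. lookup \<nu> i) \<le> (\<Sum>i<k. lookup \<mu> i))"

definition strictly_below :: "(nat \<Rightarrow>\<^sub>0 nat) \<Rightarrow> (nat \<Rightarrow>\<^sub>0 nat) set" where
  "strictly_below \<mu> = {\<nu>. is_partition \<nu> \<and> dominated \<nu> \<mu> \<and> \<nu> \<noteq> \<mu>}"

text \<open>The pair \<open>(i, j)\<close> stands for the box $(i+1, j+1)$.\<close>

definition diagram :: "(nat \<Rightarrow>\<^sub>0 nat) \<Rightarrow> (nat \<times> nat) set" where
  "diagram \<mu> = {(i, j). i < lookup \<mu> j}"

definition arm :: "(nat \<Rightarrow>\<^sub>0 nat) \<Rightarrow> nat \<times> nat \<Rightarrow> nat" where
  "arm \<mu> = (\<lambda>(i, j). lookup \<mu> j - (i + 1))"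

definition leg :: "(nat \<Rightarrow>\<^sub>0 nat) \<Rightarrow> nat \<times> nat \<Rightarrow> nat" where
  "leg \<mu> = (\<lambda>(i, j). lookup (conjugate \<mu>) i - (j + 1))"


section \<open>Symmetric functions in infinitely many variables\<close>

lemma part_size_superset:
  assumes "finite S" "keys m \<subseteq> S"
  shows "part_size m = (\<Sum>i\<in>S. lookup m i)"
  unfolding part_size_def using assms by (intro sum.mono_neutral_left) (auto simp: in_keys_iff)

lemma part_size_add: "part_size (a + b) = part_size a + part_size b"
proof -
  let ?S = "keys a \<union> keys b"
  have "keys (a + b) \<subseteq> ?S" by (rule Poly_Mapping.keys_add)
  then show ?thesis
    by (simp add: part_size_superset[of ?S] lookup_add sum.distrib)
qed

lemma lookup_le_part_size: "lookup m k \<le> part_size m"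
proof (cases "k \<in> keys m")
  case True
  then show ?thesis unfolding part_size_def by (intro member_le_sum) auto
qed (simp add: in_keys_iff)

lemma lookup_map_key: "inj f \<Longrightarrow> lookup (Poly_Mapping.map_key f p) k = lookup p (f k)"
  by (simp add: Poly_Mapping.map_key.rep_eq)

lemma part_size_map_key:
  assumes "bij (\<pi> :: nat \<Rightarrow> nat)"
  shows "part_size (Poly_Mapping.map_key \<pi> m) = part_size m"
proof -
  have i: "inj \<pi>" using assms by (simp add: bij_is_inj)
  have "bij_betw \<pi> (keys (Poly_Mapping.map_key \<pi> m)) (keys m)"
    using assms unfolding keys_map_key[OF i] bij_betw_def
    by (auto simp: inj_on_def bij_def surj_image_vimage_eq)
  then show ?thesis
    unfolding part_size_def using i
    by (subst sum.reindex_bij_betw[symmetric]) (auto simp: lookup_map_key)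
qed

lemma finite_bounded_exponents:
  assumes "finite S"
  shows "finite {a :: nat \<Rightarrow>\<^sub>0 nat. keys a \<subseteq> S \<and> (\<forall>k. lookup a k \<le> d)}"
proof (rule finite_imageD)
  have "finite {f :: nat \<Rightarrow> nat. \<forall>x. (x \<in> S \<longrightarrow> f x \<in> {..d}) \<and> (x \<notin> S \<longrightarrow> f x = 0)}"
    using assms by (intro finite_set_of_finite_funs) auto
  then show "finite (lookup ` {a :: nat \<Rightarrow>\<^sub>0 nat. keys a \<subseteq> S \<and> (\<forall>k. lookup a k \<le> d)})"
    by (rule finite_subset[rotated]) (auto simp: in_keys_iff)
  show "inj_on lookup {a :: nat \<Rightarrow>\<^sub>0 nat. keys a \<subseteq> S \<and> (\<forall>k. lookup a k \<le> d)}"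
    by (auto simp: inj_on_def)
qed

lemma keys_add_exponent: "keys ((a :: nat \<Rightarrow>\<^sub>0 nat) + b) = keys a \<union> keys b"
  by (auto simp: in_keys_iff lookup_add)

lemma finite_decompositions: "finite {(a, b). a + b = (m :: nat \<Rightarrow>\<^sub>0 nat)}"
proof -
  let ?A = "{a. keys a \<subseteq> keys m \<and> (\<forall>k. lookup a k \<le> part_size m)}"
  have "a \<in> ?A \<and> b \<in> ?A" if "a + b = m" for a b
    using that part_size_add[of a b] lookup_le_part_size[of a] lookup_le_part_size[of b]
    by (auto simp: keys_add_exponent intro: le_trans[OF lookup_le_part_size])
  then have "{(a, b). a + b = m} \<subseteq> ?A \<times> ?A" by blast
  then show ?thesis
    by (rule finite_subset) (intro finite_cartesian_product finite_bounded_exponents; simp)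
qed

text \<open>
  A symmetric function is a formal series of bounded degree in $x_0, x_1, \ldots$, given by its
  coefficients, that is invariant under permutations of the variables.
\<close>

definition bounded_degree :: "((nat \<Rightarrow>\<^sub>0 nat) \<Rightarrow> 'a::zero) \<Rightarrow> bool" where
  "bounded_degree f \<longleftrightarrow> (\<exists>d. \<forall>m. f m \<noteq> 0 \<longrightarrow> part_size m \<le> d)"

definition symmetric_series :: "((nat \<Rightarrow>\<^sub>0 nat) \<Rightarrow> 'a) \<Rightarrow> bool" where
  "symmetric_series f \<longleftrightarrow> (\<forall>\<pi> m. bij \<pi> \<longrightarrow> f (Poly_Mapping.map_key \<pi> m) = f m)"

typedef (overloaded) 'a symf =
  "{f :: (nat \<Rightarrow>\<^sub>0 nat) \<Rightarrow> 'a::zero. bounded_degree f \<and> symmetric_series f}"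
  morphisms sf_coeff Abs_symf
  by (rule exI[of _ "\<lambda>_. 0"]) (simp add: bounded_degree_def symmetric_series_def)

setup_lifting type_definition_symf

lemma symf_eqI: "(\<And>m. sf_coeff f m = sf_coeff g m) \<Longrightarrow> f = g"
  by (simp add: sf_coeff_inject[symmetric] fun_eq_iff)

lemma symf_eq_iff: "f = g \<longleftrightarrow> (\<forall>m. sf_coeff f m = sf_coeff g m)"
  by (auto intro: symf_eqI)

lemma finite_truncation:
  assumes "bounded_degree f"
  shows "finite {m. keys m \<subseteq> {..<N} \<and> f m \<noteq> 0}"
proof -
  obtain d where "\<forall>m. f m \<noteq> 0 \<longrightarrow> part_size m \<le> d" using assms by (auto simp: bounded_degree_def)
  then have "{m. keys m \<subseteq> {..<N} \<and> f m \<noteq> 0} \<subseteq> {a. keys a \<subseteq> {..<N} \<and> (\<forall>k. lookup a k \<le> d)}"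
    using lookup_le_part_size le_trans by blast
  then show ?thesis by (rule finite_subset) (simp add: finite_bounded_exponents)
qed

type_synonym 'a mpol = "(nat \<Rightarrow>\<^sub>0 nat) \<Rightarrow>\<^sub>0 'a"

text \<open>
  Setting all variables but the first \<open>N\<close> to zero turns a symmetric function into a polynomial.
\<close>

lift_definition restrict_vars :: "nat \<Rightarrow> 'a::zero symf \<Rightarrow> 'a mpol" is
  "\<lambda>N f m. if keys m \<subseteq> {..<N} then f m else 0"
  by (rule finite_subset[OF _ finite_truncation]) (auto split: if_splits)

lemma lookup_restrict_vars:
  "lookup (restrict_vars N f) m = (if keys m \<subseteq> {..<N} then sf_coeff f m else 0)"
  by (simp add: restrict_vars.rep_eq)

lemma keys_below_bound: "\<exists>N. keys (m :: nat \<Rightarrow>\<^sub>0 nat) \<subseteq> {..<N}"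
  using finite_nat_iff_bounded[of "keys m"] by simp

lemma symf_eqI_restrict:
  assumes "\<And>N. restrict_vars N f = restrict_vars N g"
  shows "f = g"
proof (rule symf_eqI)
  fix m :: "nat \<Rightarrow>\<^sub>0 nat"
  obtain N where "keys m \<subseteq> {..<N}" using keys_below_bound by blast
  then show "sf_coeff f m = sf_coeff g m"
    using arg_cong[OF assms[of N], of "\<lambda>p. lookup p m"] by (simp add: lookup_restrict_vars)
qed

lemma map_key_eq_zero_iff:
  assumes "bij (\<pi> :: nat \<Rightarrow> nat)"
  shows "Poly_Mapping.map_key \<pi> m = 0 \<longleftrightarrow> (m :: nat \<Rightarrow>\<^sub>0 nat) = 0"
proof
  assume *: "Poly_Mapping.map_key \<pi> m = 0"
  show "m = 0"
  proof (rule poly_mapping_eqI)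
    fix k
    obtain j where "k = \<pi> j" using assms by (meson bij_pointE)
    then show "lookup m k = lookup 0 k"
      using * lookup_map_key[OF bij_is_inj[OF assms], of m j] by simp
  qed
qed (simp add: map_key_zero[OF bij_is_inj[OF assms]])

instantiation symf :: (zero) zero
begin
lift_definition zero_symf :: "'a symf" is "\<lambda>_. 0"
  by (simp add: bounded_degree_def symmetric_series_def)
instance ..
end

instantiation symf :: (comm_ring_1) comm_ring_1
begin

lift_definition one_symf :: "'a symf" is "\<lambda>m. if m = 0 then 1 else 0"
  by (auto simp: bounded_degree_def symmetric_series_def map_key_eq_zero_iff)

lift_definition plus_symf :: "'a symf \<Rightarrow> 'a symf \<Rightarrow> 'a symf" is "\<lambda>f g m. f m + g m"
proof -
  fix f g :: "(nat \<Rightarrow>\<^sub>0 nat) \<Rightarrow> 'a"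
  assume f: "bounded_degree f \<and> symmetric_series f" and g: "bounded_degree g \<and> symmetric_series g"
  obtain d e where d: "\<forall>m. f m \<noteq> 0 \<longrightarrow> part_size m \<le> d" and e: "\<forall>m. g m \<noteq> 0 \<longrightarrow> part_size m \<le> e"
    using f g by (auto simp: bounded_degree_def)
  have "f m + g m \<noteq> 0 \<longrightarrow> part_size m \<le> d + e" for m
    using d[rule_format, of m] e[rule_format, of m] by (cases "f m = 0") auto
  then show "bounded_degree (\<lambda>m. f m + g m) \<and> symmetric_series (\<lambda>m. f m + g m)"
    using f g by (auto simp: bounded_degree_def symmetric_series_def)
qed

lift_definition uminus_symf :: "'a symf \<Rightarrow> 'a symf" is "\<lambda>f m. - f m"
  by (simp add: bounded_degree_def symmetric_series_def)

definition minus_symf :: "'a symf \<Rightarrow> 'a symf \<Rightarrow> 'a symf" where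
  "minus_symf f g = f + - g"

lift_definition times_symf :: "'a symf \<Rightarrow> 'a symf \<Rightarrow> 'a symf" is
  "\<lambda>f g m. \<Sum>(a, b) | a + b = m. f a * g b"
proof -
  fix f g :: "(nat \<Rightarrow>\<^sub>0 nat) \<Rightarrow> 'a"
  assume f: "bounded_degree f \<and> symmetric_series f" and g: "bounded_degree g \<and> symmetric_series g"
  let ?h = "\<lambda>m. \<Sum>(a, b) | a + b = m. f a * g b"
  obtain d e where d: "\<forall>m. f m \<noteq> 0 \<longrightarrow> part_size m \<le> d" and e: "\<forall>m. g m \<noteq> 0 \<longrightarrow> part_size m \<le> e"
    using f g by (auto simp: bounded_degree_def)
  have "part_size m \<le> d + e" if h: "?h m \<noteq> 0" for m
  proof -
    obtain ab where "ab \<in> {(a, b). a + b = m}" "(case ab of (a, b) \<Rightarrow> f a * g b) \<noteq> 0"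
      by (rule sum.not_neutral_contains_not_neutral[OF h])
    then have "fst ab + snd ab = m" "f (fst ab) \<noteq> 0" "g (snd ab) \<noteq> 0"
      by (auto simp: case_prod_beta)
    then show ?thesis using d e part_size_add[of "fst ab" "snd ab"] add_mono by metis
  qed
  then have "bounded_degree ?h" unfolding bounded_degree_def by blast
  moreover have "?h (Poly_Mapping.map_key \<pi> m) = ?h m" if b: "bij \<pi>" for \<pi> m
  proof -
    let ?k = "Poly_Mapping.map_key \<pi>" and ?l = "Poly_Mapping.map_key (inv \<pi>)"
    have i: "inj \<pi>" "inj (inv \<pi>)" using b by (auto simp: bij_is_inj bij_imp_bij_inv)
    have kl: "?k (?l x) = x" for x :: "nat \<Rightarrow>\<^sub>0 nat"
      using b i by (intro poly_mapping_eqI) (simp add: lookup_map_key bij_is_inj)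
    have lk: "?l (?k x) = x" for x :: "nat \<Rightarrow>\<^sub>0 nat"
      using b i by (intro poly_mapping_eqI) (simp add: lookup_map_key bij_is_surj surj_f_inv_f)
    have "?h m = ?h (?k m)"
      using f g b
      by (intro sum.reindex_bij_witness[of _ "\<lambda>(a, b). (?l a, ?l b)" "\<lambda>(a, b). (?k a, ?k b)"])
         (auto simp: kl lk map_key_plus[OF i(1), symmetric] map_key_plus[OF i(2), symmetric]
            symmetric_series_def)
    then show ?thesis by simp
  qed
  ultimately show "bounded_degree ?h \<and> symmetric_series ?h"
    by (simp add: symmetric_series_def)
qed

lemma restrict_vars_one: "restrict_vars N (1 :: 'a symf) = 1"
  by (rule poly_mapping_eqI) (auto simp: lookup_restrict_vars one_symf.rep_eq lookup_one when_def)

lemma restrict_vars_add: "restrict_vars N (f + g :: 'a symf) = restrict_vars N f + restrict_vars N g"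
  by (rule poly_mapping_eqI) (simp add: lookup_restrict_vars plus_symf.rep_eq lookup_add)

lemma restrict_vars_uminus: "restrict_vars N (- f :: 'a symf) = - restrict_vars N f"
  by (rule poly_mapping_eqI) (simp add: lookup_restrict_vars uminus_symf.rep_eq)

lemma restrict_vars_mult: "restrict_vars N (f * g :: 'a symf) = restrict_vars N f * restrict_vars N g"
proof (rule poly_mapping_eqI)
  fix m
  let ?f = "restrict_vars N f" and ?g = "restrict_vars N g"
  let ?h = "\<lambda>(a, b). lookup ?f a * lookup ?g b when m = a + b"
  have "lookup (?f * ?g) m = Sum_any ?h"
    by (simp add: times_poly_mapping.rep_eq prod_fun_unfold_prod)
  also have "\<dots> = (\<Sum>ab\<in>{(a, b). a + b = m}. ?h ab)"
    by (rule Sum_any.expand_superset[OF finite_decompositions]) (auto simp: when_def split: if_splits)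
  also have "\<dots> = (\<Sum>(a, b) | a + b = m. lookup ?f a * lookup ?g b)"
    by (rule sum.cong) auto
  also have "\<dots> = (\<Sum>(a, b) | a + b = m.
      if keys m \<subseteq> {..<N} then sf_coeff f a * sf_coeff g b else 0)"
    by (rule sum.cong) (auto simp: lookup_restrict_vars keys_add_exponent)
  also have "\<dots> = lookup (restrict_vars N (f * g)) m"
    by (auto simp: lookup_restrict_vars times_symf.rep_eq intro!: sum.neutral)
  finally show "lookup (restrict_vars N (f * g)) m = lookup (?f * ?g) m" ..
qed

lemma restrict_vars_zero: "restrict_vars N (0 :: 'a symf) = 0"
  by (rule poly_mapping_eqI) (simp add: lookup_restrict_vars zero_symf.rep_eq)

instance
proof
  show "(0 :: 'a symf) \<noteq> 1"
    by (metis lookup_one_zero restrict_vars_one restrict_vars_zero lookup_zero zero_neq_one)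
qed (rule symf_eqI_restrict;
      simp add: restrict_vars_zero restrict_vars_one restrict_vars_add restrict_vars_uminus
        restrict_vars_mult minus_symf_def algebra_simps)+

end

instance symf :: (idom) idom
proof
  fix f g :: "'a symf"
  assume f: "f \<noteq> 0" and g: "g \<noteq> 0"
  have nz: "\<exists>N. \<forall>M\<ge>N. restrict_vars M h \<noteq> 0" if h: "h \<noteq> 0" for h :: "'a symf"
  proof -
    obtain m where m: "sf_coeff h m \<noteq> 0"
      using h symf_eq_iff[of h 0] by (auto simp: zero_symf.rep_eq)
    obtain N where "keys m \<subseteq> {..<N}" using keys_below_bound by blast
    then have "lookup (restrict_vars M h) m \<noteq> 0" if "M \<ge> N" for M
      using that m by (auto simp: lookup_restrict_vars)
    then have "restrict_vars M h \<noteq> 0" if "M \<ge> N" for M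
      using that by force
    then show ?thesis by blast
  qed
  obtain N1 N2 where "\<forall>M\<ge>N1. restrict_vars M f \<noteq> 0" "\<forall>M\<ge>N2. restrict_vars M g \<noteq> 0"
    using nz[OF f] nz[OF g] by blast
  then have "restrict_vars (max N1 N2) f * restrict_vars (max N1 N2) g \<noteq> 0" by simp
  then have "restrict_vars (max N1 N2) (f * g) \<noteq> 0" by (simp add: restrict_vars_mult)
  then show "f * g \<noteq> 0" by (auto simp: restrict_vars_zero)
qed

text \<open>
  The monomial symmetric function of a partition: the sum of all distinct monomials whose exponent
  is a rearrangement of the partition.
\<close>

lift_definition msym :: "(nat \<Rightarrow>\<^sub>0 nat) \<Rightarrow> 'a::zero_neq_one symf" is
  "\<lambda>\<nu> m. if \<exists>\<pi>. bij \<pi> \<and> m = Poly_Mapping.map_key \<pi> \<nu> then 1 else 0"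
proof -
  fix \<nu> :: "nat \<Rightarrow>\<^sub>0 nat"
  let ?P = "\<lambda>m. \<exists>\<pi>. bij \<pi> \<and> m = Poly_Mapping.map_key \<pi> \<nu>"
  have 1: "?P (Poly_Mapping.map_key \<rho> m)" if b: "bij \<rho>" "?P m"
    for \<rho> :: "nat \<Rightarrow> nat" and m :: "nat \<Rightarrow>\<^sub>0 nat"
  proof -
    obtain \<pi> where "bij \<pi>" "m = Poly_Mapping.map_key \<pi> \<nu>" using b by blast
    then have "Poly_Mapping.map_key \<rho> m = Poly_Mapping.map_key (\<pi> \<circ> \<rho>) \<nu>" "bij (\<pi> \<circ> \<rho>)"
      using b by (auto simp: map_key_compose bij_is_inj bij_comp)
    then show ?thesis by blast
  qed
  have 2: "?P m" if b: "bij \<rho>" "?P (Poly_Mapping.map_key \<rho> m)"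
    for \<rho> :: "nat \<Rightarrow> nat" and m :: "nat \<Rightarrow>\<^sub>0 nat"
  proof -
    have "Poly_Mapping.map_key (inv \<rho>) (Poly_Mapping.map_key \<rho> m) = m"
      using b by (intro poly_mapping_eqI)
        (simp add: lookup_map_key bij_is_inj bij_imp_bij_inv bij_is_surj surj_f_inv_f)
    then show ?thesis using 1[OF bij_imp_bij_inv[OF b(1)] b(2)] by (simp only:)
  qed
  have "?P (Poly_Mapping.map_key \<rho> m) \<longleftrightarrow> ?P m" if "bij \<rho>" for \<rho> :: "nat \<Rightarrow> nat" and m
    using 1 2 that by blast
  then show "bounded_degree (\<lambda>m. if ?P m then 1 else 0 :: 'a) \<and>
      symmetric_series (\<lambda>m. if ?P m then 1 else 0 :: 'a)"
    by (auto simp: bounded_degree_def symmetric_series_def part_size_map_key)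
qed


section \<open>Jack symmetric functions\<close>

type_synonym 'a ratfun = "'a poly fract"

definition alpha :: "'a::field ratfun" where
  "alpha = to_fract [:0, 1:]"

definition hook_alpha :: "(nat \<Rightarrow>\<^sub>0 nat) \<Rightarrow> rat ratfun" where
  "hook_alpha \<mu> = (\<Prod>s\<in>diagram \<mu>. alpha * of_nat (arm \<mu> s) + of_nat (leg \<mu> s) + 1)"

definition jack_eigenvalue :: "nat \<Rightarrow> (nat \<Rightarrow>\<^sub>0 nat) \<Rightarrow> rat ratfun" where
  "jack_eigenvalue N \<mu> =
     alpha * of_nat (bstat \<mu>) - of_nat (bstat (conjugate \<mu>)) + (of_nat N - 1) * of_nat (part_size \<mu>)"

definition pconst :: "'a::zero \<Rightarrow> 'a mpol" where
  "pconst c = single 0 c"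

definition pvar :: "nat \<Rightarrow> 'a::zero_neq_one mpol" where
  "pvar i = single (single i 1) 1"

definition partial_deriv :: "nat \<Rightarrow> 'a::comm_ring_1 mpol \<Rightarrow> 'a mpol" where
  "partial_deriv i f =
     (\<Sum>m\<in>keys f. single (m - single i 1) (of_nat (lookup m i) * lookup f m))"

text \<open>
  The summands of \<open>D1_op\<close> are not polynomials, so the operators take values in the field of
  fractions of the polynomial ring.
\<close>

definition D1_op :: "nat \<Rightarrow> 'a::field mpol \<Rightarrow> 'a mpol fract" where
  "D1_op N f = (\<Sum>i<N. \<Sum>j\<in>{..<N} - {i}.
     to_fract (pvar i) ^ 2 / (to_fract (pvar i) - to_fract (pvar j)) * to_fract (partial_deriv i f))"

definition D2_op :: "nat \<Rightarrow> 'a::field mpol \<Rightarrow> 'a mpol fract" where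
  "D2_op N f = 1 / 2 *
     (\<Sum>i<N. to_fract (pvar i) ^ 2 * to_fract (partial_deriv i (partial_deriv i f)))"

definition D_alpha :: "nat \<Rightarrow> rat ratfun mpol \<Rightarrow> rat ratfun mpol fract" where
  "D_alpha N f = D1_op N f + to_fract (pconst alpha) * D2_op N f"

definition is_jack_polynomial :: "nat \<Rightarrow> (nat \<Rightarrow>\<^sub>0 nat) \<Rightarrow> rat ratfun mpol \<Rightarrow> bool" where
  "is_jack_polynomial N \<mu> J \<longleftrightarrow>
     D_alpha N J = to_fract (pconst (jack_eigenvalue N \<mu>)) * to_fract J \<and>
     (\<exists>a. J = pconst (hook_alpha \<mu>) * restrict_vars N (msym \<mu>) +
            (\<Sum>\<nu>\<in>strictly_below \<mu>. pconst (a \<nu>) * restrict_vars N (msym \<nu>)))"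

text \<open>Only meaningful for \<open>part_length \<mu> \<le> N\<close>.\<close>

definition jack_polynomial :: "nat \<Rightarrow> (nat \<Rightarrow>\<^sub>0 nat) \<Rightarrow> rat ratfun mpol" where
  "jack_polynomial N \<mu> = (THE J. is_jack_polynomial N \<mu> J)"

definition Jack :: "(nat \<Rightarrow>\<^sub>0 nat) \<Rightarrow> rat ratfun symf" where
  "Jack \<mu> = (THE F. \<forall>N\<ge>part_length \<mu>. restrict_vars N F = jack_polynomial N \<mu>)"


section \<open>Symmetric functions as rational functions of $\alpha$\<close>

type_synonym symfield = "rat symf fract"

lift_definition sf_const :: "'a::zero \<Rightarrow> 'a symf" is "\<lambda>c m. if m = 0 then c else 0"
  by (auto simp: bounded_degree_def symmetric_series_def map_key_eq_zero_iff)

text \<open>The inclusion of $\mathbb{Q}(\alpha)$ into the rational functions over \<^typ>\<open>symfield\<close>.\<close>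

definition ratfun_embed :: "rat ratfun \<Rightarrow> symfield ratfun" where
  "ratfun_embed x = (case quot_of_fract x of (p, q) \<Rightarrow>
     Fraction_Field.Fract (map_poly (\<lambda>c. to_fract (sf_const c)) p)
                          (map_poly (\<lambda>c. to_fract (sf_const c)) q))"

text \<open>
  A symmetric function over $\mathbb{Q}(\alpha)$ is a unique finite combination of monomial
  symmetric functions. Replacing these by their counterparts over $\mathbb{Q}$, regarded as
  constants in $\alpha$, yields a rational function of $\alpha$.
\<close>

definition as_ratfun :: "rat ratfun symf \<Rightarrow> symfield ratfun" where
  "as_ratfun F = (\<Sum>\<nu> | is_partition \<nu> \<and> sf_coeff F \<nu> \<noteq> 0.
     ratfun_embed (sf_coeff F \<nu>) * to_fract [:to_fract (msym \<nu>):])"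

definition no_pole_at_0 :: "'a::field ratfun \<Rightarrow> bool" where
  "no_pole_at_0 f \<longleftrightarrow> (\<exists>p q. poly q 0 \<noteq> 0 \<and> f = Fraction_Field.Fract p q)"

definition O_alpha :: "int \<Rightarrow> 'a::field ratfun set" where
  "O_alpha k = {f. no_pole_at_0 (f * alpha powi (- k))}"

end

theory Submission
  imports Defs "HOL-Combinatorics.Permutations"
begin

text \<open>
  Write $F_I$ for $J^{(\alpha)}_{\lambda^I}$ and let $A_K$ and $B_K$ be the products of the $F_I$ over the
  $I \subseteq K$ of even and of odd size. We show $A_K - B_K = O(\alpha^{|K|-1})$ by induction on $K$.
  Dividing the eigenvalue equation by $F_I$ turns it into an equation for the logarithmic derivatives
  of $F_I$, which is linear except for the squares that $\alpha D_2$ contributes. In its alternating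
  sum over $I \subseteq K$ the eigenvalues cancel up to $O(\alpha^{|K|-1})$, and by inclusion-exclusion
  the squares become products of alternating sums over pairs $G \cup H = K$, which the induction
  hypothesis bounds. Hence, if $A_K - B_K = O(\alpha^k)$ with $k < |K| - 1$, then $A_K - B_K$ is an
  eigenvector of $D_1$ up to $O(\alpha^{k+1})$. Since $D_1$ is triangular with respect to the dominance
  order, with distinct eigenvalues on comparable partitions, $A_K - B_K$ is $O(\alpha^{k+1})$ as soon as
  its leading coefficient is. That coefficient is a difference of products of the polynomials
  $\mathrm{hook}_\alpha$, for which strong factorization is an explicit computation.
\<close>

section \<open>Rational functions regular at the origin\<close>

text \<open>Dividing by F_I leaves the polynomials, so orders in \<alpha> are measured on fractions
  by the Gauss valuation. Nothing is lost: the leading coefficient \<open>hook_alpha\<close> is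
  nonzero at \<alpha> = 0, so every F_I is primitive and may stand in a denominator, and Gauss's
  lemma leads back to coefficients. The difference A_K - B_K replaces the quotient because
  triangularity of D_1 concerns coefficients; for |K| \<ge> 2 both products have the same leading
  partition.

  Each step gains one power of \<alpha>, the explicit factor of D_2. Proper nonempty G, H with union
  K contribute order (|G|-1) + (|H|-1) \<ge> |K|-2, and |K|-1 with that factor: this is the exponent
  of the theorem. A pair containing K itself is only as small as the bound already known for K,
  hence a second induction over k. The eigenvalues fit because b(\<lambda>^t) is additive and
  b(\<lambda>) quadratic in \<lambda>: their alternating sums vanish for |K| \<ge> 2 and |K| \<ge> 3
  respectively, and b carries the factor \<alpha>.\<close>

lemma alpha_nonzero [simp]: "alpha \<noteq> 0"
  by (simp add: alpha_def)

lemma no_pole_Fract: "poly q 0 \<noteq> 0 \<Longrightarrow> no_pole_at_0 (Fraction_Field.Fract p q)"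
  by (auto simp: no_pole_at_0_def)

lemma no_poleE:
  assumes "no_pole_at_0 x"
  obtains p q where "poly q 0 \<noteq> 0" "q \<noteq> 0" "x = Fraction_Field.Fract p q"
proof -
  obtain p q where *: "poly q 0 \<noteq> 0" "x = Fraction_Field.Fract p q"
    using assms by (auto simp: no_pole_at_0_def)
  then have "q \<noteq> 0" by auto
  with * that show ?thesis by blast
qed

lemma no_pole_to_fract: "no_pole_at_0 (to_fract p)"
  by (simp add: to_fract_def no_pole_Fract)

lemma no_pole_0: "no_pole_at_0 0" and no_pole_1: "no_pole_at_0 1"
  and no_pole_alpha: "no_pole_at_0 alpha"
  using no_pole_to_fract[of 0] no_pole_to_fract[of 1] no_pole_to_fract[of "[:0, 1:]"]
  by (simp_all add: alpha_def)

lemma no_pole_add: "no_pole_at_0 x \<Longrightarrow> no_pole_at_0 y \<Longrightarrow> no_pole_at_0 (x + y)"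
  by (elim no_poleE) (simp add: no_pole_Fract)

lemma no_pole_mult: "no_pole_at_0 x \<Longrightarrow> no_pole_at_0 y \<Longrightarrow> no_pole_at_0 (x * y)"
  by (elim no_poleE) (simp add: no_pole_Fract)

lemma no_pole_uminus: "no_pole_at_0 x \<Longrightarrow> no_pole_at_0 (- x)"
  by (elim no_poleE) (simp add: no_pole_Fract)

lemma no_pole_diff: "no_pole_at_0 x \<Longrightarrow> no_pole_at_0 y \<Longrightarrow> no_pole_at_0 (x - y)"
  using no_pole_add[of x "- y"] by (simp add: no_pole_uminus)

lemma no_pole_sum: "(\<And>i. i \<in> A \<Longrightarrow> no_pole_at_0 (f i)) \<Longrightarrow> no_pole_at_0 (sum f A)"
  by (induction A rule: infinite_finite_induct) (auto simp: no_pole_0 no_pole_add)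

lemma no_pole_prod: "(\<And>i. i \<in> A \<Longrightarrow> no_pole_at_0 (f i)) \<Longrightarrow> no_pole_at_0 (prod f A)"
  by (induction A rule: infinite_finite_induct) (auto simp: no_pole_1 no_pole_mult)

lemma no_pole_of_nat: "no_pole_at_0 (of_nat n)"
  by (induction n) (auto simp: no_pole_0 no_pole_1 no_pole_add)

lemma no_pole_power: "no_pole_at_0 x \<Longrightarrow> no_pole_at_0 (x ^ n)"
  by (induction n) (auto simp: no_pole_1 no_pole_mult)

lemmas no_pole_intros = no_pole_0 no_pole_1 no_pole_alpha no_pole_add no_pole_mult no_pole_uminus
  no_pole_diff no_pole_sum no_pole_prod no_pole_of_nat no_pole_power

text \<open>Evaluation at \<alpha> = 0, the residue map of the local ring. \<open>res0_Fract\<close>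
  shows independence of the chosen fraction; at a pole the value is unspecified.\<close>

definition res0 :: "'a::field ratfun \<Rightarrow> 'a" where
  "res0 x = (THE c. \<exists>p q. poly q 0 \<noteq> 0 \<and> x = Fraction_Field.Fract p q \<and> c = poly p 0 / poly q 0)"

lemma res0_Fract:
  assumes "poly q 0 \<noteq> 0"
  shows "res0 (Fraction_Field.Fract p q) = poly p 0 / poly q 0"
  unfolding res0_def
proof (rule the_equality)
  fix c
  assume "\<exists>p' q'. poly q' 0 \<noteq> 0 \<and> Fraction_Field.Fract p q = Fraction_Field.Fract p' q' \<and>
            c = poly p' 0 / poly q' 0"
  then obtain p' q' where *: "poly q' 0 \<noteq> 0" "Fraction_Field.Fract p q = Fraction_Field.Fract p' q'"
      "c = poly p' 0 / poly q' 0" by blast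
  moreover have "q \<noteq> 0" "q' \<noteq> 0" using * assms by auto
  ultimately have "p * q' = p' * q" by (simp add: eq_fract)
  then have "poly p 0 * poly q' 0 = poly p' 0 * poly q 0"
    by (metis poly_mult)
  then have "poly p' 0 / poly q' 0 = poly p 0 / poly q 0"
    using assms * by (simp add: divide_eq_eq eq_divide_eq)
  then show "c = poly p 0 / poly q 0" using * by simp
qed (use assms in blast)

lemma res0_to_fract: "res0 (to_fract p) = poly p 0"
  by (simp add: to_fract_def res0_Fract)

lemma res0_0 [simp]: "res0 0 = 0" and res0_1 [simp]: "res0 1 = 1"
  and res0_alpha [simp]: "res0 alpha = 0"
  using res0_to_fract[of 0] res0_to_fract[of 1] res0_to_fract[of "[:0, 1:]"]
  by (simp_all add: alpha_def)

lemma res0_add: "no_pole_at_0 x \<Longrightarrow> no_pole_at_0 y \<Longrightarrow> res0 (x + y) = res0 x + res0 y"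
  by (elim no_poleE) (simp add: res0_Fract field_simps)

lemma res0_mult: "no_pole_at_0 x \<Longrightarrow> no_pole_at_0 y \<Longrightarrow> res0 (x * y) = res0 x * res0 y"
  by (elim no_poleE) (simp add: res0_Fract)

lemma res0_uminus: "no_pole_at_0 x \<Longrightarrow> res0 (- x) = - res0 x"
  by (elim no_poleE) (simp add: res0_Fract)

lemma res0_diff: "no_pole_at_0 x \<Longrightarrow> no_pole_at_0 y \<Longrightarrow> res0 (x - y) = res0 x - res0 y"
  using res0_add[of x "- y"] by (simp add: no_pole_uminus res0_uminus)

lemma res0_sum: "(\<And>i. i \<in> A \<Longrightarrow> no_pole_at_0 (f i)) \<Longrightarrow> res0 (sum f A) = (\<Sum>i\<in>A. res0 (f i))"
  by (induction A rule: infinite_finite_induct) (auto simp: res0_add no_pole_sum)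

lemma res0_prod: "(\<And>i. i \<in> A \<Longrightarrow> no_pole_at_0 (f i)) \<Longrightarrow> res0 (prod f A) = (\<Prod>i\<in>A. res0 (f i))"
  by (induction A rule: infinite_finite_induct) (auto simp: res0_mult no_pole_prod)

lemma res0_of_nat [simp]: "res0 (of_nat n) = of_nat n"
  by (induction n) (auto simp: res0_add no_pole_intros)

lemma no_pole_inverse:
  assumes "no_pole_at_0 x" "res0 x \<noteq> 0"
  shows "no_pole_at_0 (inverse x)" "res0 (inverse x) = inverse (res0 x)"
  using assms by (auto elim!: no_poleE simp: res0_Fract no_pole_Fract)

text \<open>The local ring at 0 is a discrete valuation ring with uniformizer \<open>alpha\<close>:
  a zero of the numerator at 0 splits off the factor.\<close>

lemma alpha_dvd_if_res0_eq_0: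
  assumes "no_pole_at_0 x" "res0 x = 0"
  obtains y where "no_pole_at_0 y" "x = alpha * y"
proof -
  obtain p q where q: "poly q 0 \<noteq> 0" "q \<noteq> 0" and x: "x = Fraction_Field.Fract p q"
    using assms(1) by (rule no_poleE)
  have "poly p 0 = 0" using assms(2) q by (simp add: x res0_Fract)
  then obtain p' where "p = [:0, 1:] * p'" by (auto simp: poly_eq_0_iff_dvd)
  then have "x = alpha * Fraction_Field.Fract p' q"
    by (simp add: x alpha_def to_fract_def)
  with q that show ?thesis by (blast intro: no_pole_Fract)
qed

text \<open>The k-th power of the maximal ideal, that is O(\<alpha>^k) for k \<ge> 0. Factoring out
  the power keeps every estimate inside the local ring, with exponents that add under
  multiplication.\<close>

definition vanishing :: "nat \<Rightarrow> 'a::field ratfun set" where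
  "vanishing k = {alpha ^ k * x | x. no_pole_at_0 x}"

lemma vanishingI: "no_pole_at_0 y \<Longrightarrow> x = alpha ^ k * y \<Longrightarrow> x \<in> vanishing k"
  by (auto simp: vanishing_def)

lemma vanishing_0_iff: "x \<in> vanishing 0 \<longleftrightarrow> no_pole_at_0 x"
  by (simp add: vanishing_def)

lemma vanishing_zero [simp]: "0 \<in> vanishing k"
  by (rule vanishingI[OF no_pole_0]) simp

lemma vanishing_add: "x \<in> vanishing k \<Longrightarrow> y \<in> vanishing k \<Longrightarrow> x + y \<in> vanishing k"
  by (auto simp: vanishing_def no_pole_add simp flip: distrib_left)

lemma vanishing_mult: "x \<in> vanishing j \<Longrightarrow> y \<in> vanishing k \<Longrightarrow> x * y \<in> vanishing (j + k)"
proof -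
  assume "x \<in> vanishing j" "y \<in> vanishing k"
  then obtain u v where "no_pole_at_0 u" "no_pole_at_0 v" "x = alpha ^ j * u" "y = alpha ^ k * v"
    by (auto simp: vanishing_def)
  then show ?thesis
    by (intro vanishingI[of "u * v"]) (auto simp: no_pole_mult power_add)
qed

lemma vanishing_mult_left: "no_pole_at_0 x \<Longrightarrow> y \<in> vanishing k \<Longrightarrow> x * y \<in> vanishing k"
  using vanishing_mult[of x 0 y k] by (simp add: vanishing_0_iff)

lemma vanishing_uminus: "x \<in> vanishing k \<Longrightarrow> - x \<in> vanishing k"
  using vanishing_mult_left[of "- 1" x k] by (simp add: no_pole_intros)

lemma vanishing_diff: "x \<in> vanishing k \<Longrightarrow> y \<in> vanishing k \<Longrightarrow> x - y \<in> vanishing k"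
  using vanishing_add[of x k "- y"] by (simp add: vanishing_uminus)

lemma vanishing_sum: "(\<And>i. i \<in> A \<Longrightarrow> f i \<in> vanishing k) \<Longrightarrow> sum f A \<in> vanishing k"
  by (induction A rule: infinite_finite_induct) (auto simp: vanishing_add)

lemma alpha_power_vanishing: "no_pole_at_0 x \<Longrightarrow> alpha ^ k * x \<in> vanishing k"
  by (auto simp: vanishing_def)

lemma vanishing_antimono: "j \<le> k \<Longrightarrow> vanishing k \<subseteq> vanishing j"
proof
  fix x :: "'a ratfun" assume "j \<le> k" "x \<in> vanishing k"
  then obtain y where "no_pole_at_0 y" "x = alpha ^ (j + (k - j)) * y"
    by (auto simp: vanishing_def)
  then have "x = alpha ^ j * (alpha ^ (k - j) * y)" "no_pole_at_0 (alpha ^ (k - j) * y)"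
    by (auto simp: power_add intro: no_pole_intros)
  then show "x \<in> vanishing j" by (blast intro: vanishingI)
qed

lemma vanishing_no_pole: "x \<in> vanishing k \<Longrightarrow> no_pole_at_0 x"
  using vanishing_antimono[of 0 k] by (auto simp: vanishing_0_iff)

lemma vanishing_res0: "x \<in> vanishing k \<Longrightarrow> 0 < k \<Longrightarrow> res0 x = 0"
  by (auto simp: vanishing_def res0_mult no_pole_intros gr0_conv_Suc)

section \<open>Polynomials over the local ring\<close>

lemma lookup_times:
  "lookup (f * g :: 'a::comm_ring_1 mpol) m = (\<Sum>(a, b) | a + b = m. lookup f a * lookup g b)"
proof -
  let ?h = "\<lambda>(a, b). lookup f a * lookup g b when m = a + b"
  have "lookup (f * g) m = Sum_any ?h"
    by (simp add: times_poly_mapping.rep_eq prod_fun_unfold_prod)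
  also have "\<dots> = (\<Sum>ab\<in>{(a, b). a + b = m}. ?h ab)"
    by (rule Sum_any.expand_superset[OF finite_decompositions]) (auto simp: when_def split: if_splits)
  also have "\<dots> = (\<Sum>(a, b) | a + b = m. lookup f a * lookup g b)"
    by (rule sum.cong) auto
  finally show ?thesis .
qed

lemma lookup_pconst_times: "lookup (pconst c * p :: 'a::comm_ring_1 mpol) m = c * lookup p m"
  by (simp add: pconst_def mult_map_scale_conv_mult[symmetric] Poly_Mapping.map.rep_eq when_def)

definition coeffs_in :: "'a set \<Rightarrow> 'a::zero mpol \<Rightarrow> bool" where
  "coeffs_in S p \<longleftrightarrow> (\<forall>m. lookup p m \<in> S)"

lemma coeffs_in_mult:
  "coeffs_in (vanishing j) p \<Longrightarrow> coeffs_in (vanishing k) q \<Longrightarrow> coeffs_in (vanishing (j + k)) (p * q)"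
  by (auto simp: coeffs_in_def lookup_times intro!: vanishing_sum vanishing_mult)

lemma coeffs_in_add:
  "coeffs_in (vanishing k) p \<Longrightarrow> coeffs_in (vanishing k) q \<Longrightarrow> coeffs_in (vanishing k) (p + q)"
  by (auto simp: coeffs_in_def lookup_add intro!: vanishing_add)

lemma coeffs_in_diff:
  "coeffs_in (vanishing k) p \<Longrightarrow> coeffs_in (vanishing k) q \<Longrightarrow> coeffs_in (vanishing k) (p - q)"
  by (auto simp: coeffs_in_def lookup_minus intro!: vanishing_diff)

lemma coeffs_in_zero: "coeffs_in (vanishing k) 0"
  by (simp add: coeffs_in_def)

lemma coeffs_in_one: "coeffs_in (vanishing 0) 1"
  by (auto simp: coeffs_in_def lookup_one when_def vanishing_0_iff no_pole_intros)

lemma coeffs_in_antimono: "j \<le> k \<Longrightarrow> coeffs_in (vanishing k) p \<Longrightarrow> coeffs_in (vanishing j) p"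
  using vanishing_antimono by (fastforce simp: coeffs_in_def)

definition mpol_res :: "'a::field ratfun mpol \<Rightarrow> 'a mpol" where
  "mpol_res = Poly_Mapping.map res0"

lemma lookup_mpol_res: "lookup (mpol_res p) m = res0 (lookup p m)"
  by (auto simp: mpol_res_def Poly_Mapping.map.rep_eq when_def)

lemma mpol_res_mult:
  assumes "coeffs_in (vanishing 0) p" "coeffs_in (vanishing 0) q"
  shows "mpol_res (p * q) = mpol_res p * mpol_res q"
  using assms unfolding coeffs_in_def vanishing_0_iff
  by (intro poly_mapping_eqI)
    (auto simp: lookup_mpol_res lookup_times res0_sum res0_mult no_pole_intros case_prod_unfold)

text \<open>Gauss valuation exactly 0: no coefficient has a pole and some coefficient is a unit of
  the local ring. These are the admissible denominators.\<close>

definition primitive :: "'a::field ratfun mpol \<Rightarrow> bool" where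
  "primitive p \<longleftrightarrow> coeffs_in (vanishing 0) p \<and> mpol_res p \<noteq> 0"

lemma primitive_nonzero: "primitive p \<Longrightarrow> p \<noteq> 0"
proof
  assume "primitive p" "p = 0"
  then have "mpol_res p = 0" by (intro poly_mapping_eqI) (simp add: lookup_mpol_res)
  then show False using \<open>primitive p\<close> by (simp add: primitive_def)
qed

lemma primitive_coeffs: "primitive p \<Longrightarrow> coeffs_in (vanishing 0) p"
  by (simp add: primitive_def)

text \<open>Reduction modulo \<open>alpha\<close> is multiplicative, and polynomials over the
  residue field have no zero divisors.\<close>

lemma primitive_mult: "primitive p \<Longrightarrow> primitive q \<Longrightarrow> primitive (p * q)"
  using coeffs_in_mult[of 0 p 0 q] by (simp add: primitive_def mpol_res_mult)

lemma primitive_one: "primitive 1"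
proof -
  have "lookup (mpol_res 1) 0 = (1 :: 'a)" by (simp add: lookup_mpol_res)
  then have "mpol_res (1 :: 'a ratfun mpol) \<noteq> 0" by force
  then show ?thesis by (simp add: primitive_def coeffs_in_one)
qed

lemma primitive_prod: "(\<And>i. i \<in> A \<Longrightarrow> primitive (f i)) \<Longrightarrow> primitive (prod f A)"
  by (induction A rule: infinite_finite_induct) (auto simp: primitive_one primitive_mult)

text \<open>Gauss's lemma, for the valuation at \<open>\<alpha> = 0\<close>.\<close>

lemma coeffs_in_cancel:
  assumes pr: "primitive g" and p0: "coeffs_in (vanishing 0) p" and pg: "coeffs_in (vanishing k) (p * g)"
  shows "coeffs_in (vanishing k) p"
proof -
  have "j \<le> k \<Longrightarrow> coeffs_in (vanishing j) p" for j
  proof (induction j)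
    case (Suc j)
    then have j: "coeffs_in (vanishing j) p" by simp
    \<comment> \<open>After division by \<open>alpha ^ j\<close> the coefficients of q are still
      regular while q * g vanishes at \<alpha> = 0. As the residue of g is nonzero, the residue of q
      is zero, which gives p one more power of \<open>alpha\<close>.\<close>
    define q where "q = pconst (inverse (alpha ^ j)) * p"
    have lq: "lookup q m = lookup p m / alpha ^ j" for m
      by (simp add: q_def lookup_pconst_times divide_inverse mult.commute[of "inverse _"] del: mult.commute)
    have q0: "coeffs_in (vanishing 0) q"
      unfolding coeffs_in_def lq vanishing_0_iff
    proof
      fix m
      obtain y where "no_pole_at_0 y" "lookup p m = alpha ^ j * y"
        using j by (auto simp: coeffs_in_def vanishing_def)
      then show "no_pole_at_0 (lookup p m / alpha ^ j)" by simp
    qed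
    have "coeffs_in (vanishing (Suc 0)) (q * g)"
      unfolding coeffs_in_def
    proof
      fix m
      have "lookup (q * g) m = lookup (p * g) m / alpha ^ j"
        by (simp add: lookup_times lq case_prod_unfold sum_divide_distrib)
      moreover have "lookup (p * g) m \<in> vanishing (j + Suc 0)"
        using coeffs_in_antimono[OF _ pg, of "j + Suc 0"] Suc.prems by (simp add: coeffs_in_def)
      ultimately show "lookup (q * g) m \<in> vanishing (Suc 0)"
        by (auto simp: vanishing_def)
    qed
    then have "mpol_res (q * g) = 0"
      by (auto simp: coeffs_in_def lookup_mpol_res intro!: poly_mapping_eqI vanishing_res0)
    then have "mpol_res q * mpol_res g = 0"
      using q0 pr by (simp add: mpol_res_mult primitive_def)
    then have r: "mpol_res q = 0" using pr by (simp add: primitive_def)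
    show ?case unfolding coeffs_in_def
    proof
      fix m
      have "res0 (lookup q m) = 0" using r by (simp add: lookup_mpol_res[symmetric])
      then obtain y where y: "no_pole_at_0 y" "lookup q m = alpha * y"
        using alpha_dvd_if_res0_eq_0[of "lookup q m"] q0 by (auto simp: coeffs_in_def vanishing_0_iff)
      then have "lookup p m = alpha ^ Suc j * y" by (simp add: lq field_simps)
      then show "lookup p m \<in> vanishing (Suc j)" using y by (blast intro: vanishingI)
    qed
  qed (use p0 in simp)
  then show ?thesis by simp
qed

text \<open>
  The elements of valuation at least \<open>k\<close> for the Gauss extension of the \<open>\<alpha>\<close>-adic valuation to
  rational functions in the variables.
\<close>

definition gauss :: "nat \<Rightarrow> 'a::field ratfun mpol fract set" where
  "gauss k = {to_fract p / to_fract g | p g. coeffs_in (vanishing k) p \<and> primitive g}"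

lemma gaussI: "coeffs_in (vanishing k) p \<Longrightarrow> primitive g \<Longrightarrow> to_fract p / to_fract g \<in> gauss k"
  by (auto simp: gauss_def)

lemma gauss_to_fract: "coeffs_in (vanishing k) p \<Longrightarrow> to_fract p \<in> gauss k"
  using gaussI[OF _ primitive_one] by fastforce

lemma gauss_mult:
  assumes "x \<in> gauss j" "y \<in> gauss k"
  shows "x * y \<in> gauss (j + k)"
proof -
  obtain p g q h where "coeffs_in (vanishing j) p" "primitive g" "coeffs_in (vanishing k) q" "primitive h"
    and xy: "x = to_fract p / to_fract g" "y = to_fract q / to_fract h"
    using assms by (auto simp: gauss_def)
  then have "to_fract (p * q) / to_fract (g * h) \<in> gauss (j + k)"
    by (intro gaussI coeffs_in_mult primitive_mult)
  then show ?thesis by (simp add: xy)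
qed

lemma gauss_add:
  assumes "x \<in> gauss k" "y \<in> gauss k"
  shows "x + y \<in> gauss k"
proof -
  obtain p g q h where *: "coeffs_in (vanishing k) p" "primitive g" "coeffs_in (vanishing k) q" "primitive h"
    and xy: "x = to_fract p / to_fract g" "y = to_fract q / to_fract h"
    using assms by (auto simp: gauss_def)
  have "coeffs_in (vanishing (k + 0)) (p * h)" "coeffs_in (vanishing (k + 0)) (q * g)"
    using * by (blast intro: coeffs_in_mult primitive_coeffs)+
  then have "to_fract (p * h + q * g) / to_fract (g * h) \<in> gauss k"
    using * by (intro gaussI coeffs_in_add primitive_mult) simp_all
  moreover have "to_fract g \<noteq> 0" "to_fract h \<noteq> 0" using * by (auto simp: primitive_nonzero)
  ultimately show ?thesis by (simp add: xy field_simps)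
qed

lemma gauss_uminus: "x \<in> gauss k \<Longrightarrow> - x \<in> gauss k"
proof -
  assume "x \<in> gauss k"
  then obtain p g where "coeffs_in (vanishing k) p" "primitive g" "x = to_fract p / to_fract g"
    by (auto simp: gauss_def)
  then show ?thesis
    using gaussI[of k "- p" g] by (simp add: coeffs_in_def vanishing_uminus)
qed

lemma gauss_diff: "x \<in> gauss k \<Longrightarrow> y \<in> gauss k \<Longrightarrow> x - y \<in> gauss k"
  using gauss_add[of x k "- y"] by (simp add: gauss_uminus)

lemma gauss_zero: "0 \<in> gauss k"
  using gauss_to_fract[OF coeffs_in_zero] by simp

lemma gauss_sum: "(\<And>i. i \<in> A \<Longrightarrow> f i \<in> gauss k) \<Longrightarrow> sum f A \<in> gauss k"
  by (induction A rule: infinite_finite_induct) (auto simp: gauss_zero gauss_add)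

lemma gauss_antimono: "j \<le> k \<Longrightarrow> x \<in> gauss k \<Longrightarrow> x \<in> gauss j"
  by (auto simp: gauss_def intro: coeffs_in_antimono)

lemma gauss_mult_left: "x \<in> gauss 0 \<Longrightarrow> y \<in> gauss k \<Longrightarrow> x * y \<in> gauss k"
  using gauss_mult[of x 0 y k] by simp

text \<open>The way back from fractions to coefficients: cross multiplication leaves a primitive
  factor, which Gauss's lemma cancels.\<close>

lemma coeffs_in_if_gauss:
  assumes "to_fract p \<in> gauss k" "coeffs_in (vanishing 0) p"
  shows "coeffs_in (vanishing k) p"
proof -
  obtain q g where *: "coeffs_in (vanishing k) q" "primitive g" "to_fract p = to_fract q / to_fract g"
    using assms(1) by (auto simp: gauss_def)
  then have "to_fract (p * g) = to_fract q"
    by (simp add: field_simps primitive_nonzero)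
  then have "p * g = q" by (simp only: to_fract_eq_iff)
  then show ?thesis using coeffs_in_cancel assms(2) * by blast
qed

section \<open>Exponents up to permutation and the dominance order\<close>

type_synonym exponent = "nat \<Rightarrow>\<^sub>0 nat"

abbreviation map_key where "map_key \<equiv> Poly_Mapping.map_key"

definition perm_of :: "exponent \<Rightarrow> exponent \<Rightarrow> bool" where
  "perm_of m \<nu> \<longleftrightarrow> (\<exists>\<pi>. bij \<pi> \<and> m = map_key \<pi> \<nu>)"

lemma map_key_inv [simp]:
  assumes "bij \<pi>"
  shows "map_key (inv \<pi>) (map_key \<pi> m) = m"
    and "map_key \<pi> (map_key (inv \<pi>) m) = m"
  using assms
  by (auto intro!: poly_mapping_eqI
      simp: lookup_map_key bij_is_inj bij_imp_bij_inv bij_is_surj surj_f_inv_f)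

lemma perm_of_map_key: "bij \<pi> \<Longrightarrow> perm_of (map_key \<pi> \<nu>) \<nu>"
  by (auto simp: perm_of_def)

lemma perm_of_refl: "perm_of \<nu> \<nu>"
  unfolding perm_of_def by (rule exI[of _ "\<lambda>x. x"]) (simp add: map_key_id bij_id[unfolded id_def])

lemma perm_of_sym: "perm_of m \<nu> \<Longrightarrow> perm_of \<nu> m"
  unfolding perm_of_def by (metis (full_types) map_key_inv(1) bij_imp_bij_inv)

lemma perm_of_trans: "perm_of a b \<Longrightarrow> perm_of b c \<Longrightarrow> perm_of a c"
proof -
  assume "perm_of a b" "perm_of b c"
  then obtain \<pi> \<rho> where *: "bij \<pi>" "a = map_key \<pi> b" "bij \<rho>" "b = map_key \<rho> c"
    by (auto simp: perm_of_def)
  then have "a = map_key (\<rho> \<circ> \<pi>) c" "bij (\<rho> \<circ> \<pi>)"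
    by (auto simp: map_key_compose bij_is_inj bij_comp)
  then show ?thesis by (auto simp: perm_of_def)
qed

lemma perm_of_map_key_iff: "bij \<pi> \<Longrightarrow> perm_of (map_key \<pi> m) \<nu> \<longleftrightarrow> perm_of m \<nu>"
  using perm_of_map_key perm_of_sym perm_of_trans by blast

lemma part_size_perm: "perm_of m \<nu> \<Longrightarrow> part_size m = part_size \<nu>"
  by (auto simp: perm_of_def part_size_map_key)

lemma symf_coeff_map_key: "bij \<pi> \<Longrightarrow> sf_coeff f (map_key \<pi> m) = sf_coeff f m"
  using sf_coeff[of f] by (simp add: symmetric_series_def)

lemma symf_coeff_perm: "perm_of m \<nu> \<Longrightarrow> sf_coeff f m = sf_coeff f \<nu>"
  by (auto simp: perm_of_def symf_coeff_map_key)

lemma sf_coeff_msym: "sf_coeff (msym \<nu>) m = (if perm_of m \<nu> then 1 else 0)"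
  by (simp add: msym.rep_eq perm_of_def)

text \<open>The values on an initial segment containing the support are sorted by a finite
  permutation, which is the identity elsewhere and hence a bijection of all indices.\<close>

lemma exists_sorted:
  fixes m :: exponent
  obtains \<nu> where "is_partition \<nu>" "perm_of \<nu> m"
proof -
  obtain N where N: "keys m \<subseteq> {..<N}" using keys_below_bound by blast
  define ys where "ys = map (lookup m) [0..<N]"
  have len: "length ys = N" by (simp add: ys_def)
  have "mset (rev (sort ys)) = mset ys" by simp
  then obtain p where p: "p permutes {..<length ys}" and pl: "permute_list p ys = rev (sort ys)"
    by (rule mset_eq_permutation)
  have bp: "bij p" using p by (rule permutes_bij)
  let ?\<nu> = "map_key p m"
  have lk: "lookup ?\<nu> k = (if k < N then rev (sort ys) ! k else 0)" for k
  proof (cases "k < N")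
    case True
    then have "p k < N" using p len by (metis lessThan_iff permutes_in_image)
    then have "rev (sort ys) ! k = lookup m (p k)"
      using pl True permute_list_nth[OF p, of k] by (simp add: len) (simp add: ys_def)
    then show ?thesis using True by (simp add: lookup_map_key bij_is_inj[OF bp])
  next
    case False
    then have "p k = k" using p len by (simp add: permutes_not_in)
    then show ?thesis using False N by (auto simp: lookup_map_key bij_is_inj[OF bp] in_keys_iff)
  qed
  have "is_partition ?\<nu>" unfolding is_partition_def
  proof (rule antimonoI)
    fix x y :: nat assume "x \<le> y"
    then show "lookup ?\<nu> y \<le> lookup ?\<nu> x"
      by (auto simp: lk rev_nth len intro!: sorted_nth_mono)
  qed
  with that perm_of_map_key[OF bp] show ?thesis by blast
qed

section \<open>Partitions among the exponents\<close>

lemma partition_antimono: "is_partition \<nu> \<Longrightarrow> i \<le> j \<Longrightarrow> lookup \<nu> j \<le> lookup \<nu> i"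
  by (auto simp: is_partition_def antimono_def)

lemma partition_add: "is_partition \<mu> \<Longrightarrow> is_partition \<nu> \<Longrightarrow> is_partition (\<mu> + \<nu>)"
  by (auto simp: is_partition_def antimono_def lookup_add intro: add_mono)

lemma partition_zero: "is_partition 0"
  by (simp add: is_partition_def antimono_def)

lemma partition_sum: "(\<And>i. i \<in> I \<Longrightarrow> is_partition (f i)) \<Longrightarrow> is_partition (sum f I)"
  by (induction I rule: infinite_finite_induct) (auto simp: partition_zero partition_add)

lemma finite_downclosed_nat:
  fixes A :: "nat set"
  assumes "finite A" "\<And>i j. j \<in> A \<Longrightarrow> i \<le> j \<Longrightarrow> i \<in> A"
  shows "A = {..<card A}"
proof (rule card_subset_eq[symmetric, OF assms(1)])
  show "{..<card A} \<subseteq> A"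
  proof
    fix i assume i: "i \<in> {..<card A}"
    show "i \<in> A"
    proof (rule ccontr)
      assume "i \<notin> A"
      then have "A \<subseteq> {..<i}" using assms(2) by (meson lessThan_iff not_le subsetI)
      then have "card A \<le> i" using card_mono[of "{..<i}"] by fastforce
      then show False using i by simp
    qed
  qed
qed simp

lemma keys_partition:
  assumes "is_partition \<nu>"
  shows "keys \<nu> = {..<part_length \<nu>}"
  unfolding part_length_def
proof (rule finite_downclosed_nat[OF finite_keys])
  show "i \<in> keys \<nu>" if "j \<in> keys \<nu>" "i \<le> j" for i j
    using that partition_antimono[OF assms that(2)] by (auto simp: in_keys_iff)
qed

text \<open>The largest element of a set with n + 1 elements is at least n, so its entry is at most
  \<open>lookup \<nu> n\<close>; the rest follows by removing it.\<close>

lemma sum_partition_le: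
  assumes "is_partition \<nu>" "finite S"
  shows "(\<Sum>i\<in>S. lookup \<nu> i) \<le> (\<Sum>i<card S. lookup \<nu> i)"
  using assms(2)
proof (induction "card S" arbitrary: S)
  case (Suc n)
  then have ne: "S \<noteq> {}" by auto
  let ?x = "Max S"
  have x: "?x \<in> S" using Suc ne by simp
  have c: "card (S - {?x}) = n" using Suc x by simp
  have "S \<subseteq> {..?x}" using Suc by auto
  then have "card S \<le> Suc ?x" using card_mono[of "{..?x}" S] by simp
  then have "lookup \<nu> ?x \<le> lookup \<nu> n"
    using Suc.hyps by (intro partition_antimono[OF assms(1)]) simp
  moreover have "(\<Sum>i\<in>S - {?x}. lookup \<nu> i) \<le> (\<Sum>i<n. lookup \<nu> i)"
    using Suc c by (metis finite_Diff)
  ultimately have "(\<Sum>i\<in>S. lookup \<nu> i) \<le> (\<Sum>i<Suc n. lookup \<nu> i)"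
    using sum.remove[OF Suc.prems x, of "lookup \<nu>"] by simp
  then show ?case using Suc.hyps(2) by simp
qed simp

text \<open>
  The dominance order, extended to arbitrary exponents on the left so that no sorting is needed.
\<close>

definition dom_by :: "exponent \<Rightarrow> exponent \<Rightarrow> bool" where
  "dom_by m \<mu> \<longleftrightarrow> part_size m = part_size \<mu> \<and>
     (\<forall>S. finite S \<longrightarrow> (\<Sum>i\<in>S. lookup m i) \<le> (\<Sum>i<card S. lookup \<mu> i))"

lemma dom_by_refl: "is_partition \<mu> \<Longrightarrow> dom_by \<mu> \<mu>"
  by (simp add: dom_by_def sum_partition_le)

lemma dom_by_map_key: "bij \<pi> \<Longrightarrow> dom_by m \<mu> \<Longrightarrow> dom_by (map_key \<pi> m) \<mu>"
proof (unfold dom_by_def part_size_map_key, safe)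
  fix S :: "nat set"
  assume b: "bij \<pi>" and "finite S" and *: "\<forall>S. finite S \<longrightarrow> (\<Sum>i\<in>S. lookup m i) \<le> (\<Sum>i<card S. lookup \<mu> i)"
  then have "(\<Sum>i\<in>\<pi> ` S. lookup m i) \<le> (\<Sum>i<card (\<pi> ` S). lookup \<mu> i)" by blast
  moreover have "inj_on \<pi> S" using b by (meson bij_is_inj inj_on_subset subset_UNIV)
  ultimately show "(\<Sum>i\<in>S. lookup (map_key \<pi> m) i) \<le> (\<Sum>i<card S. lookup \<mu> i)"
    by (simp add: sum.reindex card_image lookup_map_key bij_is_inj[OF b])
qed

lemma dom_by_perm: "perm_of m \<nu> \<Longrightarrow> dom_by \<nu> \<mu> \<Longrightarrow> dom_by m \<mu>"
  by (auto simp: perm_of_def dom_by_map_key)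

text \<open>The prefix sums of a decreasing sequence are its largest sums over sets of the same
  cardinality, so testing all finite sets asks no more than testing initial segments.\<close>

lemma dom_by_partition: "is_partition \<nu> \<Longrightarrow> dom_by \<nu> \<mu> \<longleftrightarrow> dominated \<nu> \<mu>"
  unfolding dom_by_def dominated_def
  by (metis card_lessThan finite_lessThan le_trans sum_partition_le)

lemma dom_by_add:
  "dom_by a \<mu> \<Longrightarrow> dom_by b \<nu> \<Longrightarrow> dom_by (a + b) (\<mu> + \<nu>)"
  by (simp add: dom_by_def part_size_add lookup_add sum.distrib add_mono)

lemma lookup_eqI_prefix_sums:
  fixes a b :: "exponent"
  assumes "\<And>k. (\<Sum>i<k. lookup a i) = (\<Sum>i<k. lookup b i)"
  shows "a = b"
proof (rule poly_mapping_eqI)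
  fix k
  show "lookup a k = lookup b k" using assms[of k] assms[of "Suc k"] by simp
qed

text \<open>The prefix inequalities for a and b add up to equalities, so each of them is tight. Thus
  a leading monomial of a product arises in one way only.\<close>

lemma dom_by_add_top:
  assumes "dom_by a \<mu>" "dom_by b \<nu>" "a + b = \<mu> + \<nu>"
  shows "a = \<mu> \<and> b = \<nu>"
proof -
  have "(\<Sum>i<k. lookup a i) \<le> (\<Sum>i<k. lookup \<mu> i)" "(\<Sum>i<k. lookup b i) \<le> (\<Sum>i<k. lookup \<nu> i)" for k
    using assms(1,2) unfolding dom_by_def by (metis card_lessThan finite_lessThan)+
  note bnd = this
  have tot: "(\<Sum>i<k. lookup a i) + (\<Sum>i<k. lookup b i) =
      (\<Sum>i<k. lookup \<mu> i) + (\<Sum>i<k. lookup \<nu> i)" for k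
    using assms(3) by (simp flip: sum.distrib lookup_add)
  have "(\<Sum>i<k. lookup a i) = (\<Sum>i<k. lookup \<mu> i) \<and>
      (\<Sum>i<k. lookup b i) = (\<Sum>i<k. lookup \<nu> i)" for k
    using bnd(1,2)[of k] tot[of k] by linarith
  then show ?thesis using lookup_eqI_prefix_sums by blast
qed

text \<open>
  The exponents occurring when \<open>D_\<alpha>\<close> acts on a monomial arise from moving units from one
  variable to another variable of smaller exponent; \<open>raise\<close> goes the opposite way.
\<close>

definition raise :: "nat \<Rightarrow> nat \<Rightarrow> nat \<Rightarrow> exponent \<Rightarrow> exponent" where
  "raise i j s m = (if lookup m j \<le> lookup m i then m + single i s - single j s
                    else m + single j s - single i s)"

lemma lookup_raise:
  "i \<noteq> j \<Longrightarrow> lookup (raise i j s m) k =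
    (if lookup m j \<le> lookup m i
     then (if k = i then lookup m i + s else if k = j then lookup m j - s else lookup m k)
     else (if k = j then lookup m j + s else if k = i then lookup m i - s else lookup m k))"
  by (auto simp: raise_def lookup_add lookup_minus lookup_single when_def)

text \<open>Calls p the position of the larger exponent and q that of the smaller one, which removes
  the case distinction of \<open>raise\<close> from the arguments below.\<close>

lemma raise_normal_form:
  assumes "i \<noteq> j" "1 \<le> s" "s \<le> min (lookup m i) (lookup m j)"
  obtains p q where "p \<noteq> q" "{p, q} = {i, j}" "lookup m q \<le> lookup m p" "s \<le> lookup m q"
    "\<And>k. lookup (raise i j s m) k =
       (if k = p then lookup m p + s else if k = q then lookup m q - s else lookup m k)"
proof (cases "lookup m j \<le> lookup m i")
  case True
  show ?thesis using that[of i j] True assms by (auto simp: lookup_raise)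
next
  case False
  show ?thesis using that[of j i] False assms by (auto simp: lookup_raise)
qed

lemma sum_two_points:
  fixes f g :: "nat \<Rightarrow> nat"
  assumes "finite S" "p \<in> S" "q \<in> S" "p \<noteq> q" "\<And>k. k \<noteq> p \<Longrightarrow> k \<noteq> q \<Longrightarrow> f k = g k"
  shows "sum f S + (g p + g q) = sum g S + (f p + f q)"
proof -
  have "sum f S = f p + (f q + sum f (S - {p} - {q}))" "sum g S = g p + (g q + sum g (S - {p} - {q}))"
    using sum.remove[of S p f] sum.remove[of S p g] sum.remove[of "S - {p}" q f]
      sum.remove[of "S - {p}" q g] assms(1-4) by simp_all
  moreover have "sum f (S - {p} - {q}) = sum g (S - {p} - {q})"
    using assms(5) by (intro sum.cong) auto
  ultimately show ?thesis by simp
qed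

lemma keys_raise_subset:
  assumes "i \<noteq> j" "keys m \<subseteq> S" "i \<in> S" "j \<in> S"
  shows "keys (raise i j s m) \<subseteq> S"
  using assms by (auto simp: subset_iff in_keys_iff lookup_raise split: if_splits)

lemma part_size_raise:
  assumes "i \<noteq> j" "1 \<le> s" "s \<le> min (lookup m i) (lookup m j)"
  shows "part_size (raise i j s m) = part_size m"
proof -
  obtain p q where pq: "p \<noteq> q" "{p, q} = {i, j}" "lookup m q \<le> lookup m p" "s \<le> lookup m q"
    and lk: "\<And>k. lookup (raise i j s m) k =
       (if k = p then lookup m p + s else if k = q then lookup m q - s else lookup m k)"
    using raise_normal_form[OF assms] by metis
  let ?S = "insert i (insert j (keys m))"
  have "keys (raise i j s m) \<subseteq> ?S" using assms(1) by (intro keys_raise_subset) auto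
  then have "part_size (raise i j s m) = (\<Sum>k\<in>?S. lookup (raise i j s m) k)"
    by (intro part_size_superset) auto
  moreover have "part_size m = (\<Sum>k\<in>?S. lookup m k)" by (intro part_size_superset) auto
  moreover have "p \<in> ?S" "q \<in> ?S" using pq by auto
  ultimately show ?thesis
    using sum_two_points[of ?S p q "lookup (raise i j s m)" "lookup m"] pq lk by simp
qed

text \<open>A potential for recursions along the dominance order: raising makes two exponents more
  unequal and so increases it, while the squared size bounds it.\<close>

definition square_sum :: "exponent \<Rightarrow> nat" where
  "square_sum m = (\<Sum>k\<in>keys m. lookup m k ^ 2)"

lemma square_sum_le: "square_sum m \<le> part_size m ^ 2"
proof -
  have "square_sum m \<le> (\<Sum>k\<in>keys m. lookup m k * part_size m)"
    unfolding square_sum_def power2_eq_square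
    by (intro sum_mono mult_mono lookup_le_part_size) auto
  also have "\<dots> = part_size m ^ 2"
    by (simp add: part_size_def power2_eq_square flip: sum_distrib_right)
  finally show ?thesis .
qed

lemma square_sum_raise:
  assumes "i \<noteq> j" "1 \<le> s" "s \<le> min (lookup m i) (lookup m j)"
  shows "square_sum m < square_sum (raise i j s m)"
proof -
  obtain p q where pq: "p \<noteq> q" "{p, q} = {i, j}" "lookup m q \<le> lookup m p" "s \<le> lookup m q"
    and lk: "\<And>k. lookup (raise i j s m) k =
       (if k = p then lookup m p + s else if k = q then lookup m q - s else lookup m k)"
    using raise_normal_form[OF assms] by metis
  let ?S = "insert i (insert j (keys m))"
  have sup: "square_sum a = (\<Sum>k\<in>?S. lookup a k ^ 2)" if "keys a \<subseteq> ?S" for a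
    unfolding square_sum_def using that by (intro sum.mono_neutral_left) (auto simp: in_keys_iff)
  have "keys (raise i j s m) \<subseteq> ?S" using assms(1) by (intro keys_raise_subset) auto
  note 1 = sup[OF this]
  have 2: "square_sum m = (\<Sum>k\<in>?S. lookup m k ^ 2)" by (intro sup) auto
  have pS: "p \<in> ?S" "q \<in> ?S" using pq by auto
  \<comment> \<open>With these parameters the sum of squares grows by 2s(e + s), which is
    positive.\<close>
  obtain d e where d: "lookup m q = s + d" "lookup m p = s + d + e"
    using that[of "lookup m q - s" "lookup m p - lookup m q"] pq(3,4) by simp
  have "lookup m p ^ 2 + lookup m q ^ 2 < (lookup m p + s) ^ 2 + (lookup m q - s) ^ 2"
    using assms(2) by (simp add: d power2_eq_square algebra_simps)
  then show ?thesis
    unfolding 1 2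
    using sum_two_points[of ?S p q "\<lambda>k. lookup (raise i j s m) k ^ 2" "\<lambda>k. lookup m k ^ 2"] pq lk pS
    by simp
qed

lemma square_sum_raise_measure:
  assumes "i \<noteq> j" "1 \<le> s" "s \<le> min (lookup m i) (lookup m j)" "dom_by m \<mu>"
  shows "part_size \<mu> ^ 2 - square_sum (raise i j s m) < part_size \<mu> ^ 2 - square_sum m"
proof -
  have "square_sum (raise i j s m) \<le> part_size \<mu> ^ 2"
    using square_sum_le[of "raise i j s m"] part_size_raise[OF assms(1-3)] assms(4)
    by (simp add: dom_by_def)
  then show ?thesis using square_sum_raise[OF assms(1-3)] by (intro diff_less_mono2) auto
qed

text \<open>Undoing a raise goes down in the dominance order. Only a set containing q but not p is
  delicate: exchanging q for p does not decrease the sum for m, and on the exchanged set the raised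
  exponent is at least as large.\<close>

lemma dom_by_raise:
  assumes "i \<noteq> j" "1 \<le> s" "s \<le> min (lookup m i) (lookup m j)" and d: "dom_by (raise i j s m) \<mu>"
  shows "dom_by m \<mu>"
proof -
  obtain p q where pq: "p \<noteq> q" "{p, q} = {i, j}" "lookup m q \<le> lookup m p" "s \<le> lookup m q"
    and lk: "\<And>k. lookup (raise i j s m) k =
       (if k = p then lookup m p + s else if k = q then lookup m q - s else lookup m k)"
    using raise_normal_form[OF assms(1-3)] by metis
  let ?m = "raise i j s m"
  have "(\<Sum>k\<in>S. lookup m k) \<le> (\<Sum>k<card S. lookup \<mu> k)" if S: "finite S" for S
  proof -
    have *: "(\<Sum>k\<in>T. lookup ?m k) \<le> (\<Sum>k<card T. lookup \<mu> k)" if "finite T" for T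
      using d that by (simp add: dom_by_def)
    consider "q \<notin> S" | "p \<in> S" "q \<in> S" | "q \<in> S" "p \<notin> S" by blast
    then show ?thesis
    proof cases
      case 1
      have "(\<Sum>k\<in>S. lookup m k) \<le> (\<Sum>k\<in>S. lookup ?m k)"
        using 1 by (intro sum_mono) (auto simp: lk)
      then show ?thesis using *[OF S] by simp
    next
      case 2
      have "(\<Sum>k\<in>S. lookup m k) = (\<Sum>k\<in>S. lookup ?m k)"
        using sum_two_points[of S p q "lookup ?m" "lookup m"] 2 S pq lk by simp
      then show ?thesis using *[OF S] by simp
    next
      case 3
      let ?T = "insert p (S - {q})"
      have cT: "card ?T = card S" using 3 card.remove[OF S 3(1)] S by simp
      have "(\<Sum>k\<in>S. lookup m k) \<le> lookup m p + (\<Sum>k\<in>S - {q}. lookup m k)"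
        using sum.remove[OF S 3(1), of "lookup m"] pq by simp
      also have "\<dots> = (\<Sum>k\<in>?T. lookup m k)" using 3 S by simp
      also have "\<dots> \<le> (\<Sum>k\<in>?T. lookup ?m k)"
        using pq by (intro sum_mono) (auto simp: lk)
      also have "\<dots> \<le> (\<Sum>k<card ?T. lookup \<mu> k)" using S by (intro *) auto
      finally show ?thesis by (simp add: cT)
    qed
  qed
  then show ?thesis using d part_size_raise[OF assms(1-3)] by (simp add: dom_by_def)
qed

lemma raise_map_key:
  assumes "bij \<pi>" "i \<noteq> j"
  shows "raise i j s (map_key \<pi> m) = map_key \<pi> (raise (\<pi> i) (\<pi> j) s m)"
proof (rule poly_mapping_eqI)
  fix k
  have "\<pi> i \<noteq> \<pi> j" "\<And>x. \<pi> k = \<pi> x \<longleftrightarrow> k = x" using assms by (auto simp: bij_def inj_eq)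
  then show "lookup (raise i j s (map_key \<pi> m)) k =
      lookup (map_key \<pi> (raise (\<pi> i) (\<pi> j) s m)) k"
    using assms(2) by (simp add: lookup_raise lookup_map_key bij_is_inj[OF assms(1)])
qed

text \<open>The violated inequality is that for the first \<open>l = min p q\<close> positions
  together with p: the first l entries are unchanged, and the new entry at p exceeds
  \<open>lookup \<mu> l\<close>. Hence nothing is raised from the leading exponent into the
  support.\<close>

lemma raise_partition_not_dom:
  assumes "is_partition \<mu>" "i \<noteq> j" "1 \<le> s" "s \<le> min (lookup \<mu> i) (lookup \<mu> j)"
  shows "\<not> dom_by (raise i j s \<mu>) \<mu>"
proof
  assume d: "dom_by (raise i j s \<mu>) \<mu>"
  obtain p q where pq: "p \<noteq> q" "{p, q} = {i, j}" "lookup \<mu> q \<le> lookup \<mu> p" "s \<le> lookup \<mu> q"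
    and lk: "\<And>k. lookup (raise i j s \<mu>) k =
       (if k = p then lookup \<mu> p + s else if k = q then lookup \<mu> q - s else lookup \<mu> k)"
    using raise_normal_form[OF assms(2-4)] by metis
  define l where "l = min p q"
  have lp: "lookup \<mu> l \<le> lookup \<mu> p"
    using pq by (auto simp: l_def min_def)
  have l: "p \<notin> {..<l}" "q \<notin> {..<l}" by (auto simp: l_def)
  let ?S = "insert p {..<l}"
  have cS: "card ?S = Suc l" using l by simp
  have "(\<Sum>k\<in>?S. lookup (raise i j s \<mu>) k) \<le> (\<Sum>k<card ?S. lookup \<mu> k)"
    using d by (simp add: dom_by_def)
  moreover have "(\<Sum>k\<in>?S. lookup (raise i j s \<mu>) k) = lookup \<mu> p + s + (\<Sum>k<l. lookup (raise i j s \<mu>) k)"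
    using l by (simp add: lk)
  moreover have "(\<Sum>k<l. lookup (raise i j s \<mu>) k) = (\<Sum>k<l. lookup \<mu> k)"
    using l by (intro sum.cong) (auto simp: lk)
  ultimately show False using lp assms(3) by (simp add: cS)
qed

lemma raise_perm_not_dom:
  assumes "is_partition \<mu>" "perm_of m \<mu>" "i \<noteq> j" "1 \<le> s" "s \<le> min (lookup m i) (lookup m j)"
  shows "\<not> dom_by (raise i j s m) \<mu>"
proof
  assume d: "dom_by (raise i j s m) \<mu>"
  obtain \<pi> where b: "bij \<pi>" and m: "m = map_key \<pi> \<mu>"
    using assms(2) by (auto simp: perm_of_def)
  have "dom_by (raise (\<pi> i) (\<pi> j) s \<mu>) \<mu>"
    using dom_by_map_key[OF bij_imp_bij_inv[OF b] d] b assms(3) by (simp add: m raise_map_key)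
  moreover have "\<pi> i \<noteq> \<pi> j" using b assms(3) by (auto simp: bij_def inj_eq)
  ultimately show False
    using raise_partition_not_dom[OF assms(1), of "\<pi> i" "\<pi> j" s] assms(4,5) b
    by (simp add: m lookup_map_key bij_is_inj)
qed

section \<open>Eigenvalues\<close>

lemma lookup_conjugate: "lookup (conjugate m) k = card {j. k < lookup m j}"
  by (simp add: conjugate.rep_eq)

lemma finite_greater_lookup: "finite {j. k < lookup m j}" for k :: nat
  by (rule finite_subset[OF _ finite_keys[of m]]) (auto simp: in_keys_iff)

lemma greater_lookup_partition:
  assumes "is_partition \<nu>"
  shows "{j. k < lookup \<nu> j} = {..<lookup (conjugate \<nu>) k}"
proof -
  have "{j. k < lookup \<nu> j} = {..<card {j. k < lookup \<nu> j}}"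
    by (rule finite_downclosed_nat[OF finite_greater_lookup])
      (use partition_antimono[OF assms] in \<open>auto intro: less_le_trans\<close>)
  then show ?thesis by (simp add: lookup_conjugate)
qed

lemma bstat_conjugate_superset:
  assumes "\<And>j. lookup m j \<le> M"
  shows "bstat (conjugate m) = (\<Sum>k<M. lookup (conjugate m) k choose 2)"
  unfolding bstat_def
proof (rule sum.mono_neutral_left)
  show "keys (conjugate m) \<subseteq> {..<M}"
  proof
    fix k assume "k \<in> keys (conjugate m)"
    then have "{j. k < lookup m j} \<noteq> {}" by (force simp: in_keys_iff lookup_conjugate)
    then show "k \<in> {..<M}" using assms by (auto intro: less_le_trans)
  qed
qed (auto simp: in_keys_iff)

lemma less_if_keys_subset: "keys m \<subseteq> {..<N} \<Longrightarrow> k < lookup m x \<Longrightarrow> x < N" for k :: nat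
  by (auto simp: subset_iff in_keys_iff)

lemma two_choose_two: "2 * (n choose 2) = n * (n - 1)"
proof -
  have "even (n * (n - 1))" by (cases n) auto
  then show ?thesis by (simp add: choose_two)
qed

text \<open>Counting by levels: column k contributes the ordered pairs of distinct rows longer than
  k, and a pair i, j is counted once for each k below the minimum of its two entries.\<close>

lemma bstat_conjugate_pairs:
  assumes "keys m \<subseteq> {..<N}"
  shows "2 * bstat (conjugate m) = (\<Sum>i<N. \<Sum>j\<in>{..<N} - {i}. min (lookup m i) (lookup m j))"
proof -
  let ?M = "part_size m"
  let ?X = "\<lambda>k. {j. k < lookup m j}"
  have X: "?X k \<subseteq> {..<N}" for k using assms by (auto intro: less_if_keys_subset)
  have c: "2 * (card A choose 2) = (\<Sum>i<N. \<Sum>j\<in>{..<N} - {i}. of_bool (i \<in> A) * of_bool (j \<in> A))"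
    if A: "A \<subseteq> {..<N}" for A
  proof -
    have fA: "finite A" using A finite_subset by blast
    have cd: "card (A - {i}) = (\<Sum>j\<in>{..<N} - {i}. of_bool (j \<in> A))" for i
    proof -
      have "card (A - {i}) = (\<Sum>j\<in>A - {i}. 1)" by simp
      also have "\<dots> = (\<Sum>j\<in>{..<N} - {i}. of_bool (j \<in> A))"
        using A by (intro sum.mono_neutral_cong_left) auto
      finally show ?thesis .
    qed
    have "2 * (card A choose 2) = card A * (card A - 1)" by (rule two_choose_two)
    also have "\<dots> = (\<Sum>i\<in>A. card (A - {i}))" using fA by simp
    also have "\<dots> = (\<Sum>i<N. of_bool (i \<in> A) * card (A - {i}))"
      using A by (intro sum.mono_neutral_cong_left) auto
    also have "\<dots> = (\<Sum>i<N. \<Sum>j\<in>{..<N} - {i}. of_bool (i \<in> A) * of_bool (j \<in> A))"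
      by (simp only: cd sum_distrib_left)
    finally show ?thesis .
  qed
  have mn: "(\<Sum>k<?M. of_bool (i \<in> ?X k) * of_bool (j \<in> ?X k)) = min (lookup m i) (lookup m j)" for i j
  proof -
    have "(\<Sum>k<?M. of_bool (i \<in> ?X k) * of_bool (j \<in> ?X k)) =
        (\<Sum>k<?M. of_bool (k < min (lookup m i) (lookup m j)) :: nat)"
      by (intro sum.cong) auto
    also have "\<dots> = (\<Sum>k<min (lookup m i) (lookup m j). 1)"
      using lookup_le_part_size[of m i] by (intro sum.mono_neutral_cong_right) auto
    finally show ?thesis by simp
  qed
  have "2 * bstat (conjugate m) = (\<Sum>k<?M. 2 * (card (?X k) choose 2))"
    by (simp add: bstat_conjugate_superset[OF lookup_le_part_size] lookup_conjugate sum_distrib_left)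
  also have "\<dots> = (\<Sum>k<?M. \<Sum>i<N. \<Sum>j\<in>{..<N} - {i}. of_bool (i \<in> ?X k) * of_bool (j \<in> ?X k))"
    by (simp only: c[OF X])
  also have "\<dots> = (\<Sum>i<N. \<Sum>k<?M. \<Sum>j\<in>{..<N} - {i}. of_bool (i \<in> ?X k) * of_bool (j \<in> ?X k))"
    by (rule sum.swap)
  also have "\<dots> = (\<Sum>i<N. \<Sum>j\<in>{..<N} - {i}. \<Sum>k<?M. of_bool (i \<in> ?X k) * of_bool (j \<in> ?X k))"
    by (intro sum.cong refl sum.swap)
  also have "\<dots> = (\<Sum>i<N. \<Sum>j\<in>{..<N} - {i}. min (lookup m i) (lookup m j))"
    by (simp only: mn)
  finally show ?thesis .
qed

text \<open>Maximum and minimum of a pair add up to its sum. The maxima appear as the diagonal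
  coefficients of D_1 once its terms are grouped in pairs of variables.\<close>

lemma bstat_conjugate_max:
  assumes "keys m \<subseteq> {..<N}"
  shows "(\<Sum>i<N. \<Sum>j\<in>{..<N} - {i}. max (lookup m i) (lookup m j)) + 2 * bstat (conjugate m)
    = 2 * (N - 1) * part_size m"
proof -
  have ps: "part_size m = (\<Sum>i<N. lookup m i)" by (rule part_size_superset) (use assms in auto)
  have sw: "(\<Sum>j\<in>{..<N} - {i}. lookup m j) + lookup m i = part_size m" if "i < N" for i
    using that sum.remove[of "{..<N}" i "lookup m"] ps by simp
  have "(\<Sum>i<N. \<Sum>j\<in>{..<N} - {i}. max (lookup m i) (lookup m j)) + 2 * bstat (conjugate m)
    = (\<Sum>i<N. \<Sum>j\<in>{..<N} - {i}. lookup m i + lookup m j)"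
    unfolding bstat_conjugate_pairs[OF assms] sum.distrib[symmetric]
    by (intro sum.cong refl) (simp add: max_def min_def)
  also have "\<dots> = (\<Sum>i<N. (N - 1) * lookup m i + (\<Sum>j\<in>{..<N} - {i}. lookup m j))"
    by (simp add: sum.distrib)
  finally have 1: "(\<Sum>i<N. \<Sum>j\<in>{..<N} - {i}. max (lookup m i) (lookup m j)) + 2 * bstat (conjugate m)
    = (N - 1) * part_size m + (\<Sum>i<N. \<Sum>j\<in>{..<N} - {i}. lookup m j)"
    by (simp add: sum.distrib ps sum_distrib_left)
  have "(\<Sum>i<N. \<Sum>j\<in>{..<N} - {i}. lookup m j) + part_size m = N * part_size m"
    unfolding ps by (subst sum.distrib[symmetric]) (simp add: sw ps)
  then have "(\<Sum>i<N. \<Sum>j\<in>{..<N} - {i}. lookup m j) = (N - 1) * part_size m"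
    by (cases N) auto
  with 1 show ?thesis by simp
qed

text \<open>A column of height h contributes \<open>h choose 2\<close>, the sum of its row indices
  0, ..., h - 1; summing by rows instead gives a form linear in the parts, from which additivity
  follows.\<close>

lemma bstat_conjugate_partition:
  assumes "is_partition \<nu>" "keys \<nu> \<subseteq> {..<N}"
  shows "bstat (conjugate \<nu>) = (\<Sum>j<N. j * lookup \<nu> j)"
proof -
  let ?M = "part_size \<nu>"
  have inner: "(\<Sum>k<?M. of_bool (k < lookup \<nu> j) * j) = j * lookup \<nu> j" for j
  proof -
    have "(\<Sum>k<?M. of_bool (k < lookup \<nu> j) * j) = (\<Sum>k<lookup \<nu> j. j)"
      using lookup_le_part_size[of \<nu> j] by (intro sum.mono_neutral_cong_right) auto
    also have "\<dots> = j * lookup \<nu> j" by simp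
    finally show ?thesis .
  qed
  have "bstat (conjugate \<nu>) = (\<Sum>k<?M. \<Sum>j<lookup (conjugate \<nu>) k. j)"
    by (simp add: bstat_conjugate_superset[OF lookup_le_part_size] gauss_sum_nat choose_two
        lessThan_atLeast0 Sum_Ico_nat)
  also have "\<dots> = (\<Sum>k<?M. \<Sum>j<N. of_bool (k < lookup \<nu> j) * j)"
  proof (rule sum.cong[OF refl], rule sum.mono_neutral_cong_left)
    fix k :: nat
    show "{..<lookup (conjugate \<nu>) k} \<subseteq> {..<N}"
      using assms(2) by (auto simp: greater_lookup_partition[OF assms(1), symmetric] intro: less_if_keys_subset)
    show "\<forall>j\<in>{..<N} - {..<lookup (conjugate \<nu>) k}. of_bool (k < lookup \<nu> j) * j = 0"
      by (auto simp: greater_lookup_partition[OF assms(1), symmetric])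
    show "j = of_bool (k < lookup \<nu> j) * j" if "j \<in> {..<lookup (conjugate \<nu>) k}" for j
      using that by (auto simp: greater_lookup_partition[OF assms(1), symmetric])
  qed simp
  also have "\<dots> = (\<Sum>j<N. \<Sum>k<?M. of_bool (k < lookup \<nu> j) * j)" by (rule sum.swap)
  also have "\<dots> = (\<Sum>j<N. j * lookup \<nu> j)" by (simp only: inner)
  finally show ?thesis .
qed

lemma bstat_conjugate_add:
  assumes "is_partition \<mu>" "is_partition \<nu>"
  shows "bstat (conjugate (\<mu> + \<nu>)) = bstat (conjugate \<mu>) + bstat (conjugate \<nu>)"
proof -
  obtain N where N: "keys (\<mu> + \<nu>) \<subseteq> {..<N}" using keys_below_bound by blast
  then show ?thesis
    using assms partition_add[OF assms]
    by (simp add: bstat_conjugate_partition[of _ N] keys_add_exponent lookup_add distrib_left sum.distrib)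
qed

lemma sum_prefix_sums:
  "(\<Sum>j<N. j * f j) + (\<Sum>k<N. \<Sum>j<Suc k. f j) = N * (\<Sum>j<N. f j :: nat)"
  by (induction N) (auto simp: algebra_simps)

text \<open>Summation by parts turns the row-weighted sum into a constant minus the sum of all
  prefix sums, so a single strict prefix inequality decides. This is what separates the eigenvalues
  of D_1.\<close>

lemma bstat_conjugate_strict_mono:
  assumes "is_partition \<mu>" "is_partition \<nu>" "dominated \<nu> \<mu>" "\<nu> \<noteq> \<mu>"
  shows "bstat (conjugate \<mu>) < bstat (conjugate \<nu>)"
proof -
  obtain N where N: "keys (\<mu> + \<nu>) \<subseteq> {..<N}" using keys_below_bound by blast
  then have N: "keys \<mu> \<subseteq> {..<N}" "keys \<nu> \<subseteq> {..<N}" by (auto simp: keys_add_exponent)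
  have tail: "(\<Sum>j<k. lookup m j) = part_size m" if "keys m \<subseteq> {..<N}" "N \<le> k" for k m
    using that by (intro part_size_superset[symmetric]) auto
  have le: "(\<Sum>j<k. lookup \<nu> j) \<le> (\<Sum>j<k. lookup \<mu> j)" for k
    using assms(3) by (simp add: dominated_def)
  have "\<exists>k<N. (\<Sum>j<Suc k. lookup \<nu> j) \<noteq> (\<Sum>j<Suc k. lookup \<mu> j)"
  proof (rule ccontr)
    assume *: "\<not> (\<exists>k<N. (\<Sum>j<Suc k. lookup \<nu> j) \<noteq> (\<Sum>j<Suc k. lookup \<mu> j))"
    have "(\<Sum>j<k. lookup \<nu> j) = (\<Sum>j<k. lookup \<mu> j)" for k
    proof (cases "k \<le> N")
      case True
      then show ?thesis using * by (cases k) (auto simp del: sum.lessThan_Suc)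
    next
      case False
      then show ?thesis using tail[OF N(1), of k] tail[OF N(2), of k] assms(3) by (simp add: dominated_def)
    qed
    then show False using lookup_eqI_prefix_sums assms(4) by blast
  qed
  then have "\<exists>k\<in>{..<N}. (\<Sum>j<Suc k. lookup \<nu> j) < (\<Sum>j<Suc k. lookup \<mu> j)"
    using le by (auto simp del: sum.lessThan_Suc intro!: bexI order.not_eq_order_implies_strict)
  then have "(\<Sum>k<N. \<Sum>j<Suc k. lookup \<nu> j) < (\<Sum>k<N. \<Sum>j<Suc k. lookup \<mu> j)"
    using le by (intro sum_strict_mono_ex1) (auto simp del: sum.lessThan_Suc)
  moreover have eq: "(\<Sum>j<N. lookup \<nu> j) = (\<Sum>j<N. lookup \<mu> j)"
    using tail[OF N(1), of N] tail[OF N(2), of N] assms(3) by (simp add: dominated_def)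
  ultimately show ?thesis
    using sum_prefix_sums[of "lookup \<mu>" N] sum_prefix_sums[of "lookup \<nu>" N, unfolded eq]
    unfolding bstat_conjugate_partition[OF assms(1) N(1)] bstat_conjugate_partition[OF assms(2) N(2)]
    by linarith
qed

lemma bij_betw_keys_map_key:
  assumes "bij (\<pi> :: nat \<Rightarrow> nat)"
  shows "bij_betw \<pi> (keys (map_key \<pi> m)) (keys m)"
  using assms unfolding keys_map_key[OF bij_is_inj[OF assms]] bij_betw_def
  by (auto simp: inj_on_def bij_def surj_image_vimage_eq)

lemma bstat_perm: "perm_of m \<nu> \<Longrightarrow> bstat m = bstat \<nu>"
proof -
  assume "perm_of m \<nu>"
  then obtain \<pi> where b: "bij \<pi>" and m: "m = map_key \<pi> \<nu>" by (auto simp: perm_of_def)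
  show ?thesis
    unfolding bstat_def m lookup_map_key[OF bij_is_inj[OF b]]
    by (rule sum.reindex_bij_betw[OF bij_betw_keys_map_key[OF b]])
qed

lemma conjugate_perm:
  assumes "perm_of m \<nu>"
  shows "conjugate m = conjugate \<nu>"
proof (rule poly_mapping_eqI)
  fix k
  obtain \<pi> where b: "bij \<pi>" and m: "m = map_key \<pi> \<nu>"
    using assms by (auto simp: perm_of_def)
  have "bij_betw \<pi> {j. k < lookup m j} {j. k < lookup \<nu> j}"
    unfolding bij_betw_def
  proof
    show "inj_on \<pi> {j. k < lookup m j}" using b by (auto simp: bij_def inj_on_def)
    show "\<pi> ` {j. k < lookup m j} = {j. k < lookup \<nu> j}"
      using b by (auto simp: m lookup_map_key bij_is_inj image_iff) (metis bij_pointE)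
  qed
  then show "lookup (conjugate m) k = lookup (conjugate \<nu>) k"
    by (simp add: lookup_conjugate bij_betw_same_card)
qed

lemma bstat_conjugate_dom:
  assumes "is_partition \<mu>" "dom_by m \<mu>" "\<not> perm_of m \<mu>"
  shows "bstat (conjugate \<mu>) < bstat (conjugate m)"
proof -
  obtain \<nu> where \<nu>: "is_partition \<nu>" "perm_of \<nu> m" using exists_sorted by blast
  then have "dominated \<nu> \<mu>" using dom_by_perm assms(2) dom_by_partition by blast
  moreover have "\<nu> \<noteq> \<mu>" using \<nu>(2) assms(3) perm_of_sym by blast
  ultimately show ?thesis
    using bstat_conjugate_strict_mono[OF assms(1) \<nu>(1)] conjugate_perm[OF \<nu>(2)] by simp
qed

text \<open>
  The parameter \<open>t\<close> is \<open>\<alpha>\<close> for the eigenvalues of \<open>D_\<alpha>\<close>, and \<open>0\<close> for those of \<open>D_1\<close>.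
\<close>

definition eig :: "rat ratfun \<Rightarrow> nat \<Rightarrow> exponent \<Rightarrow> rat ratfun" where
  "eig t N m = t * of_nat (bstat m) - of_nat (bstat (conjugate m)) + (of_nat N - 1) * of_nat (part_size m)"

lemma jack_eigenvalue_eig: "jack_eigenvalue N \<mu> = eig alpha N \<mu>"
  by (simp add: jack_eigenvalue_def eig_def)

lemma eig_perm: "perm_of m \<nu> \<Longrightarrow> eig t N m = eig t N \<nu>"
  by (simp add: eig_def bstat_perm conjugate_perm part_size_perm)

text \<open>Differences of eigenvalues within one degree do not depend on N, so one family of
  coefficients serves every number of variables.\<close>

lemma eig_diff: "part_size m = part_size \<mu> \<Longrightarrow> eig t N m - eig t N \<mu> = eig t 0 m - eig t 0 \<mu>"
  by (simp add: eig_def)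

lemma no_pole_eig: "no_pole_at_0 t \<Longrightarrow> no_pole_at_0 (eig t N m)"
  unfolding eig_def by (intro no_pole_intros)

text \<open>At \<alpha> = 0 only the strictly monotone statistic \<open>bstat (conjugate _)\<close>
  survives. The difference is therefore a unit of the local ring, and dividing by it creates no
  pole.\<close>

lemma res0_eig_diff:
  assumes "is_partition \<mu>" "dom_by m \<mu>" "\<not> perm_of m \<mu>" "t \<in> vanishing 1"
  shows "res0 (eig t N m - eig t N \<mu>) \<noteq> 0"
proof -
  have "part_size m = part_size \<mu>" using assms(2) by (simp add: dom_by_def)
  then have "eig t N m - eig t N \<mu> =
      t * (of_nat (bstat m) - of_nat (bstat \<mu>)) - (of_nat (bstat (conjugate m)) - of_nat (bstat (conjugate \<mu>)))"
    by (simp add: eig_def algebra_simps)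
  moreover have "no_pole_at_0 t" "res0 t = 0"
    using assms(4) by (auto simp: vanishing_no_pole vanishing_res0)
  ultimately have "res0 (eig t N m - eig t N \<mu>) =
      - (of_nat (bstat (conjugate m)) - of_nat (bstat (conjugate \<mu>)))"
    by (simp add: res0_diff res0_mult no_pole_intros)
  then show ?thesis using bstat_conjugate_dom[OF assms(1-3)] by simp
qed

section \<open>The Laplace--Beltrami operator on coefficients\<close>

text \<open>The off-diagonal part of D_1 for the variables i and j. The weight of each term is the
  difference of the two exponents after raising.\<close>

definition raise_pair :: "(exponent \<Rightarrow> 'a::comm_ring_1) \<Rightarrow> nat \<Rightarrow> nat \<Rightarrow> exponent \<Rightarrow> 'a" where
  "raise_pair F i j m = (\<Sum>s\<in>{1..min (lookup m i) (lookup m j)}.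
     of_nat (max (lookup m i) (lookup m j) - min (lookup m i) (lookup m j) + 2 * s) * F (raise i j s m))"

definition raise_sum :: "(exponent \<Rightarrow> 'a::comm_ring_1) \<Rightarrow> exponent \<Rightarrow> 'a" where
  "raise_sum F m = (\<Sum>i\<in>keys m. \<Sum>j\<in>keys m - {i}. raise_pair F i j m)"

text \<open>The operator read on coefficients: the eigenvalue on the diagonal, plus contributions
  from raised exponents. The division by 2 is there because \<open>raise_sum\<close> runs over
  ordered pairs.\<close>

definition lap :: "rat ratfun \<Rightarrow> nat \<Rightarrow> (exponent \<Rightarrow> rat ratfun) \<Rightarrow> exponent \<Rightarrow> rat ratfun" where
  "lap t N F m = eig t N m * F m + raise_sum F m / 2"

lemma raise_sum_cong:
  assumes "\<And>i j s. i \<noteq> j \<Longrightarrow> 1 \<le> s \<Longrightarrow> s \<le> min (lookup m i) (lookup m j) \<Longrightarrow>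
      F (raise i j s m) = G (raise i j s m)"
  shows "raise_sum F m = raise_sum G m"
  unfolding raise_sum_def raise_pair_def using assms by (intro sum.cong refl) auto

lemma raise_sum_eq_0:
  assumes "\<And>i j s. i \<noteq> j \<Longrightarrow> 1 \<le> s \<Longrightarrow> s \<le> min (lookup m i) (lookup m j) \<Longrightarrow>
      F (raise i j s m) = 0"
  shows "raise_sum F m = 0"
  unfolding raise_sum_def raise_pair_def using assms by (intro sum.neutral ballI) auto

lemma raise_sum_map_key:
  assumes b: "bij \<pi>"
  shows "raise_sum F (map_key \<pi> m) = raise_sum (\<lambda>x. F (map_key \<pi> x)) m"
proof -
  let ?k = "map_key \<pi>"
  have inj: "\<pi> i = \<pi> j \<longleftrightarrow> i = j" for i j using b by (auto simp: bij_def inj_eq)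
  have bb: "bij_betw \<pi> (keys (?k m) - {i}) (keys m - {\<pi> i})" for i
    using bij_betw_keys_map_key[OF b, of m] inj unfolding bij_betw_def inj_on_def by auto
  let ?F = "\<lambda>x. F (?k x)"
  have "raise_sum F (?k m) = (\<Sum>i\<in>keys (?k m). \<Sum>j\<in>keys (?k m) - {i}. raise_pair ?F (\<pi> i) (\<pi> j) m)"
    unfolding raise_sum_def raise_pair_def
    by (intro sum.cong refl) (auto simp: lookup_map_key bij_is_inj[OF b] raise_map_key[OF b])
  also have "\<dots> = (\<Sum>i\<in>keys (?k m). \<Sum>j\<in>keys m - {\<pi> i}. raise_pair ?F (\<pi> i) j m)"
    by (rule sum.cong[OF refl]) (rule sum.reindex_bij_betw[OF bb])
  also have "\<dots> = raise_sum ?F m"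
    unfolding raise_sum_def by (rule sum.reindex_bij_betw[OF bij_betw_keys_map_key[OF b]])
  finally show ?thesis .
qed

lemma half_no_pole: "no_pole_at_0 (1 / 2 :: rat ratfun)"
proof -
  have "res0 (of_nat 2 :: rat ratfun) \<noteq> 0" by (subst res0_of_nat) simp
  then have "no_pole_at_0 (inverse (of_nat 2 :: rat ratfun))"
    by (intro no_pole_inverse no_pole_of_nat)
  then show ?thesis by (simp add: inverse_eq_divide)
qed

text \<open>
  Uniqueness of the Jack polynomials is the case \<open>M = {0}\<close>. The other cases bound the coefficients
  of approximate eigenfunctions.
\<close>

lemma triangular_solution_in:
  assumes part: "is_partition \<mu>" and t: "t \<in> vanishing 1"
    and supp: "\<And>m. F m \<noteq> 0 \<Longrightarrow> dom_by m \<mu>"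
    and top: "\<And>m. perm_of m \<mu> \<Longrightarrow> F m \<in> M"
    and resid: "\<And>m. keys m \<subseteq> {..<N} \<Longrightarrow> lap t N F m - eig t N \<mu> * F m \<in> M"
    and zero: "0 \<in> M" and add: "\<And>x y. x \<in> M \<Longrightarrow> y \<in> M \<Longrightarrow> x + y \<in> M"
    and mult: "\<And>c x. no_pole_at_0 c \<Longrightarrow> x \<in> M \<Longrightarrow> c * x \<in> M"
    and km: "keys m \<subseteq> {..<N}"
  shows "F m \<in> M"
  using km
proof (induction "part_size \<mu> ^ 2 - square_sum m" arbitrary: m rule: less_induct)
  case less
  consider "perm_of m \<mu>" | "\<not> dom_by m \<mu>" | "dom_by m \<mu>" "\<not> perm_of m \<mu>" by blast
  then show ?case
  proof cases
    case 3
    have sum: "sum f A \<in> M" if "\<And>i. i \<in> A \<Longrightarrow> f i \<in> M" for f :: "nat \<Rightarrow> _" and A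
      using that by (induction A rule: infinite_finite_induct) (auto simp: zero add)
    have raised: "F (raise i j s m) \<in> M"
      if "i \<noteq> j" "1 \<le> s" "s \<le> min (lookup m i) (lookup m j)" for i j s
    proof -
      have "i \<in> keys m" "j \<in> keys m" using that by (auto simp: in_keys_iff)
      then have "keys (raise i j s m) \<subseteq> {..<N}"
        using less.prems that(1) by (intro keys_raise_subset) auto
      then show ?thesis by (intro less.hyps square_sum_raise_measure that 3)
    qed
    have rs: "raise_sum F m \<in> M"
      unfolding raise_sum_def raise_pair_def by (intro sum mult no_pole_of_nat raised) auto
    let ?d = "eig t N m - eig t N \<mu>"
    have nt: "no_pole_at_0 t" using t by (rule vanishing_no_pole)
    have nz: "res0 ?d \<noteq> 0" using res0_eig_diff[OF part 3 t] .
    have nd: "no_pole_at_0 ?d" by (intro no_pole_diff no_pole_eig nt)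
    have "?d \<noteq> 0" using nz by force
    moreover have "lap t N F m - eig t N \<mu> * F m = ?d * F m + (1 / 2) * raise_sum F m"
      by (simp add: lap_def algebra_simps)
    \<comment> \<open>The residual identity solved for \<open>F m\<close>. The coefficient
      \<open>?d\<close> is a unit, and M is closed under addition and regular factors, so the
      right-hand side stays in M.\<close>
    ultimately have "F m = inverse ?d * ((lap t N F m - eig t N \<mu> * F m) + (- (1 / 2)) * raise_sum F m)"
      by simp
    moreover have "\<dots> \<in> M"
      by (intro mult add resid less.prems rs no_pole_inverse(1)[OF nd nz] no_pole_uminus half_no_pole)
    ultimately show ?thesis by simp
  next
    case 2
    then have "F m = 0" using supp by blast
    then show ?thesis using zero by simp
  qed (rule top)
qed

section \<open>Existence of Jack symmetric functions\<close>

text \<open>The eigenvalue equation solved for the coefficient at m, starting from the normalization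
  \<open>hook_alpha\<close> on the orbit of \<mu>. The sum is \<open>raise_sum\<close> written out
  so that the recursive call keeps its index bounds, and the guard \<open>dom_by m \<mu>\<close>
  bounds the potential \<open>square_sum\<close>; both enter the termination proof. Eigenvalues are
  taken at N = 0 because only their difference matters.\<close>

function jack_coeff :: "exponent \<Rightarrow> exponent \<Rightarrow> rat ratfun" where
  "jack_coeff \<mu> m =
     (if perm_of m \<mu> then hook_alpha \<mu>
      else if dom_by m \<mu> then
        (\<Sum>i\<in>keys m. \<Sum>j\<in>keys m - {i}. \<Sum>s\<in>{1..min (lookup m i) (lookup m j)}.
          of_nat (max (lookup m i) (lookup m j) - min (lookup m i) (lookup m j) + 2 * s) *
          jack_coeff \<mu> (raise i j s m)) / (2 * (eig alpha 0 \<mu> - eig alpha 0 m))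
      else 0)"
  by pat_completeness auto
termination
proof (relation "measure (\<lambda>(\<mu>, m). part_size \<mu> ^ 2 - square_sum m)")
  fix \<mu> m :: "exponent" and i j s
  assume *: "dom_by m \<mu>" "i \<in> keys m" "j \<in> keys m - {i}" "s \<in> {1..min (lookup m i) (lookup m j)}"
  then show "((\<mu>, raise i j s m), \<mu>, m) \<in> measure (\<lambda>(\<mu>, m). part_size \<mu> ^ 2 - square_sum m)"
    using square_sum_raise_measure[of i j s m \<mu>] by simp
qed simp

declare jack_coeff.simps [simp del]

lemma jack_coeff_eq:
  "jack_coeff \<mu> m = (if perm_of m \<mu> then hook_alpha \<mu>
     else if dom_by m \<mu> then raise_sum (jack_coeff \<mu>) m / (2 * (eig alpha 0 \<mu> - eig alpha 0 m))
     else 0)"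
  by (subst jack_coeff.simps) (simp add: raise_sum_def raise_pair_def)

lemma jack_coeff_perm: "perm_of m \<mu> \<Longrightarrow> jack_coeff \<mu> m = hook_alpha \<mu>"
  by (simp add: jack_coeff_eq)

lemma jack_coeff_support: "is_partition \<mu> \<Longrightarrow> jack_coeff \<mu> m \<noteq> 0 \<Longrightarrow> dom_by m \<mu>"
  by (auto simp: jack_coeff_eq[of \<mu> m] dom_by_perm dom_by_refl split: if_splits)

lemma dom_by_map_key_iff: "bij \<pi> \<Longrightarrow> dom_by (map_key \<pi> m) \<mu> \<longleftrightarrow> dom_by m \<mu>"
  using dom_by_map_key[of \<pi> m \<mu>] dom_by_map_key[of "inv \<pi>" "map_key \<pi> m" \<mu>]
  by (auto simp: bij_imp_bij_inv)

lemma jack_coeff_map_key: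
  assumes b: "bij \<pi>"
  shows "jack_coeff \<mu> (map_key \<pi> m) = jack_coeff \<mu> m"
proof (induction "part_size \<mu> ^ 2 - square_sum m" arbitrary: m rule: less_induct)
  case less
  let ?k = "map_key \<pi>"
  have "raise_sum (jack_coeff \<mu>) (?k m) = raise_sum (jack_coeff \<mu>) m" if d: "dom_by m \<mu>"
    unfolding raise_sum_map_key[OF b]
  proof (rule raise_sum_cong)
    fix i j s assume *: "i \<noteq> j" "1 \<le> s" "s \<le> min (lookup m i) (lookup m j)"
    then show "jack_coeff \<mu> (?k (raise i j s m)) = jack_coeff \<mu> (raise i j s m)"
      by (intro less square_sum_raise_measure d)
  qed
  moreover have "eig alpha 0 (?k m) = eig alpha 0 m" by (rule eig_perm[OF perm_of_map_key[OF b]])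
  ultimately show ?case
    by (simp add: jack_coeff_eq[of \<mu> "?k m"] jack_coeff_eq[of \<mu> m] perm_of_map_key_iff[OF b]
        dom_by_map_key_iff[OF b])
qed

lemma alpha_in_vanishing: "alpha \<in> vanishing 1"
  using vanishingI[OF no_pole_1, of alpha 1] by simp

text \<open>Strictly below \<mu> this is the recursion itself. On the orbit of \<mu> and outside the
  dominance ideal all raised exponents lie outside the support, so only the diagonal term is
  left.\<close>

lemma jack_coeff_lap:
  assumes "is_partition \<mu>"
  shows "lap alpha N (jack_coeff \<mu>) m = eig alpha N \<mu> * jack_coeff \<mu> m"
proof -
  have raised: "jack_coeff \<mu> (raise i j s m) = 0"
    if "\<not> dom_by m \<mu> \<or> perm_of m \<mu>" "i \<noteq> j" "1 \<le> s" "s \<le> min (lookup m i) (lookup m j)" for i j s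
    using that jack_coeff_support[OF assms] dom_by_raise raise_perm_not_dom[OF assms] by blast
  consider "perm_of m \<mu>" | "\<not> dom_by m \<mu>" | "dom_by m \<mu>" "\<not> perm_of m \<mu>" by blast
  then show ?thesis
  proof cases
    case 1
    then have "raise_sum (jack_coeff \<mu>) m = 0" by (intro raise_sum_eq_0) (rule raised; simp)
    then show ?thesis using 1 by (simp add: lap_def eig_perm)
  next
    case 2
    then have "raise_sum (jack_coeff \<mu>) m = 0" by (intro raise_sum_eq_0) (rule raised; simp)
    moreover have "jack_coeff \<mu> m = 0" using 2 jack_coeff_support[OF assms] by blast
    ultimately show ?thesis by (simp add: lap_def)
  next
    case 3
    have ps: "part_size m = part_size \<mu>" using 3 by (simp add: dom_by_def)
    let ?d = "eig alpha 0 \<mu> - eig alpha 0 m"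
    have "res0 (eig alpha 0 m - eig alpha 0 \<mu>) \<noteq> 0"
      by (rule res0_eig_diff[OF assms 3 alpha_in_vanishing])
    then have "?d \<noteq> 0" by force
    moreover have "jack_coeff \<mu> m = raise_sum (jack_coeff \<mu>) m / (2 * ?d)"
      using 3 by (subst jack_coeff_eq) simp
    moreover have "x = y / (2 * d) \<Longrightarrow> d \<noteq> 0 \<Longrightarrow> y / 2 = d * x" for x y d :: "rat ratfun" by simp
    ultimately have "raise_sum (jack_coeff \<mu>) m / 2 = ?d * jack_coeff \<mu> m" by blast
    moreover have "eig alpha N m = eig alpha N \<mu> - ?d"
      using eig_diff[OF ps, of alpha N] by (simp add: algebra_simps)
    ultimately show ?thesis unfolding lap_def by (simp only: left_diff_distrib diff_add_cancel)
  qed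
qed

lift_definition jack_symf :: "exponent \<Rightarrow> rat ratfun symf" is
  "\<lambda>\<mu> m. if is_partition \<mu> then jack_coeff \<mu> m else 0"
proof -
  fix \<mu> :: "exponent"
  have "bounded_degree (jack_coeff \<mu>)" if "is_partition \<mu>"
    using jack_coeff_support[OF that] unfolding bounded_degree_def dom_by_def by (metis order_refl)
  then show "bounded_degree (\<lambda>m. if is_partition \<mu> then jack_coeff \<mu> m else 0) \<and>
      symmetric_series (\<lambda>m. if is_partition \<mu> then jack_coeff \<mu> m else 0)"
    by (auto simp: symmetric_series_def jack_coeff_map_key bounded_degree_def)
qed

section \<open>The operators \<open>D_1\<close> and \<open>D_2\<close> on symmetric functions\<close>

lemma lookup_partial_deriv:
  "lookup (partial_deriv i f) m = of_nat (lookup m i + 1) * lookup f (m + single i 1)"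
proof -
  have "lookup (partial_deriv i f) m =
      (\<Sum>a\<in>keys f. of_nat (lookup a i) * lookup f a when a - single i 1 = m)"
    by (simp add: partial_deriv_def lookup_sum lookup_single)
  also have "\<dots> = (\<Sum>a\<in>keys f. if a = m + single i 1 then of_nat (lookup a i) * lookup f a else 0)"
  proof (rule sum.cong[OF refl])
    fix a
    show "(of_nat (lookup a i) * lookup f a when a - single i 1 = m) =
        (if a = m + single i 1 then of_nat (lookup a i) * lookup f a else 0)"
    proof (cases "lookup a i")
      case (Suc k)
      have "a = (a - single i 1) + single i 1"
        using Suc by (intro poly_mapping_eqI) (auto simp: lookup_add lookup_minus lookup_single when_def)
      then show ?thesis by (auto simp: when_def)
    next
      case 0
      \<comment> \<open>Subtraction of exponents is truncated, so \<open>a - single i 1 = m\<close>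
        can still hold with a = m; the factor \<open>lookup a i\<close> = 0 removes this
        term.\<close>
      then have "a \<noteq> m + single i 1" by (auto simp: lookup_add)
      then show ?thesis using 0 by (simp add: when_def)
    qed
  qed
  also have "\<dots> = of_nat (lookup (m + single i 1) i) * lookup f (m + single i 1)"
    by (auto simp: in_keys_iff)
  finally show ?thesis by (simp add: lookup_add)
qed

lemma lookup_pvar_times:
  "lookup (pvar i * p :: 'a::comm_ring_1 mpol) m =
     (if lookup m i = 0 then 0 else lookup p (m - single i 1))"
proof -
  let ?e = "single i (1 :: nat)"
  have "lookup (pvar i * p) m = (\<Sum>ab | fst ab + snd ab = m. (1 when fst ab = ?e) * lookup p (snd ab))"
    by (simp add: lookup_times pvar_def lookup_single case_prod_unfold when_def eq_commute)
  also have "\<dots> = (\<Sum>ab \<in> (if lookup m i = 0 then {} else {(?e, m - ?e)}). lookup p (snd ab))"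
  proof (rule sum.mono_neutral_cong_right)
    show "finite {ab. fst ab + snd ab = m}"
      using finite_decompositions[of m] by (simp add: case_prod_unfold)
    have "lookup m i \<noteq> 0 \<Longrightarrow> ?e + (m - ?e) = m"
      by (intro poly_mapping_eqI) (auto simp: lookup_add lookup_minus lookup_single when_def)
    then show "(if lookup m i = 0 then {} else {(?e, m - ?e)}) \<subseteq> {ab. fst ab + snd ab = m}" by auto
    show "\<forall>ab\<in>{ab. fst ab + snd ab = m} - (if lookup m i = 0 then {} else {(?e, m - ?e)}).
        (1 when fst ab = ?e) * lookup p (snd ab) = 0"
      by (auto simp: when_def lookup_add split: if_splits)
  qed (auto split: if_splits)
  finally show ?thesis by simp
qed

lemma lookup_pvar_deriv:
  "lookup (pvar i * partial_deriv i f) m = of_nat (lookup m i) * lookup f m"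
proof (cases "lookup m i = 0")
  case False
  then have "m - single i 1 + single i 1 = m"
    by (intro poly_mapping_eqI) (auto simp: lookup_add lookup_minus lookup_single when_def)
  then show ?thesis using False
    by (simp add: lookup_pvar_times lookup_partial_deriv lookup_minus del: of_nat_Suc)
qed (simp add: lookup_pvar_times)

lemma lookup_pvar2_deriv:
  "lookup (pvar i ^ 2 * partial_deriv i f) m =
     (if lookup m i = 0 then 0 else of_nat (lookup m i - 1) * lookup f (m - single i 1))"
  by (simp add: power2_eq_square mult.assoc lookup_pvar_times[of i "pvar i * _"] lookup_pvar_deriv
      lookup_minus)

lemma lookup_pvar2_deriv2:
  "lookup (pvar i ^ 2 * partial_deriv i (partial_deriv i f)) m =
     of_nat (2 * (lookup m i choose 2)) * lookup f m"
proof (cases "lookup m i")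
  case (Suc k)
  then have "m - single i 1 + single i 1 = m"
    by (intro poly_mapping_eqI) (auto simp: lookup_add lookup_minus lookup_single when_def)
  then show ?thesis using Suc
    unfolding lookup_pvar2_deriv lookup_partial_deriv two_choose_two
    by (simp add: lookup_minus algebra_simps)
qed (simp add: lookup_pvar2_deriv binomial_eq_0)

text \<open>The coefficient at x^a y^b of the divided difference of x^2 df/dx and y^2 df/dy by x -
  y, for a symmetric f(x, y) with coefficients h.\<close>

definition pair_sum :: "(nat \<Rightarrow> nat \<Rightarrow> 'a::comm_ring_1) \<Rightarrow> nat \<Rightarrow> nat \<Rightarrow> 'a" where
  "pair_sum h a b = of_nat (max a b) * h (max a b) (min a b) +
    (\<Sum>s\<in>{1..min a b}. of_nat (max a b - min a b + 2 * s) * h (max a b + s) (min a b - s))"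

lemma pair_sum_commute: "pair_sum h a b = pair_sum h b a"
  by (simp add: pair_sum_def max.commute min.commute)

text \<open>Multiplication of the divided difference by x - y, on coefficients. For 0 < b < a the
  sum at (a - 1, b) from its second term on is the sum at (a, b - 1), and the rest leaves (a - b +
  1) - a = -(b - 1) at \<open>h a (b - 1)\<close>. For a = b both sides vanish by symmetry.\<close>

lemma pair_telescope_aux:
  fixes h :: "nat \<Rightarrow> nat \<Rightarrow> 'a::comm_ring_1"
  assumes "b \<le> a" and sym: "\<And>a b. h a b = h b a"
  shows "(if a = 0 then 0 else of_nat (a - 1) * h (a - 1) b) - (if b = 0 then 0 else of_nat (b - 1) * h a (b - 1))
    = (if a = 0 then 0 else pair_sum h (a - 1) b) - (if b = 0 then 0 else pair_sum h a (b - 1))"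
proof -
  consider "a = 0" "b = 0" | "b = 0" "0 < a" | "a = b" "0 < b" | "0 < b" "b < a" using assms by linarith
  then show ?thesis
  proof cases
    case 2
    then show ?thesis by (simp add: pair_sum_def)
  next
    case 3
    then show ?thesis using pair_sum_commute[of h a "a - 1"] sym[of a "a - 1"] by simp
  next
    case 4
    then obtain c e where b: "b = Suc c" and a: "a = Suc (Suc c + e)"
      by (metis less_imp_Suc_add add_Suc gr0_implies_Suc)
    have m: "max (a - 1) b = Suc c + e" "min (a - 1) b = Suc c"
      "max a (b - 1) = Suc (Suc c + e)" "min a (b - 1) = c"
      by (auto simp: a b)
    have split: "sum f {1..Suc c} = f 1 + (\<Sum>s\<in>{1..c}. f (Suc s))" for f :: "nat \<Rightarrow> 'a"
      using sum.atLeast_Suc_atMost[of 1 "Suc c" f] sum.shift_bounds_cl_Suc_ivl[of f 1 c] by simp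
    have "(\<Sum>s\<in>{1..Suc c}. of_nat (e + 2 * s) * h (Suc c + e + s) (Suc c - s)) =
        of_nat (e + 2) * h (Suc (Suc c + e)) c +
        (\<Sum>s\<in>{1..c}. of_nat (e + 2 * Suc s) * h (Suc c + e + Suc s) (Suc c - Suc s))"
      by (subst split) (simp add: Suc_diff_le)
    also have "(\<Sum>s\<in>{1..c}. of_nat (e + 2 * Suc s) * h (Suc c + e + Suc s) (Suc c - Suc s)) =
        (\<Sum>s\<in>{1..c}. of_nat (Suc (Suc c + e) - c + 2 * s) * h (Suc (Suc c + e) + s) (c - s))"
      by (intro sum.cong refl) (simp add: add.commute Suc_diff_le)
    finally show ?thesis
      unfolding pair_sum_def m by (simp add: a b algebra_simps)
  qed simp
qed

lemma pair_telescope: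
  fixes h :: "nat \<Rightarrow> nat \<Rightarrow> 'a::comm_ring_1"
  assumes sym: "\<And>a b. h a b = h b a"
  shows "(if a = 0 then 0 else of_nat (a - 1) * h (a - 1) b) - (if b = 0 then 0 else of_nat (b - 1) * h a (b - 1))
    = (if a = 0 then 0 else pair_sum h (a - 1) b) - (if b = 0 then 0 else pair_sum h a (b - 1))"
proof (cases "b \<le> a")
  case True
  show ?thesis by (rule pair_telescope_aux[of b a h, OF True sym])
next
  case False
  then have "a \<le> b" by simp
  from pair_telescope_aux[of a b h, OF this sym]
  have "(if b = 0 then 0 else of_nat (b - 1) * h a (b - 1)) - (if a = 0 then 0 else of_nat (a - 1) * h (a - 1) b)
    = (if b = 0 then 0 else pair_sum h a (b - 1)) - (if a = 0 then 0 else pair_sum h (a - 1) b)"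
    unfolding sym[of "b - 1" a] sym[of b] pair_sum_commute[of h b] pair_sum_commute[of h "b - 1"] .
  then show ?thesis by (metis minus_diff_eq)
qed

text \<open>Freezes all variables but two, so that statements about the pair i, j become statements
  about functions of two exponents.\<close>

definition upd2 :: "nat \<Rightarrow> nat \<Rightarrow> nat \<Rightarrow> nat \<Rightarrow> exponent \<Rightarrow> exponent" where
  "upd2 i j a b m = Poly_Mapping.update i a (Poly_Mapping.update j b m)"

lemma lookup_upd2: "lookup (upd2 i j a b m) k = (if k = i then a else if k = j then b else lookup m k)"
  by (simp add: upd2_def lookup_update)

lemma symf_coeff_upd2_swap:
  assumes "i \<noteq> j"
  shows "sf_coeff F (upd2 i j a b m) = sf_coeff F (upd2 i j b a m)"
proof -
  have b: "bij (transpose i j)" by simp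
  have "upd2 i j a b m = map_key (transpose i j) (upd2 i j b a m)"
    by (rule poly_mapping_eqI)
      (use assms in \<open>auto simp: lookup_map_key bij_is_inj[OF b] lookup_upd2 transpose_def\<close>)
  then show ?thesis by (simp add: symf_coeff_map_key[OF b])
qed

text \<open>The divided difference as a polynomial, given by its coefficients because the quotient
  is known so far only as a fraction. The guard \<open>i \<noteq> j\<close> allows
  \<open>part_size_raise\<close> to bound the degree.\<close>

lift_definition pair_quotient :: "nat \<Rightarrow> nat \<Rightarrow> nat \<Rightarrow> 'a::comm_ring_1 symf \<Rightarrow> 'a mpol" is
  "\<lambda>N i j F m. if keys m \<subseteq> {..<N} \<and> i \<noteq> j then
     of_nat (max (lookup m i) (lookup m j)) * F m + raise_pair F i j m
     else 0"
proof -
  fix N i j :: nat and F :: "exponent \<Rightarrow> 'a"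
  assume "bounded_degree F \<and> symmetric_series F"
  then obtain d where d: "\<And>m. F m \<noteq> 0 \<Longrightarrow> part_size m \<le> d" by (auto simp: bounded_degree_def)
  let ?G = "\<lambda>m. if keys m \<subseteq> {..<N} \<and> i \<noteq> j then
     of_nat (max (lookup m i) (lookup m j)) * F m + raise_pair F i j m
     else 0"
  have "keys m \<subseteq> {..<N} \<and> part_size m \<le> d" if "?G m \<noteq> 0" for m
  proof -
    have k: "keys m \<subseteq> {..<N}" and ij: "i \<noteq> j" using that by (auto split: if_splits)
    have "part_size m \<le> d"
    proof (rule ccontr)
      assume *: "\<not> part_size m \<le> d"
      then have "F m = 0" using d by blast
      moreover have "F (raise i j s m) = 0" if "s \<in> {1..min (lookup m i) (lookup m j)}" for s
        using d[of "raise i j s m"] * part_size_raise[OF ij, of s m] that by auto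
      ultimately have "?G m = 0" by (simp add: raise_pair_def)
      then show False using that by blast
    qed
    with k show ?thesis by blast
  qed
  then have "{m. ?G m \<noteq> 0} \<subseteq> {a. keys a \<subseteq> {..<N} \<and> (\<forall>k. lookup a k \<le> d)}"
    using lookup_le_part_size le_trans by blast
  then show "finite {m. ?G m \<noteq> 0}" by (rule finite_subset) (simp add: finite_bounded_exponents)
qed

lemma pair_quotient_upd2:
  fixes F :: "'a::comm_ring_1 symf"
  assumes "i \<noteq> j" "keys m \<subseteq> {..<N}" "i < N" "j < N"
  defines "h \<equiv> \<lambda>a b. sf_coeff F (upd2 i j a b m)"
  shows "lookup (pair_quotient N i j F) (upd2 i j a b m) = pair_sum h a b"
proof -
  have sym: "h x y = h y x" for x y
    unfolding h_def by (rule symf_coeff_upd2_swap[OF assms(1)])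
  have k: "keys (upd2 i j a b m) \<subseteq> {..<N}"
    using assms(2-4) by (auto simp: subset_iff in_keys_iff lookup_upd2 split: if_splits)
  have mx: "h a b = h (max a b) (min a b)" using sym[of a b] by (auto simp: max_def min_def)
  have "sf_coeff F (raise i j s (upd2 i j a b m)) = h (max a b + s) (min a b - s)" for s
  proof (cases "b \<le> a")
    case True
    then have "raise i j s (upd2 i j a b m) = upd2 i j (a + s) (b - s) m"
      using assms(1) by (intro poly_mapping_eqI) (simp add: lookup_raise lookup_upd2)
    then show ?thesis using True by (simp add: h_def)
  next
    case False
    then have "raise i j s (upd2 i j a b m) = upd2 i j (a - s) (b + s) m"
      using assms(1) by (intro poly_mapping_eqI) (simp add: lookup_raise lookup_upd2)
    then show ?thesis using False sym[of "a - s" "b + s"] by (simp add: h_def)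
  qed
  then show ?thesis
    using assms(1) k mx by (simp add: pair_quotient.rep_eq lookup_upd2 h_def pair_sum_def raise_pair_def)
qed

text \<open>Symmetry of F makes the left-hand side divisible by x_i - x_j. With the other exponents
  frozen, the identity is \<open>pair_telescope\<close>.\<close>

lemma pair_quotient:
  fixes F :: "'a::comm_ring_1 symf"
  assumes "i \<noteq> j" "i < N" "j < N"
  defines "f \<equiv> restrict_vars N F"
  shows "pvar i ^ 2 * partial_deriv i f - pvar j ^ 2 * partial_deriv j f =
    (pvar i - pvar j) * pair_quotient N i j F"
proof (rule poly_mapping_eqI)
  fix m
  let ?G = "lookup (pair_quotient N i j F)"
  have lhs: "lookup (pvar i ^ 2 * partial_deriv i f - pvar j ^ 2 * partial_deriv j f) m =
      (if lookup m i = 0 then 0 else of_nat (lookup m i - 1) * lookup f (m - single i 1)) -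
      (if lookup m j = 0 then 0 else of_nat (lookup m j - 1) * lookup f (m - single j 1))"
    by (simp add: lookup_minus lookup_pvar2_deriv)
  have rhs: "lookup ((pvar i - pvar j) * pair_quotient N i j F) m =
      (if lookup m i = 0 then 0 else ?G (m - single i 1)) - (if lookup m j = 0 then 0 else ?G (m - single j 1))"
    by (simp add: left_diff_distrib lookup_minus lookup_pvar_times)
  show "lookup (pvar i ^ 2 * partial_deriv i f - pvar j ^ 2 * partial_deriv j f) m =
    lookup ((pvar i - pvar j) * pair_quotient N i j F) m"
  proof (cases "keys m \<subseteq> {..<N}")
    case True
    let ?a = "lookup m i" and ?b = "lookup m j"
    have ui: "m - single i 1 = upd2 i j (?a - 1) ?b m" and uj: "m - single j 1 = upd2 i j ?a (?b - 1) m"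
      using assms(1)
      by (auto intro!: poly_mapping_eqI simp: lookup_upd2 lookup_minus lookup_single when_def)
    have ku: "keys (upd2 i j a b m) \<subseteq> {..<N}" for a b
      using True assms(2,3) by (auto simp: subset_iff in_keys_iff lookup_upd2 split: if_splits)
    have "lookup f (upd2 i j a b m) = sf_coeff F (upd2 i j a b m)" for a b
      using ku by (simp add: f_def lookup_restrict_vars)
    moreover note pair_telescope[of "\<lambda>a b. sf_coeff F (upd2 i j a b m)" ?a ?b,
        OF symf_coeff_upd2_swap[OF assms(1)]]
    ultimately show ?thesis
      unfolding lhs rhs ui uj pair_quotient_upd2[OF assms(1) True assms(2,3)] by (simp only:)
  next
    case False
    then obtain k where k: "k \<in> keys m" "\<not> k < N" by auto
    then have "k \<in> keys (m - single i 1)" "k \<in> keys (m - single j 1)"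
      using assms(2,3) by (auto simp: in_keys_iff lookup_minus lookup_single when_def)
    then have "\<not> keys (m - single i 1) \<subseteq> {..<N}" "\<not> keys (m - single j 1) \<subseteq> {..<N}" using k by auto
    then show ?thesis unfolding lhs rhs by (simp add: f_def lookup_restrict_vars pair_quotient.rep_eq)
  qed
qed

lemma sum_off_diagonal_swap:
  "(\<Sum>i\<in>A. \<Sum>j\<in>A - {i}. f i j) = (\<Sum>i\<in>A. \<Sum>j\<in>A - {i}. f j i)" if "finite A"
proof -
  have A: "A - {i} = {j \<in> A. i \<noteq> j}" for i by auto
  have "(\<Sum>i\<in>A. \<Sum>j\<in>A - {i}. f i j) = (\<Sum>j\<in>A. \<Sum>i\<in>{i \<in> A. i \<noteq> j}. f i j)"
    unfolding A by (rule sum.swap_restrict[OF that that])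
  also have "\<dots> = (\<Sum>i\<in>A. \<Sum>j\<in>A - {i}. f j i)" by (intro sum.cong) auto
  finally show ?thesis .
qed

lemma pvar_eq_iff: "pvar i = (pvar j :: 'a::zero_neq_one mpol) \<longleftrightarrow> i = j"
proof
  assume "pvar i = (pvar j :: 'a mpol)"
  then have "lookup (pvar i :: 'a mpol) (single i 1) = lookup (pvar j) (single i 1)" by simp
  then have "single j 1 = (single i 1 :: exponent)" by (auto simp: pvar_def lookup_single when_def split: if_splits)
  then show "i = j" by (metis keys_single one_neq_zero singleton_inject)
qed simp

lemma antisym_fractions: "a / (x - y) * p + b / (y - x) * q = (a * p - b * q) / (x - y :: 'a::field)"
proof -
  have "b / (y - x) = - (b / (x - y))" by (metis minus_diff_eq divide_minus_right)
  then show ?thesis by (simp add: diff_divide_distrib)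
qed

lemma two_nonzero: "(2 :: 'a::{field, ring_char_0} mpol fract) \<noteq> 0"
proof -
  have "to_fract (2 :: 'a mpol) \<noteq> 0" by simp
  moreover have "to_fract (2 :: 'a mpol) = 2" by (metis one_add_one to_fract_1 to_fract_add)
  ultimately show ?thesis by simp
qed

lemma two_cancel: "2 * x = y \<Longrightarrow> 2 * z = y \<Longrightarrow> x = (z :: 'a::{field, ring_char_0} mpol fract)"
  using mult_left_cancel[OF two_nonzero, of x z] by simp

lemma half_plus_half: "pconst (1 / 2) * p + pconst (1 / 2) * p = (p :: 'a::{field, ring_char_0} mpol)"
proof (rule poly_mapping_eqI)
  fix m
  have "(1 / 2) * x + (1 / 2) * x = x" for x :: 'a by (simp flip: mult_2)
  then show "lookup (pconst (1 / 2) * p + pconst (1 / 2) * p) m = lookup p m"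
    by (simp only: lookup_add lookup_pconst_times)
qed

text \<open>The terms for (i, j) and (j, i) have opposite denominators, and together they form a
  divided difference. Hence D_1 preserves polynomials that come from symmetric functions and acts on
  coefficients as \<open>lap\<close> with parameter 0.\<close>

lemma D1_op_symf:
  fixes F :: "rat ratfun symf"
  shows "\<exists>P. D1_op N (restrict_vars N F) = to_fract P \<and>
    (\<forall>m. lookup P m = (if keys m \<subseteq> {..<N} then lap 0 N (sf_coeff F) m else 0))"
proof -
  let ?f = "restrict_vars N F" and ?x = "\<lambda>i. to_fract (pvar i :: rat ratfun mpol)"
  let ?Q = "\<Sum>i<N. \<Sum>j\<in>{..<N} - {i}. pair_quotient N i j F"
  let ?P = "pconst (1 / 2) * ?Q"
  define g where "g i j = ?x i ^ 2 / (?x i - ?x j) * to_fract (partial_deriv i ?f)" for i j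
  have pair: "g i j + g j i = to_fract (pair_quotient N i j F)" if "i < N" "j < N" "i \<noteq> j" for i j
  proof -
    have nz: "?x i - ?x j \<noteq> 0" "?x j - ?x i \<noteq> 0" using that by (auto simp: pvar_eq_iff)
    have "g i j + g j i =
        (?x i ^ 2 * to_fract (partial_deriv i ?f) - ?x j ^ 2 * to_fract (partial_deriv j ?f)) / (?x i - ?x j)"
      unfolding g_def by (rule antisym_fractions)
    also have "?x i ^ 2 * to_fract (partial_deriv i ?f) - ?x j ^ 2 * to_fract (partial_deriv j ?f) =
        to_fract (pvar i ^ 2 * partial_deriv i ?f - pvar j ^ 2 * partial_deriv j ?f)"
      by (simp add: power2_eq_square)
    also have "\<dots> = (?x i - ?x j) * to_fract (pair_quotient N i j F)"
      by (subst pair_quotient) (use that in simp_all)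
    finally show ?thesis using nz by simp
  qed
  have "2 * D1_op N ?f = (\<Sum>i<N. \<Sum>j\<in>{..<N} - {i}. g i j) + (\<Sum>i<N. \<Sum>j\<in>{..<N} - {i}. g i j)"
    by (simp only: D1_op_def g_def mult_2)
  also have "\<dots> = (\<Sum>i<N. \<Sum>j\<in>{..<N} - {i}. g i j) + (\<Sum>i<N. \<Sum>j\<in>{..<N} - {i}. g j i)"
    using sum_off_diagonal_swap[of "{..<N}" g] by simp
  also have "\<dots> = (\<Sum>i<N. \<Sum>j\<in>{..<N} - {i}. to_fract (pair_quotient N i j F))"
    unfolding sum.distrib[symmetric] by (intro sum.cong refl pair) auto
  also have "\<dots> = to_fract ?Q" by simp
  finally have "2 * D1_op N ?f = to_fract ?Q" .
  moreover have "2 * to_fract ?P = to_fract ?Q"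
    by (simp only: mult_2 to_fract_add[symmetric] half_plus_half)
  ultimately have 1: "D1_op N ?f = to_fract ?P"
    by (rule two_cancel)
  have 2: "lookup ?P m = (if keys m \<subseteq> {..<N} then lap 0 N (sf_coeff F) m else 0)" for m
  proof (cases "keys m \<subseteq> {..<N}")
    case True
    let ?mx = "\<lambda>i j. max (lookup m i) (lookup m j)"
    let ?R = "\<lambda>i j. raise_pair (sf_coeff F) i j m"
    have R0: "?R i j = 0" if "i \<notin> keys m \<or> j \<notin> keys m" for i j
    proof -
      have "{1..min (lookup m i) (lookup m j)} = {}" using that by (auto simp: in_keys_iff)
      then show ?thesis by (simp only: raise_pair_def sum.empty)
    qed
    have "lookup ?Q m = (\<Sum>i<N. \<Sum>j\<in>{..<N} - {i}. of_nat (?mx i j) * sf_coeff F m + ?R i j)"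
      using True by (simp add: lookup_sum pair_quotient.rep_eq)
    also have "\<dots> = of_nat (\<Sum>i<N. \<Sum>j\<in>{..<N} - {i}. ?mx i j) * sf_coeff F m + (\<Sum>i<N. \<Sum>j\<in>{..<N} - {i}. ?R i j)"
      by (simp add: sum.distrib sum_distrib_right)
    also have "(\<Sum>i<N. \<Sum>j\<in>{..<N} - {i}. ?R i j) = (\<Sum>i\<in>keys m. \<Sum>j\<in>{..<N} - {i}. ?R i j)"
      using True R0 by (intro sum.mono_neutral_right) auto
    also have "\<dots> = (\<Sum>i\<in>keys m. \<Sum>j\<in>keys m - {i}. ?R i j)"
      using True R0 by (intro sum.cong[OF refl] sum.mono_neutral_right) blast+
    also have "\<dots> = raise_sum (sf_coeff F) m"
      by (simp only: raise_sum_def)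
    also have "of_nat (\<Sum>i<N. \<Sum>j\<in>{..<N} - {i}. ?mx i j) = 2 * eig 0 N m"
    proof -
      have *: "of_nat (\<Sum>i<N. \<Sum>j\<in>{..<N} - {i}. ?mx i j) + 2 * of_nat (bstat (conjugate m)) =
          (2 * of_nat (N - 1) * of_nat (part_size m) :: rat ratfun)"
        using arg_cong[OF bstat_conjugate_max[OF True], of "of_nat :: nat \<Rightarrow> rat ratfun"] by simp
      \<comment> \<open>For N = 0 the truncated \<open>N - 1\<close> differs from
        \<open>of_nat N - 1\<close>, but then m has size 0.\<close>
      have "of_nat (N - 1) * of_nat (part_size m) = ((of_nat N - 1) * of_nat (part_size m) :: rat ratfun)"
      proof (cases N)
        case 0
        then have "part_size m = 0" using True by (simp add: part_size_def)
        then show ?thesis by simp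
      qed simp
      then show ?thesis using * by (simp add: eig_def algebra_simps)
    qed
    finally have "lookup ?Q m = 2 * lap 0 N (sf_coeff F) m" by (simp add: lap_def algebra_simps)
    then show ?thesis using True by (simp add: lookup_pconst_times)
  next
    case False
    then show ?thesis by (simp add: lookup_pconst_times lookup_sum pair_quotient.rep_eq)
  qed
  show ?thesis using 1 2 by blast
qed

lemma bstat_superset: "finite S \<Longrightarrow> keys m \<subseteq> S \<Longrightarrow> bstat m = (\<Sum>i\<in>S. lookup m i choose 2)"
  unfolding bstat_def by (intro sum.mono_neutral_left) (auto simp: in_keys_iff)

lemma D_alpha_symf:
  "\<exists>P. D_alpha N (restrict_vars N F) = to_fract P \<and>
    (\<forall>m. lookup P m = (if keys m \<subseteq> {..<N} then lap alpha N (sf_coeff F) m else 0))"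
proof -
  let ?f = "restrict_vars N F"
  obtain P1 where P1: "D1_op N ?f = to_fract P1"
    "\<And>m. lookup P1 m = (if keys m \<subseteq> {..<N} then lap 0 N (sf_coeff F) m else 0)"
    using D1_op_symf[of N F] by blast
  let ?Q = "\<Sum>i<N. pvar i ^ 2 * partial_deriv i (partial_deriv i ?f)"
  let ?P2 = "pconst (1 / 2) * ?Q"
  have "2 * D2_op N ?f = to_fract ?Q" by (simp add: D2_op_def power2_eq_square two_nonzero)
  moreover have "2 * to_fract ?P2 = to_fract ?Q"
    by (simp only: mult_2 to_fract_add[symmetric] half_plus_half)
  ultimately have D2: "D2_op N ?f = to_fract ?P2"
    by (rule two_cancel)
  have l2: "lookup ?P2 m = (if keys m \<subseteq> {..<N} then of_nat (bstat m) * sf_coeff F m else 0)" for m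
  proof -
    have "lookup ?P2 m = (1 / 2) * (\<Sum>i<N. of_nat (2 * (lookup m i choose 2)) * lookup ?f m)"
      by (simp only: lookup_pconst_times lookup_sum lookup_pvar2_deriv2)
    also have "\<dots> = of_nat (\<Sum>i<N. lookup m i choose 2) * lookup ?f m"
      by (simp add: sum_distrib_left sum_distrib_right)
    finally show ?thesis by (simp add: lookup_restrict_vars bstat_superset[of "{..<N}"])
  qed
  show ?thesis
  proof (intro exI conjI allI)
    show "D_alpha N ?f = to_fract (P1 + pconst alpha * ?P2)"
      unfolding D_alpha_def P1(1) D2 by (simp only: to_fract_add to_fract_mult)
    show "lookup (P1 + pconst alpha * ?P2) m = (if keys m \<subseteq> {..<N} then lap alpha N (sf_coeff F) m else 0)" for m
      by (simp only: lookup_add lookup_pconst_times[of alpha] l2 P1(2))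
        (simp add: lap_def eig_def algebra_simps)
  qed
qed

section \<open>Existence and uniqueness of Jack polynomials\<close>

lemma partition_perm_eq:
  assumes "is_partition \<mu>" "is_partition \<nu>" "perm_of \<mu> \<nu>"
  shows "\<mu> = \<nu>"
proof (rule lookup_eqI_prefix_sums)
  have "dominated \<mu> \<nu>" "dominated \<nu> \<mu>"
    using assms perm_of_sym dom_by_perm dom_by_refl dom_by_partition by metis+
  then show "(\<Sum>i<k. lookup \<mu> i) = (\<Sum>i<k. lookup \<nu> i)" for k
    by (auto simp: dominated_def intro: order.antisym)
qed

lemma keys_partition_size:
  assumes "is_partition \<nu>"
  shows "keys \<nu> \<subseteq> {..<part_size \<nu>}"
proof -
  have "part_length \<nu> \<le> part_size \<nu>"
    unfolding part_length_def part_size_def card_eq_sum by (rule sum_mono) (simp add: in_keys_iff)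
  then show ?thesis using keys_partition[OF assms] by auto
qed

definition partitions_upto :: "nat \<Rightarrow> exponent set" where
  "partitions_upto d = {\<nu>. is_partition \<nu> \<and> part_size \<nu> \<le> d}"

lemma finite_partitions_upto: "finite (partitions_upto d)"
proof (rule finite_subset)
  show "partitions_upto d \<subseteq> {a. keys a \<subseteq> {..<d} \<and> (\<forall>k. lookup a k \<le> d)}"
  proof
    fix \<nu> assume "\<nu> \<in> partitions_upto d"
    then have \<nu>: "is_partition \<nu>" "part_size \<nu> \<le> d" by (auto simp: partitions_upto_def)
    then have "keys \<nu> \<subseteq> {..<d}" using keys_partition_size[OF \<nu>(1)] by fastforce
    moreover have "lookup \<nu> k \<le> d" for k using lookup_le_part_size[of \<nu> k] \<nu>(2) by linarith
    ultimately show "\<nu> \<in> {a. keys a \<subseteq> {..<d} \<and> (\<forall>k. lookup a k \<le> d)}" by simp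
  qed
qed (simp add: finite_bounded_exponents)

lemma strictly_below_partition: "\<nu> \<in> strictly_below \<mu> \<Longrightarrow> is_partition \<nu>"
  by (simp add: strictly_below_def)

lemma finite_strictly_below: "finite (strictly_below \<mu>)"
  by (rule finite_subset[OF _ finite_partitions_upto[of "part_size \<mu>"]])
    (auto simp: strictly_below_def dominated_def partitions_upto_def)

section \<open>Coefficients and restrictions of symmetric functions\<close>

lemma sf_coeff_add [simp]: "sf_coeff (f + g) m = sf_coeff f m + sf_coeff g m"
  by (simp add: plus_symf.rep_eq)

lemma sf_coeff_zero [simp]: "sf_coeff 0 m = 0"
  by (simp add: zero_symf.rep_eq)

lemma sf_coeff_uminus [simp]: "sf_coeff (- f) m = - sf_coeff f m"
  by (simp add: uminus_symf.rep_eq)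

lemma sf_coeff_diff [simp]: "sf_coeff (f - g :: 'a::comm_ring_1 symf) m = sf_coeff f m - sf_coeff g m"
  unfolding minus_symf_def sf_coeff_add sf_coeff_uminus by (rule add_uminus_conv_diff)

lemma sf_coeff_sum: "sf_coeff (sum f A :: 'a::comm_ring_1 symf) m = (\<Sum>x\<in>A. sf_coeff (f x) m)"
  by (induction A rule: infinite_finite_induct) auto

lemma sf_coeff_mult: "sf_coeff (f * g) m = (\<Sum>(a, b) | a + b = m. sf_coeff f a * sf_coeff g b)"
  by (simp add: times_symf.rep_eq)

lemma restrict_vars_const: "restrict_vars N (sf_const c) = pconst c"
  by (rule poly_mapping_eqI)
    (auto simp: lookup_restrict_vars sf_const.rep_eq pconst_def lookup_single when_def)

lemma restrict_vars_diff:
  "restrict_vars N (f - g :: 'a::comm_ring_1 symf) = restrict_vars N f - restrict_vars N g"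
  by (rule poly_mapping_eqI) (simp add: lookup_restrict_vars lookup_minus)

lemma restrict_vars_sum:
  "restrict_vars N (sum f A :: 'a::comm_ring_1 symf) = (\<Sum>x\<in>A. restrict_vars N (f x))"
  by (induction A rule: infinite_finite_induct) (auto simp: restrict_vars_zero restrict_vars_add)

lemma restrict_vars_prod:
  "restrict_vars N (prod f A :: 'a::comm_ring_1 symf) = (\<Prod>x\<in>A. restrict_vars N (f x))"
  by (induction A rule: infinite_finite_induct) (auto simp: restrict_vars_one restrict_vars_mult)

lemma sf_coeff_const_mult: "sf_coeff (sf_const c * f) m = (c * sf_coeff f m :: 'a::comm_ring_1)"
proof -
  obtain N where N: "keys m \<subseteq> {..<N}" using keys_below_bound by blast
  have "lookup (restrict_vars N (sf_const c * f)) m = c * lookup (restrict_vars N f) m"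
    by (simp add: restrict_vars_mult restrict_vars_const lookup_pconst_times)
  then show ?thesis using N by (simp add: lookup_restrict_vars)
qed

lemma restrict_vars_scaled:
  "pconst c * restrict_vars N f = restrict_vars N (sf_const c * f :: 'a::comm_ring_1 symf)"
  by (simp add: restrict_vars_mult restrict_vars_const)

lemma raise_sum_diff: "raise_sum (\<lambda>m. F m - G m) m = raise_sum F m - raise_sum G m"
  by (simp add: raise_sum_def raise_pair_def right_diff_distrib sum_subtractf)

lemma lap_diff: "lap t N (\<lambda>m. F m - G m) m = lap t N F m - lap t N G m"
  by (simp add: lap_def raise_sum_diff algebra_simps diff_divide_distrib)

lemma sf_coeff_jack_symf: "is_partition \<mu> \<Longrightarrow> sf_coeff (jack_symf \<mu>) = jack_coeff \<mu>"
  by (simp add: jack_symf.rep_eq fun_eq_iff)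

lemma sf_coeff_msym_combination:
  fixes c :: "exponent \<Rightarrow> 'a::comm_ring_1"
  assumes "finite S" "\<And>\<nu>. \<nu> \<in> S \<Longrightarrow> is_partition \<nu>" "is_partition \<nu>" "perm_of m \<nu>"
  shows "sf_coeff (\<Sum>\<rho>\<in>S. sf_const (c \<rho>) * msym \<rho>) m = (if \<nu> \<in> S then c \<nu> else 0)"
proof -
  have p: "perm_of m \<rho> \<longleftrightarrow> \<rho> = \<nu>" if "\<rho> \<in> S" for \<rho>
    using that assms partition_perm_eq perm_of_sym perm_of_trans by metis
  have "sf_coeff (\<Sum>\<rho>\<in>S. sf_const (c \<rho>) * msym \<rho>) m = (\<Sum>\<rho>\<in>S. if \<rho> = \<nu> then c \<nu> else 0)"
    by (auto simp: sf_coeff_sum sf_coeff_const_mult sf_coeff_msym p intro!: sum.cong)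
  then show ?thesis using assms(1) by simp
qed

text \<open>The right-hand side of (C2).\<close>

definition monomial_expansion :: "exponent \<Rightarrow> (exponent \<Rightarrow> rat ratfun) \<Rightarrow> rat ratfun symf" where
  "monomial_expansion \<mu> a = sf_const (hook_alpha \<mu>) * msym \<mu> + (\<Sum>\<nu>\<in>strictly_below \<mu>. sf_const (a \<nu>) * msym \<nu>)"

lemma restrict_monomial_expansion:
  "restrict_vars N (monomial_expansion \<mu> a) = pconst (hook_alpha \<mu>) * restrict_vars N (msym \<mu>) +
     (\<Sum>\<nu>\<in>strictly_below \<mu>. pconst (a \<nu>) * restrict_vars N (msym \<nu>))"
  by (simp only: monomial_expansion_def restrict_vars_add restrict_vars_sum restrict_vars_scaled)

lemma sf_coeff_monomial_expansion:
  assumes "is_partition \<mu>" "is_partition \<nu>" "perm_of m \<nu>"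
  shows "sf_coeff (monomial_expansion \<mu> a) m =
    (if \<nu> = \<mu> then hook_alpha \<mu> else if \<nu> \<in> strictly_below \<mu> then a \<nu> else 0)"
proof -
  have "perm_of m \<mu> \<longleftrightarrow> \<mu> = \<nu>"
    using assms partition_perm_eq perm_of_sym perm_of_trans by metis
  moreover have "\<mu> \<notin> strictly_below \<mu>" by (simp add: strictly_below_def)
  moreover note sf_coeff_msym_combination[where c = a, OF finite_strictly_below[of \<mu>] strictly_below_partition assms(2,3)]
  ultimately show ?thesis
    by (auto simp: monomial_expansion_def sf_coeff_const_mult sf_coeff_msym)
qed

lemma jack_symf_expansion:
  assumes "is_partition \<mu>"
  shows "jack_symf \<mu> = monomial_expansion \<mu> (jack_coeff \<mu>)"
proof (rule symf_eqI)
  fix m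
  obtain \<nu> where \<nu>: "is_partition \<nu>" "perm_of m \<nu>" using exists_sorted perm_of_sym by metis
  have "sf_coeff (jack_symf \<mu>) m = jack_coeff \<mu> \<nu>"
    using symf_coeff_perm[OF \<nu>(2), of "jack_symf \<mu>"] by (simp add: sf_coeff_jack_symf assms)
  moreover have "\<nu> \<notin> strictly_below \<mu> \<Longrightarrow> \<nu> \<noteq> \<mu> \<Longrightarrow> jack_coeff \<mu> \<nu> = 0"
    using jack_coeff_support[OF assms, of \<nu>] \<nu>(1) dom_by_partition by (auto simp: strictly_below_def)
  ultimately show "sf_coeff (jack_symf \<mu>) m = sf_coeff (monomial_expansion \<mu> (jack_coeff \<mu>)) m"
    using jack_coeff_perm[OF perm_of_refl] by (simp add: sf_coeff_monomial_expansion[OF assms \<nu>])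
qed

lemma is_jack_polynomial_jack_symf:
  assumes "is_partition \<mu>"
  shows "is_jack_polynomial N \<mu> (restrict_vars N (jack_symf \<mu>))"
proof -
  obtain P where P: "D_alpha N (restrict_vars N (jack_symf \<mu>)) = to_fract P"
    "\<And>m. lookup P m = (if keys m \<subseteq> {..<N} then lap alpha N (sf_coeff (jack_symf \<mu>)) m else 0)"
    using D_alpha_symf[of N "jack_symf \<mu>"] by blast
  have "P = pconst (jack_eigenvalue N \<mu>) * restrict_vars N (jack_symf \<mu>)"
    by (rule poly_mapping_eqI)
      (simp add: P lookup_pconst_times lookup_restrict_vars sf_coeff_jack_symf assms jack_coeff_lap
        jack_eigenvalue_eig)
  then have "D_alpha N (restrict_vars N (jack_symf \<mu>)) =
      to_fract (pconst (jack_eigenvalue N \<mu>)) * to_fract (restrict_vars N (jack_symf \<mu>))"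
    by (simp add: P)
  moreover have "restrict_vars N (jack_symf \<mu>) = pconst (hook_alpha \<mu>) * restrict_vars N (msym \<mu>) +
     (\<Sum>\<nu>\<in>strictly_below \<mu>. pconst (jack_coeff \<mu> \<nu>) * restrict_vars N (msym \<nu>))"
    by (subst jack_symf_expansion[OF assms]) (rule restrict_monomial_expansion)
  ultimately show ?thesis unfolding is_jack_polynomial_def by blast
qed

text \<open>The difference from \<open>jack_coeff\<close> satisfies the exact eigenvalue equation,
  is supported below \<mu> and has leading coefficient 0, so triangularity makes all its
  coefficients in the first N variables vanish.\<close>

lemma is_jack_polynomial_unique:
  assumes part: "is_partition \<mu>" and J: "is_jack_polynomial N \<mu> J"
  shows "J = restrict_vars N (jack_symf \<mu>)"
proof -
  obtain a where JD: "D_alpha N J = to_fract (pconst (jack_eigenvalue N \<mu>)) * to_fract J"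
    and "J = pconst (hook_alpha \<mu>) * restrict_vars N (msym \<mu>) +
            (\<Sum>\<nu>\<in>strictly_below \<mu>. pconst (a \<nu>) * restrict_vars N (msym \<nu>))"
    using J by (auto simp: is_jack_polynomial_def)
  then have Ja: "J = restrict_vars N (monomial_expansion \<mu> a)" by (simp add: restrict_monomial_expansion)
  let ?F = "sf_coeff (monomial_expansion \<mu> a)" and ?G = "jack_coeff \<mu>"
  let ?H = "\<lambda>m. ?F m - ?G m"
  obtain P where P: "D_alpha N J = to_fract P"
    "\<And>m. lookup P m = (if keys m \<subseteq> {..<N} then lap alpha N ?F m else 0)"
    using D_alpha_symf[of N "monomial_expansion \<mu> a"] unfolding Ja by blast
  have "to_fract P = to_fract (pconst (jack_eigenvalue N \<mu>) * J)" using JD P(1) by simp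
  then have "P = pconst (jack_eigenvalue N \<mu>) * J" by (simp only: to_fract_eq_iff)
  then have F: "lap alpha N ?F m = eig alpha N \<mu> * ?F m" if "keys m \<subseteq> {..<N}" for m
    using P(2)[of m] that by (simp add: lookup_pconst_times Ja lookup_restrict_vars jack_eigenvalue_eig)
  have "?H m \<in> {0}" if "keys m \<subseteq> {..<N}" for m
  proof (rule triangular_solution_in[of \<mu> alpha ?H "{0}" N m])
    fix m
    obtain \<nu> where \<nu>: "is_partition \<nu>" "perm_of m \<nu>" using exists_sorted perm_of_sym by metis
    show "dom_by m \<mu>" if "?H m \<noteq> 0"
    proof -
      have "?G m \<noteq> 0 \<or> \<nu> = \<mu> \<or> \<nu> \<in> strictly_below \<mu>"
        using that by (auto simp: sf_coeff_monomial_expansion[OF part \<nu>] split: if_splits)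
      then have "?G m \<noteq> 0 \<or> dom_by \<nu> \<mu>"
        using dom_by_refl[OF part] dom_by_partition[OF \<nu>(1)] by (auto simp: strictly_below_def)
      then show ?thesis using jack_coeff_support[OF part] dom_by_perm[OF \<nu>(2)] by blast
    qed
    show "?H m \<in> {0}" if "perm_of m \<mu>"
      using that by (simp add: sf_coeff_monomial_expansion[OF part part that] jack_coeff_perm)
    show "lap alpha N ?H m - eig alpha N \<mu> * ?H m \<in> {0}" if "keys m \<subseteq> {..<N}"
      using F[OF that] jack_coeff_lap[OF part, of N m] by (simp add: lap_diff algebra_simps)
  qed (use part alpha_in_vanishing that in auto)
  then show ?thesis
    unfolding Ja
    by (intro poly_mapping_eqI) (simp add: lookup_restrict_vars sf_coeff_jack_symf[OF part])
qed

lemma jack_polynomial_eq: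
  "is_partition \<mu> \<Longrightarrow> jack_polynomial N \<mu> = restrict_vars N (jack_symf \<mu>)"
  unfolding jack_polynomial_def
  by (rule the_equality) (auto intro: is_jack_polynomial_jack_symf is_jack_polynomial_unique)

lemma symf_eqI_restrict_large:
  assumes "\<And>N. N \<ge> N0 \<Longrightarrow> restrict_vars N f = restrict_vars N g"
  shows "f = g"
proof (rule symf_eqI)
  fix m :: "exponent"
  obtain N where "keys m \<subseteq> {..<N}" using keys_below_bound by blast
  then have "keys m \<subseteq> {..<max N N0}" by force
  then show "sf_coeff f m = sf_coeff g m"
    using arg_cong[OF assms[of "max N N0"], of "\<lambda>p. lookup p m"] by (simp add: lookup_restrict_vars)
qed

lemma Jack_eq:
  assumes "is_partition \<mu>"
  shows "Jack \<mu> = jack_symf \<mu>"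
  unfolding Jack_def
proof (rule the_equality)
  show "F = jack_symf \<mu>" if "\<forall>N\<ge>part_length \<mu>. restrict_vars N F = jack_polynomial N \<mu>" for F
    using that jack_polynomial_eq[OF assms] by (intro symf_eqI_restrict_large[of "part_length \<mu>"]) auto
qed (simp add: jack_polynomial_eq assms)

section \<open>Regularity at \<open>\<alpha> = 0\<close>\<close>

lemma diagram_bounds: "s \<in> diagram \<mu> \<Longrightarrow> fst s < part_size \<mu> \<and> snd s \<in> keys \<mu>"
  using lookup_le_part_size[of \<mu> "snd s"] by (auto simp: diagram_def in_keys_iff)

lemma hook_alpha_no_pole: "no_pole_at_0 (hook_alpha \<mu>)"
  unfolding hook_alpha_def by (intro no_pole_intros)

text \<open>At \<alpha> = 0 each box contributes its leg length plus 1, a positive integer.\<close>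

lemma hook_alpha_res0: "res0 (hook_alpha \<mu>) \<noteq> 0"
proof -
  have "finite (diagram \<mu>)"
  proof (rule finite_subset)
    show "diagram \<mu> \<subseteq> {..<part_size \<mu>} \<times> keys \<mu>"
      using diagram_bounds by fastforce
  qed simp
  moreover have "res0 (alpha * of_nat a + of_nat l + 1 :: rat ratfun) = of_nat (Suc l)" for a l
    by (simp add: res0_add res0_mult no_pole_intros)
  ultimately show ?thesis
    unfolding hook_alpha_def by (subst res0_prod) (auto intro!: no_pole_intros simp del: of_nat_Suc)
qed

text \<open>The case of \<open>triangular_solution_in\<close> where M is the local ring itself: the
  residual is 0 and the leading coefficient is regular.\<close>

lemma jack_coeff_no_pole:
  assumes "is_partition \<mu>"
  shows "no_pole_at_0 (jack_coeff \<mu> m)"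
proof -
  obtain N where N: "keys m \<subseteq> {..<N}" using keys_below_bound by blast
  have "jack_coeff \<mu> m \<in> vanishing 0"
  proof (rule triangular_solution_in[of \<mu> alpha "jack_coeff \<mu>" "vanishing 0" N m])
    show "lap alpha N (jack_coeff \<mu>) k - eig alpha N \<mu> * jack_coeff \<mu> k \<in> vanishing 0" for k
      by (simp add: jack_coeff_lap[OF assms])
  qed (use assms N alpha_in_vanishing jack_coeff_support[OF assms] in
      \<open>auto simp: jack_coeff_perm hook_alpha_no_pole vanishing_0_iff no_pole_intros\<close>)
  then show ?thesis by (simp add: vanishing_0_iff)
qed

lemma Jack_coeff_no_pole: "is_partition \<mu> \<Longrightarrow> no_pole_at_0 (sf_coeff (Jack \<mu>) m)"
  by (simp add: Jack_eq sf_coeff_jack_symf jack_coeff_no_pole)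

lemma Jack_support: "is_partition \<mu> \<Longrightarrow> sf_coeff (Jack \<mu>) m \<noteq> 0 \<Longrightarrow> dom_by m \<mu>"
  by (simp add: Jack_eq sf_coeff_jack_symf jack_coeff_support)

lemma Jack_top: "is_partition \<mu> \<Longrightarrow> sf_coeff (Jack \<mu>) \<mu> = hook_alpha \<mu>"
  by (simp add: Jack_eq sf_coeff_jack_symf jack_coeff_perm perm_of_refl)

lemma Jack_zero: "Jack 0 = 1"
proof (rule symf_eqI)
  fix m
  have h: "hook_alpha 0 = 1" by (simp add: hook_alpha_def diagram_def)
  show "sf_coeff (Jack 0) m = sf_coeff 1 m"
  proof (cases "m = 0")
    case True
    then show ?thesis using Jack_top[OF partition_zero] h by (simp add: one_symf.rep_eq)
  next
    case False
    then obtain k where "lookup m k \<noteq> 0" by (metis lookup_zero poly_mapping_eqI)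
    then have "part_size m \<noteq> 0" using lookup_le_part_size[of m k] by simp
    then have "\<not> dom_by m 0" by (simp add: dom_by_def part_size_def[of 0])
    then show ?thesis using Jack_support[OF partition_zero] False by (auto simp: one_symf.rep_eq)
  qed
qed

lemma D_alpha_Jack:
  "is_partition \<mu> \<Longrightarrow> D_alpha N (restrict_vars N (Jack \<mu>)) =
     to_fract (pconst (eig alpha N \<mu>)) * to_fract (restrict_vars N (Jack \<mu>))"
  using is_jack_polynomial_jack_symf[of \<mu> N]
  by (simp add: Jack_eq is_jack_polynomial_def jack_eigenvalue_eig)

section \<open>Strong factorization of the hook products\<close>

definition alt_prod :: "'b set \<Rightarrow> ('b set \<Rightarrow> 'a::field) \<Rightarrow> 'a" where
  "alt_prod K f = (\<Prod>I\<in>Pow K. f I powi ((-1) ^ card I))"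

abbreviation even_sets :: "'b set \<Rightarrow> 'b set set" where "even_sets K \<equiv> {I \<in> Pow K. even (card I)}"
abbreviation odd_sets :: "'b set \<Rightarrow> 'b set set" where "odd_sets K \<equiv> {I \<in> Pow K. odd (card I)}"

lemma alt_prod_even_odd:
  assumes "finite K"
  shows "alt_prod K f = (\<Prod>I\<in>even_sets K. f I) / (\<Prod>I\<in>odd_sets K. f I)"
proof -
  have "alt_prod K f = (\<Prod>I\<in>even_sets K \<union> odd_sets K. f I powi ((-1) ^ card I))"
    unfolding alt_prod_def by (rule prod.cong) auto
  also have "\<dots> = (\<Prod>I\<in>even_sets K. f I powi ((-1) ^ card I)) * (\<Prod>I\<in>odd_sets K. f I powi ((-1) ^ card I))"
    using assms by (intro prod.union_disjoint) auto
  finally have "alt_prod K f = (\<Prod>I\<in>even_sets K. f I powi ((-1) ^ card I)) * (\<Prod>I\<in>odd_sets K. f I powi ((-1) ^ card I))" .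
  then show ?thesis by (simp add: prod_inversef[unfolded comp_def] divide_inverse)
qed

lemma alt_prod_cong: "(\<And>I. I \<subseteq> K \<Longrightarrow> f I = g I) \<Longrightarrow> alt_prod K f = alt_prod K g"
  unfolding alt_prod_def by (intro prod.cong) auto

lemma alt_prod_divide: "alt_prod K (\<lambda>I. f I / g I) = alt_prod K f / alt_prod K g"
  by (simp add: alt_prod_def power_int_divide_distrib prod_dividef)

lemma alt_prod_prod: "alt_prod K (\<lambda>I. \<Prod>x\<in>X. f x I) = (\<Prod>x\<in>X. alt_prod K (f x))"
proof -
  have p: "(\<Prod>x\<in>X. g x) powi e = (\<Prod>x\<in>X. g x powi e)" for g :: "'c \<Rightarrow> 'a" and e
    by (induction X rule: infinite_finite_induct) (auto simp: power_int_mult_distrib)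
  show ?thesis unfolding alt_prod_def p by (rule prod.swap)
qed

text \<open>A set I without z is paired with \<open>insert z I\<close>, which carries the opposite
  exponent.\<close>

lemma alt_prod_insert:
  assumes "finite K" "z \<notin> K"
  shows "alt_prod (insert z K) f = alt_prod K (\<lambda>I. f I / f (insert z I))"
proof -
  have inj: "inj_on (insert z) (Pow K)" using assms(2) by (auto simp: inj_on_def)
  have c: "card (insert z I) = Suc (card I)" if "I \<subseteq> K" for I
    using that assms finite_subset by (subst card_insert_disjoint) auto
  have "alt_prod (insert z K) f = (\<Prod>I\<in>Pow K. f I powi ((-1) ^ card I)) *
      (\<Prod>I\<in>insert z ` Pow K. f I powi ((-1) ^ card I))"
    unfolding alt_prod_def Pow_insert using assms by (intro prod.union_disjoint) auto
  also have "(\<Prod>I\<in>insert z ` Pow K. f I powi ((-1) ^ card I)) = (\<Prod>I\<in>Pow K. inverse (f (insert z I) powi ((-1) ^ card I)))"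
    unfolding prod.reindex[OF inj] by (intro prod.cong refl) (simp add: c power_int_minus)
  finally show ?thesis
    unfolding alt_prod_def[of K] divide_inverse power_int_mult_distrib power_int_inverse prod.distrib .
qed

text \<open>
  Functions whose differences gain a factor \<open>\<alpha>\<close> within the same class; this replaces expansions
  of logarithms in powers of \<open>\<alpha>\<close>.
\<close>

inductive tame :: "(nat \<Rightarrow> rat ratfun) \<Rightarrow> bool" where
  const: "no_pole_at_0 c \<Longrightarrow> tame (\<lambda>_. c)"
| linear: "tame (\<lambda>n. alpha * of_nat n)"
| add: "tame f \<Longrightarrow> tame g \<Longrightarrow> tame (\<lambda>n. f n + g n)"
| mult: "tame f \<Longrightarrow> tame g \<Longrightarrow> tame (\<lambda>n. f n * g n)"
| inverse: "tame f \<Longrightarrow> (\<And>n. res0 (f n) \<noteq> 0) \<Longrightarrow> tame (\<lambda>n. inverse (f n))"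

lemma tame_no_pole: "tame f \<Longrightarrow> no_pole_at_0 (f n)"
  by (induction rule: tame.induct) (auto intro: no_pole_intros no_pole_inverse)

lemma tame_prod: "(\<And>i. i \<in> A \<Longrightarrow> tame (f i)) \<Longrightarrow> tame (\<lambda>n. \<Prod>i\<in>A. f i n)"
  by (induction A rule: infinite_finite_induct) (auto intro: tame.intros no_pole_1)

lemma inverse_step:
  fixes u w :: "'a::field"
  assumes "u \<noteq> 0" "w \<noteq> 0" "w = u + a * g"
  shows "inverse w = inverse u + a * (((- 1) * g) * (inverse u * inverse w))"
proof -
  have "a * (((- 1) * g) * (inverse u * inverse w)) = - ((w - u) * (inverse u * inverse w))"
    using assms(3) by simp
  also have "\<dots> = inverse w - inverse u"
    using assms(1,2) by (simp add: field_simps)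
  finally show ?thesis by simp
qed

text \<open>By induction on the construction: \<open>alpha * of_nat n\<close> has the constant
  difference \<open>alpha * of_nat a\<close>, products obey a discrete Leibniz rule, and inverses
  the formula for the difference of reciprocals.\<close>

lemma tame_difference:
  assumes "tame f"
  obtains g where "tame g" "\<And>n. f (n + a) = f n + alpha * g n"
proof -
  from assms have "\<exists>g. tame g \<and> (\<forall>n. f (n + a) = f n + alpha * g n)"
  proof induction
    case (const c)
    show ?case by (rule exI[of _ "\<lambda>_. 0"]) (auto intro: tame.const no_pole_0)
  next
    case linear
    show ?case
      by (rule exI[of _ "\<lambda>_. of_nat a"]) (auto intro: tame.const no_pole_of_nat simp: algebra_simps)
  next
    case (add f1 f2)
    then obtain g1 g2 where "tame g1" "tame g2"
      "\<forall>n. f1 (n + a) = f1 n + alpha * g1 n" "\<forall>n. f2 (n + a) = f2 n + alpha * g2 n" by blast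
    then show ?case
      by (intro exI[of _ "\<lambda>n. g1 n + g2 n"]) (auto intro: tame.add simp: algebra_simps)
  next
    case (mult f1 f2)
    then obtain g1 g2 where g: "tame g1" "tame g2"
      "\<forall>n. f1 (n + a) = f1 n + alpha * g1 n" "\<forall>n. f2 (n + a) = f2 n + alpha * g2 n" by blast
    \<comment> \<open>The discrete Leibniz rule; the last term comes from the product of the two
      increments, which carries a second factor \<open>alpha\<close>.\<close>
    have "tame (\<lambda>n. (g1 n * f2 n + f1 n * g2 n) + alpha * (g1 n * g2 n))"
      using g mult by (intro tame.intros no_pole_alpha)
    then show ?case
      using g by (intro exI[of _ "\<lambda>n. (g1 n * f2 n + f1 n * g2 n) + alpha * (g1 n * g2 n)"])
        (auto simp: algebra_simps)
  next
    case (inverse f)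
    then obtain g where g: "tame g" "\<forall>n. f (n + a) = f n + alpha * g n" by blast
    have nz: "f n \<noteq> 0" "f n + alpha * g n \<noteq> 0" for n
      using inverse(2)[of n] inverse(2)[of "n + a"] g(2) by (metis res0_0)+
    have "res0 (f n + alpha * g n) \<noteq> 0" for n using inverse(2)[of "n + a"] g(2) by simp
    then have "tame (\<lambda>n. ((- 1) * g n) * (inverse (f n) * inverse (f n + alpha * g n)))"
      using g inverse by (intro tame.intros no_pole_alpha no_pole_uminus no_pole_1)
    moreover have "inverse (f (n + a)) =
        inverse (f n) + alpha * (((- 1) * g n) * (inverse (f n) * inverse (f n + alpha * g n)))" for n
      unfolding g(2)[rule_format] by (rule inverse_step) (use nz[of n] in simp_all)
    ultimately show ?case by blast
  qed
  then show ?thesis using that by blast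
qed

text \<open>Splitting off one element replaces w(n) by the quotient w(n) / w(n + x z), which is
  again 1 plus a tame function times a power of \<open>alpha\<close>, the power now being one
  higher. Each element of K thus contributes one factor \<open>alpha\<close>.\<close>

lemma alt_prod_tame:
  assumes "finite K" "tame f" "\<And>n. res0 (1 + alpha ^ k * f n) \<noteq> 0"
  shows "alt_prod K (\<lambda>I. 1 + alpha ^ k * f (n + (\<Sum>i\<in>I. x i))) - 1 \<in> vanishing (k + card K)"
  using assms
proof (induction K arbitrary: f k n rule: finite_induct)
  case empty
  show ?case using tame_no_pole[OF empty(1)] by (simp add: alt_prod_def alpha_power_vanishing)
next
  case (insert z K)
  define w where "w n = 1 + alpha ^ k * f n" for n
  obtain g where g: "tame g" "\<And>n. f (n + x z) = f n + alpha * g n"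
    using tame_difference[OF insert.prems(1)] by blast
  have w: "w (n + x z) = w n + alpha ^ Suc k * g n" for n by (simp add: w_def g algebra_simps)
  have rw: "res0 (w n) \<noteq> 0" for n using insert.prems(2) by (simp add: w_def)
  then have wnz: "w n \<noteq> 0" for n by (metis res0_0)
  \<comment> \<open>Solves \<open>1 + alpha ^ Suc k * h n = w n / w (n + x z)\<close>. The
    denominator is written without the shifted argument because the rules of \<open>tame\<close>
    contain no shift.\<close>
  define h where "h n = ((- 1) * g n) * inverse (w n + alpha ^ Suc k * g n)" for n
  have tw: "tame (\<lambda>n. w n + alpha ^ Suc k * g n)"
    unfolding w_def using insert.prems(1) g by (intro tame.intros no_pole_intros)
  have "tame h"
    unfolding h_def using rw g(1) w by (intro tame.mult tame.inverse tw tame.const no_pole_intros) metis+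
  have hw: "1 + alpha ^ Suc k * h n = w n / w (n + x z)" for n
    using wnz[of "n + x z"] unfolding w by (simp add: h_def field_simps)
  have npw: "no_pole_at_0 (w n)" for n
    unfolding w_def using tame_no_pole[OF insert.prems(1)] by (intro no_pole_intros)
  have res: "res0 (1 + alpha ^ Suc k * h n) \<noteq> 0" for n
    unfolding hw divide_inverse using rw npw by (simp add: res0_mult no_pole_inverse)
  have "alt_prod (insert z K) (\<lambda>I. w (n + sum x I)) = alt_prod K (\<lambda>I. w (n + sum x I) / w (n + sum x (insert z I)))"
    by (rule alt_prod_insert[OF insert.hyps])
  also have "\<dots> = alt_prod K (\<lambda>I. 1 + alpha ^ Suc k * h (n + sum x I))"
  proof (rule alt_prod_cong)
    fix I assume "I \<subseteq> K"
    then have "finite I" "z \<notin> I" using insert.hyps finite_subset by auto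
    then have "n + sum x (insert z I) = (n + sum x I) + x z" by simp
    then show "w (n + sum x I) / w (n + sum x (insert z I)) = 1 + alpha ^ Suc k * h (n + sum x I)"
      by (simp only: hw)
  qed
  finally show ?case
    using insert.IH[OF \<open>tame h\<close> res, of n] insert.hyps by (simp add: w_def)
qed

text \<open>The rising factorial of d / \<alpha> of length n, multiplied by \<alpha>^n.\<close>

definition rising :: "nat \<Rightarrow> nat \<Rightarrow> rat ratfun" where
  "rising d n = (\<Prod>t<n. alpha * of_nat t + of_nat d)"

lemma res0_linear: "res0 (alpha * of_nat t + of_nat d :: rat ratfun) = of_nat d"
  by (simp add: res0_add res0_mult no_pole_intros)

lemma rising_nonzero: "0 < d \<Longrightarrow> rising d n \<noteq> 0"
proof -
  assume "0 < d"
  then have "alpha * of_nat t + of_nat d \<noteq> (0 :: rat ratfun)" for t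
    using res0_linear[of t d] by (metis of_nat_0_eq_iff res0_0 less_numeral_extra(3))
  then show ?thesis by (simp add: rising_def)
qed

text \<open>The number of factors of \<open>rising d n\<close> depends on n, so it is not visibly
  tame. The quotient of its values at n and n + x z has a fixed number of linear factors and is
  tame; forming it uses up one element of K, which accounts for the exponent
  \<open>card K - 1\<close>.\<close>

lemma rising_factorization:
  assumes "finite K" "K \<noteq> {}" "0 < d"
  shows "alt_prod K (\<lambda>I. rising d (\<Sum>i\<in>I. x i)) - 1 \<in> vanishing (card K - 1)"
proof -
  obtain z where "z \<in> K" using assms(2) by blast
  define L where "L = K - {z}"
  have K: "K = insert z L" and L: "finite L" "z \<notin> L" using \<open>z \<in> K\<close> assms(1) by (auto simp: L_def)
  let ?p = "\<lambda>n. \<Prod>t<x z. alpha * of_nat n + (alpha * of_nat t + of_nat d) :: rat ratfun"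
  define w :: "nat \<Rightarrow> rat ratfun"
    where "w n = inverse (?p n)" for n
  have lin: "res0 (alpha * of_nat n + (alpha * of_nat t + of_nat d) :: rat ratfun) = of_nat d" for n t
    by (simp add: res0_add res0_mult no_pole_intros)
  have rp: "res0 (?p n) = of_nat d ^ x z" for n
    by (subst res0_prod) (auto intro!: no_pole_intros simp: lin)
  have np: "no_pole_at_0 (?p n)" for n
    by (intro no_pole_intros)
  have "tame (\<lambda>n. inverse (?p n))"
    by (intro tame.inverse tame_prod tame.add tame.linear tame.const no_pole_intros)
      (use rp assms(3) in simp)
  then have tw: "tame (\<lambda>n. w n + (- 1))"
    unfolding w_def by (intro tame.add tame.const no_pole_intros)
  have rw: "res0 (1 + alpha ^ 0 * (w n + (- 1))) \<noteq> 0" for n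
    using no_pole_inverse(2)[OF np, of n] rp[of n] assms(3) by (simp add: w_def)
  have quot: "rising d n / rising d (n + x z) = w n" for n
  proof -
    have "rising d (n + x z) = rising d n * (\<Prod>t<x z. alpha * of_nat (n + t) + of_nat d)"
      by (simp add: rising_def lessThan_atLeast0 prod.atLeastLessThan_concat[of 0 n "n + x z", symmetric]
          prod.atLeastLessThan_shift_0[of _ n "n + x z"])
    then show ?thesis
      using rising_nonzero[OF assms(3), of n] by (simp add: w_def divide_inverse algebra_simps)
  qed
  have "alt_prod K (\<lambda>I. rising d (sum x I)) = alt_prod L (\<lambda>I. rising d (sum x I) / rising d (sum x (insert z I)))"
    unfolding K by (rule alt_prod_insert[OF L])
  also have "\<dots> = alt_prod L (\<lambda>I. 1 + alpha ^ 0 * (w (0 + sum x I) + (- 1)))"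
  proof (rule alt_prod_cong)
    fix I assume "I \<subseteq> L"
    then have "finite I" "z \<notin> I" using L finite_subset by auto
    then have "sum x (insert z I) = sum x I + x z" by simp
    then show "rising d (sum x I) / rising d (sum x (insert z I)) = 1 + alpha ^ 0 * (w (0 + sum x I) + (- 1))"
      by (simp add: quot)
  qed
  finally show ?thesis
    using alt_prod_tame[OF L(1) tw rw, of 0 x] L by (simp add: K)
qed

lemma prod_interval_rising:
  assumes "p \<le> q" "0 < d"
  shows "(\<Prod>t=p..<q. alpha * of_nat t + of_nat d) = rising d q / rising d p"
proof -
  have "rising d q = rising d p * (\<Prod>t=p..<q. alpha * of_nat t + of_nat d)"
    using assms(1) by (simp add: rising_def lessThan_atLeast0 prod.atLeastLessThan_concat)
  then show ?thesis using rising_nonzero[OF assms(2), of p] by simp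
qed

text \<open>Grouping the boxes of a row by the height of their column makes the arms consecutive.\<close>

lemma hook_alpha_rising:
  assumes part: "is_partition \<mu>" and N: "keys \<mu> \<subseteq> {..<N}"
  shows "hook_alpha \<mu> = (\<Prod>(j, c) | j \<le> c \<and> c < N.
    rising (c - j + 1) (lookup \<mu> j - lookup \<mu> (Suc c)) / rising (c - j + 1) (lookup \<mu> j - lookup \<mu> c))"
proof -
  have col: "i < lookup \<mu> j \<longleftrightarrow> j < lookup (conjugate \<mu>) i" for i j
    using greater_lookup_partition[OF part, of i] by blast
  let ?P = "{(j, c). j \<le> c \<and> c < N}"
  have fP: "finite ?P" by (rule finite_subset[of _ "{..<N} \<times> {..<N}"]) auto
  \<comment> \<open>A box in row j and column i is recorded as ((j, c), i), where c is the last row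
    reached by column i. Its leg length is then c - j, and i runs through the columns ending in row
    c.\<close>
  let ?S = "SIGMA p:?P. {lookup \<mu> (Suc (snd p))..<lookup \<mu> (snd p)}"
  let ?g = "\<lambda>p i. alpha * of_nat (lookup \<mu> (fst p) - (i + 1)) + of_nat (snd p - fst p + 1) :: rat ratfun"
  have "hook_alpha \<mu> = (\<Prod>(p, i)\<in>?S. ?g p i)"
    unfolding hook_alpha_def
  proof (rule prod.reindex_bij_witness[of _ "\<lambda>(p, i). (i, fst p)" "\<lambda>(i, j). ((j, lookup (conjugate \<mu>) i - 1), i)"])
    fix s assume "s \<in> diagram \<mu>"
    then obtain i j where s: "s = (i, j)" and ij: "i < lookup \<mu> j" by (auto simp: diagram_def)
    let ?c = "lookup (conjugate \<mu>) i"
    have jc: "j < ?c" using ij col by simp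
    then have "i < lookup \<mu> (?c - 1)" "\<not> i < lookup \<mu> ?c" unfolding col by auto
    then show "(case s of (i, j) \<Rightarrow> ((j, lookup (conjugate \<mu>) i - 1), i)) \<in> ?S"
      using jc less_if_keys_subset[OF N, of i "?c - 1"] by (auto simp: s)
    have "?c - (j + 1) + 1 = ?c - 1 - j + 1" using jc by simp
    then show "(case case s of (i, j) \<Rightarrow> ((j, lookup (conjugate \<mu>) i - 1), i) of (p, i) \<Rightarrow> ?g p i) =
        alpha * of_nat (arm \<mu> s) + of_nat (leg \<mu> s) + 1"
      by (simp add: s arm_def leg_def)
  next
    fix b assume "b \<in> ?S"
    then obtain j c i where b: "b = ((j, c), i)" and *: "j \<le> c" "c < N" "lookup \<mu> (Suc c) \<le> i" "i < lookup \<mu> c"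
      by auto
    then have "c < lookup (conjugate \<mu>) i" "\<not> Suc c < lookup (conjugate \<mu>) i"
      by (auto simp flip: col)
    then have "lookup (conjugate \<mu>) i = Suc c" by simp
    then show "(case case b of (p, i) \<Rightarrow> (i, fst p) of (i, j) \<Rightarrow> ((j, lookup (conjugate \<mu>) i - 1), i)) = b"
      by (simp add: b)
    show "(case b of (p, i) \<Rightarrow> (i, fst p)) \<in> diagram \<mu>"
      using * partition_antimono[OF part *(1)] by (simp add: b diagram_def)
  qed auto
  also have "\<dots> = (\<Prod>p\<in>?P. \<Prod>i\<in>{lookup \<mu> (Suc (snd p))..<lookup \<mu> (snd p)}. ?g p i)"
    using fP by (subst prod.Sigma) auto
  also have "\<dots> = (\<Prod>(j, c)\<in>?P. rising (c - j + 1) (lookup \<mu> j - lookup \<mu> (Suc c)) / rising (c - j + 1) (lookup \<mu> j - lookup \<mu> c))"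
  proof (rule prod.cong[OF refl])
    fix p assume "p \<in> ?P"
    then obtain j c where p: "p = (j, c)" and jc: "j \<le> c" by auto
    let ?a = "lookup \<mu> j" and ?b = "lookup \<mu> c" and ?e = "lookup \<mu> (Suc c)"
    have le: "?e \<le> ?b" "?b \<le> ?a" using partition_antimono[OF part] jc by auto
    \<comment> \<open>Replacing the column i by the arm length t reverses the interval of
      columns.\<close>
    have "(\<Prod>i=?e..<?b. alpha * of_nat (?a - (i + 1)) + of_nat (c - j + 1)) =
        (\<Prod>t=?a - ?b..<?a - ?e. alpha * of_nat t + of_nat (c - j + 1) :: rat ratfun)"
      by (rule prod.reindex_bij_witness[of _ "\<lambda>t. ?a - (t + 1)" "\<lambda>i. ?a - (i + 1)"]) (use le in auto)
    also have "\<dots> = rising (c - j + 1) (?a - ?e) / rising (c - j + 1) (?a - ?b)"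
      using le by (intro prod_interval_rising) auto
    finally show "(\<Prod>i\<in>{lookup \<mu> (Suc (snd p))..<lookup \<mu> (snd p)}. ?g p i) =
        (case p of (j, c) \<Rightarrow> rising (c - j + 1) (lookup \<mu> j - lookup \<mu> (Suc c)) / rising (c - j + 1) (lookup \<mu> j - lookup \<mu> c))"
      by (simp add: p)
  qed
  finally show ?thesis .
qed

section \<open>Elements congruent to 1 modulo a power of \<alpha>\<close>

lemma vanishing_unit_mult:
  assumes "x - 1 \<in> vanishing k" "y - 1 \<in> vanishing k"
  shows "x * y - 1 \<in> vanishing k"
proof -
  have "x * y - 1 = (x - 1) * (y - 1) + ((x - 1) + (y - 1))" by (simp add: algebra_simps)
  moreover have "(x - 1) * (y - 1) \<in> vanishing k"
    using assms by (intro vanishing_mult_left) (auto intro: vanishing_no_pole)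
  ultimately show ?thesis using assms by (simp only: vanishing_add)
qed

text \<open>A positive k forces the residue of x to be 1, so x is a unit, and 1/x - 1 = -(x -
  1)/x.\<close>

lemma vanishing_unit_inverse:
  assumes "x - 1 \<in> vanishing k" "0 < k"
  shows "inverse x - 1 \<in> vanishing k"
proof -
  have np: "no_pole_at_0 x" using no_pole_add[OF vanishing_no_pole[OF assms(1)] no_pole_1] by simp
  have "res0 x = 1" using vanishing_res0[OF assms] np by (simp add: res0_diff no_pole_intros)
  then have "no_pole_at_0 (inverse x)" "x \<noteq> 0" using np by (auto intro: no_pole_inverse)
  moreover have "inverse x - 1 = (- inverse x) * (x - 1)" using \<open>x \<noteq> 0\<close> by (simp add: field_simps)
  ultimately show ?thesis using assms by (simp only: vanishing_mult_left no_pole_uminus)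
qed

lemma vanishing_unit_prod:
  "(\<And>i. i \<in> A \<Longrightarrow> f i - 1 \<in> vanishing k) \<Longrightarrow> prod f A - 1 \<in> vanishing k"
  by (induction A rule: infinite_finite_induct) (auto intro: vanishing_unit_mult)

text \<open>The arguments of \<open>rising\<close> in a hook product are differences of two parts,
  and these add up over the partitions in I; so every factor reduces to
  \<open>rising_factorization\<close>.\<close>

lemma hook_factorization:
  assumes K: "finite K" "2 \<le> card K" and part: "\<And>i. i \<in> K \<Longrightarrow> is_partition (\<mu> i)"
  shows "alt_prod K (\<lambda>I. hook_alpha (\<Sum>i\<in>I. \<mu> i)) - 1 \<in> vanishing (card K - 1)"
proof -
  obtain N where N: "keys (\<Sum>i\<in>K. \<mu> i) \<subseteq> {..<N}" using keys_below_bound by blast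
  let ?P = "{(j, c). j \<le> c \<and> c < N}"
  define R where "R p m I = rising (snd p - fst p + 1) (\<Sum>i\<in>I. lookup (\<mu> i) (fst p) - lookup (\<mu> i) m)" for p :: "nat \<times> nat" and m I
  have hook: "hook_alpha (\<Sum>i\<in>I. \<mu> i) = (\<Prod>p\<in>?P. R p (Suc (snd p)) I / R p (snd p) I)" if "I \<subseteq> K" for I
  proof -
    have pI: "is_partition (\<mu> i)" if "i \<in> I" for i using that \<open>I \<subseteq> K\<close> part by blast
    have "finite I" using that K finite_subset by blast
    have "keys (\<Sum>i\<in>I. \<mu> i) \<subseteq> keys (\<Sum>i\<in>K. \<mu> i)"
      using sum_mono2[OF K(1) \<open>I \<subseteq> K\<close>, of "\<lambda>i. lookup (\<mu> i) _"]
      by (auto simp: in_keys_iff lookup_sum sum_eq_0_iff K(1) \<open>finite I\<close>) (use that in blast)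
    then have NI: "keys (\<Sum>i\<in>I. \<mu> i) \<subseteq> {..<N}" using N by blast
    \<comment> \<open>Natural subtraction commutes with the sum here because parts decrease, so no
      summand is truncated.\<close>
    have d: "lookup (\<Sum>i\<in>I. \<mu> i) j - lookup (\<Sum>i\<in>I. \<mu> i) c = (\<Sum>i\<in>I. lookup (\<mu> i) j - lookup (\<mu> i) c)"
      if "j \<le> c" for j c
      unfolding lookup_sum using that partition_antimono[OF pI] by (intro sum_subtractf_nat[symmetric]) auto
    have "is_partition (\<Sum>i\<in>I. \<mu> i)" using pI by (rule partition_sum)
    then show ?thesis
      by (subst hook_alpha_rising[OF _ NI]) (auto intro!: prod.cong simp: R_def d)
  qed
  have R: "alt_prod K (R p m) - 1 \<in> vanishing (card K - 1)" for p m
    unfolding R_def using K by (intro rising_factorization) auto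
  have "alt_prod K (\<lambda>I. hook_alpha (\<Sum>i\<in>I. \<mu> i)) = (\<Prod>p\<in>?P. alt_prod K (R p (Suc (snd p))) / alt_prod K (R p (snd p)))"
    unfolding alt_prod_prod[symmetric] alt_prod_divide[symmetric] by (rule alt_prod_cong[OF hook])
  moreover have "\<dots> - 1 \<in> vanishing (card K - 1)"
    unfolding divide_inverse using K(2)
    by (intro vanishing_unit_prod vanishing_unit_mult vanishing_unit_inverse R) auto
  ultimately show ?thesis by simp
qed

section \<open>Alternating sums over subsets\<close>

definition alt_sum :: "'b set \<Rightarrow> ('b set \<Rightarrow> 'a::comm_ring_1) \<Rightarrow> 'a" where
  "alt_sum K f = (\<Sum>I\<in>Pow K. (-1) ^ card I * f I)"

lemma alt_sum_even_odd:
  assumes "finite K"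
  shows "alt_sum K f = (\<Sum>I\<in>even_sets K. f I) - (\<Sum>I\<in>odd_sets K. f I)"
proof -
  have "alt_sum K f = (\<Sum>I\<in>even_sets K \<union> odd_sets K. (-1) ^ card I * f I)"
    unfolding alt_sum_def by (rule sum.cong) auto
  also have "\<dots> = (\<Sum>I\<in>even_sets K. (-1) ^ card I * f I) + (\<Sum>I\<in>odd_sets K. (-1) ^ card I * f I)"
    using assms by (intro sum.union_disjoint) auto
  finally show ?thesis by (simp add: sum_negf)
qed

lemma alt_sum_add: "alt_sum K (\<lambda>I. f I + g I) = alt_sum K f + alt_sum K g"
  by (simp add: alt_sum_def distrib_left sum.distrib)

lemma alt_sum_diff: "alt_sum K (\<lambda>I. f I - g I) = alt_sum K f - alt_sum K g"
  by (simp add: alt_sum_def right_diff_distrib sum_subtractf)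

lemma alt_sum_mult_left: "alt_sum K (\<lambda>I. c * f I) = c * alt_sum K f"
  by (simp add: alt_sum_def sum_distrib_left mult_ac)

lemma alt_sum_sum: "alt_sum K (\<lambda>I. \<Sum>x\<in>X. f x I) = (\<Sum>x\<in>X. alt_sum K (f x))"
  unfolding alt_sum_def sum_distrib_left by (rule sum.swap)

lemma alt_sum_cong: "(\<And>I. I \<subseteq> K \<Longrightarrow> f I = g I) \<Longrightarrow> alt_sum K f = alt_sum K g"
  unfolding alt_sum_def by (intro sum.cong) auto

text \<open>The sets between a proper subset T and K are half even and half odd. Consequently a
  function of I that is a polynomial of degree less than |K| in the membership indicators has
  alternating sum 0.\<close>

lemma alt_sum_supersets:
  assumes "finite K" "T \<subset> K"
  shows "alt_sum K (\<lambda>I. if T \<subseteq> I then c else 0) = (0 :: 'a::comm_ring_1)"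
proof -
  have "alt_sum K (\<lambda>I. if T \<subseteq> I then c else 0) = (\<Sum>I\<in>{I. I \<subseteq> K \<and> T \<subseteq> I}. (-1) ^ card I * c)"
    unfolding alt_sum_def using assms(1) by (intro sum.mono_neutral_cong_right) auto
  also have "\<dots> = (\<Sum>I\<in>{I. I \<subseteq> K \<and> T \<subseteq> I}. (-1) ^ card I) * c" by (simp add: sum_distrib_right)
  also have "(\<Sum>I\<in>{I. I \<subseteq> K \<and> T \<subseteq> I}. (-1) ^ card I) = (0 :: 'a)"
    using assms card_subsupersets_even_odd[OF assms] by (intro sum_alternating_cancels) auto
  finally show ?thesis by simp
qed

lemma sum_subset_indicator:
  "finite K \<Longrightarrow> I \<subseteq> K \<Longrightarrow> (\<Sum>i\<in>I. c i) = (\<Sum>i\<in>K. if {i} \<subseteq> I then c i else (0 :: 'a::comm_ring_1))"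
  by (intro sum.mono_neutral_cong_left) auto

lemma alt_sum_linear:
  fixes c :: "'b \<Rightarrow> 'a::comm_ring_1"
  assumes "finite K" "2 \<le> card K"
  shows "alt_sum K (\<lambda>I. \<Sum>i\<in>I. c i) = 0"
proof -
  have "alt_sum K (\<lambda>I. \<Sum>i\<in>I. c i) = alt_sum K (\<lambda>I. \<Sum>i\<in>K. if {i} \<subseteq> I then c i else 0)"
    using assms(1) by (intro alt_sum_cong sum_subset_indicator)
  also have "\<dots> = (\<Sum>i\<in>K. alt_sum K (\<lambda>I. if {i} \<subseteq> I then c i else 0))" by (rule alt_sum_sum)
  also have "\<dots> = 0"
  proof (intro sum.neutral ballI alt_sum_supersets assms)
    fix i assume "i \<in> K"
    moreover have "{i} \<noteq> K" using assms(2) by auto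
    ultimately show "{i} \<subset> K" by auto
  qed
  finally show ?thesis .
qed

lemma alt_sum_quadratic:
  fixes c :: "'b \<Rightarrow> 'a::comm_ring_1"
  assumes "finite K" "3 \<le> card K"
  shows "alt_sum K (\<lambda>I. (\<Sum>i\<in>I. c i)\<^sup>2) = 0"
proof -
  have "(\<Sum>i\<in>I. c i)\<^sup>2 = (\<Sum>i\<in>K. \<Sum>j\<in>K. if {i, j} \<subseteq> I then c i * c j else 0)" if "I \<subseteq> K" for I
  proof -
    have "(\<Sum>i\<in>I. c i)\<^sup>2 = (\<Sum>i\<in>K. \<Sum>j\<in>K. (if {i} \<subseteq> I then c i else 0) * (if {j} \<subseteq> I then c j else 0))"
      unfolding power2_eq_square sum_subset_indicator[OF assms(1) that] by (rule sum_product)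
    also have "\<dots> = (\<Sum>i\<in>K. \<Sum>j\<in>K. if {i, j} \<subseteq> I then c i * c j else 0)"
      by (intro sum.cong refl) auto
    finally show ?thesis .
  qed
  then have "alt_sum K (\<lambda>I. (\<Sum>i\<in>I. c i)\<^sup>2) = alt_sum K (\<lambda>I. \<Sum>i\<in>K. \<Sum>j\<in>K. if {i, j} \<subseteq> I then c i * c j else 0)"
    by (rule alt_sum_cong)
  also have "\<dots> = (\<Sum>i\<in>K. \<Sum>j\<in>K. alt_sum K (\<lambda>I. if {i, j} \<subseteq> I then c i * c j else 0))"
    by (simp only: alt_sum_sum)
  also have "\<dots> = 0"
  proof (intro sum.neutral ballI alt_sum_supersets assms)
    fix i j assume "i \<in> K" "j \<in> K"
    moreover have "{i, j} \<noteq> K"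
    proof
      assume "{i, j} = K"
      moreover have "card {i, j} \<le> 2" by (cases "i = j") auto
      ultimately show False using assms(2) by simp
    qed
    ultimately show "{i, j} \<subset> K" by auto
  qed
  finally show ?thesis .
qed

text \<open>Moebius inversion expresses f through its alternating sums. Squaring gives pairs (G, H),
  which are grouped by their union; inverting once more isolates the pairs with union K.\<close>

lemma alt_sum_square:
  fixes f :: "'b set \<Rightarrow> 'a::comm_ring_1"
  assumes "finite K"
  shows "alt_sum K (\<lambda>I. (f I)\<^sup>2) =
    (\<Sum>(G, H) | G \<subseteq> K \<and> H \<subseteq> K \<and> G \<union> H = K. (-1) ^ (card G + card H + card K) * (alt_sum G f * alt_sum H f))"
proof -
  let ?l = "\<lambda>G. (-1) ^ card G * alt_sum G f"
  let ?U = "\<lambda>M. {(G, H). G \<subseteq> M \<and> H \<subseteq> M \<and> G \<union> H = M}"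
  define q where "q M = (\<Sum>(G, H)\<in>?U M. ?l G * ?l H)" for M
  have inv: "f S = (\<Sum>T\<in>Pow S. ?l T)" if "finite S" for S
    by (rule inclusion_exclusion_symmetric[OF _ that, of "\<lambda>S. alt_sum S f"]) (simp add: alt_sum_def)
  \<comment> \<open>The two equal signs cancel; they only bring the sum into the form that can be
    inverted.\<close>
  have sq: "(f S)\<^sup>2 = (\<Sum>T\<in>Pow S. (-1) ^ card T * ((-1) ^ card T * q T))" if S: "finite S" for S
  proof -
    have "(f S)\<^sup>2 = (\<Sum>p\<in>Pow S \<times> Pow S. ?l (fst p) * ?l (snd p))"
      unfolding power2_eq_square inv[OF S] by (simp add: sum_product sum.cartesian_product case_prod_unfold)
    also have "\<dots> = (\<Sum>M\<in>Pow S. \<Sum>p\<in>{p \<in> Pow S \<times> Pow S. fst p \<union> snd p = M}. ?l (fst p) * ?l (snd p))"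
      using S by (intro sum.group[symmetric]) auto
    also have "\<dots> = (\<Sum>M\<in>Pow S. q M)"
    proof (rule sum.cong[OF refl])
      fix M assume "M \<in> Pow S"
      then have "{p \<in> Pow S \<times> Pow S. fst p \<union> snd p = M} = ?U M" by auto
      then show "(\<Sum>p\<in>{p \<in> Pow S \<times> Pow S. fst p \<union> snd p = M}. ?l (fst p) * ?l (snd p)) = q M"
        unfolding q_def by (simp add: case_prod_unfold)
    qed
    finally show ?thesis by (simp flip: mult.assoc power_add)
  qed
  have "(-1) ^ card K * q K = alt_sum K (\<lambda>S. (f S)\<^sup>2)"
    unfolding alt_sum_def by (rule inclusion_exclusion_symmetric[OF sq assms])
  then show ?thesis
    unfolding q_def sum_distrib_left
    by (simp add: case_prod_unfold power_add mult_ac)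
qed

section \<open>Logarithmic derivatives\<close>

lemma partial_deriv_add: "partial_deriv i (f + g) = partial_deriv i f + partial_deriv i g"
  by (rule poly_mapping_eqI) (simp only: lookup_add lookup_partial_deriv distrib_left)

lemma partial_deriv_diff: "partial_deriv i (f - g) = partial_deriv i f - partial_deriv i g"
  by (rule poly_mapping_eqI) (simp only: lookup_minus lookup_partial_deriv right_diff_distrib)

lemma pvar_nonzero: "pvar i \<noteq> (0 :: 'a::zero_neq_one mpol)"
proof
  assume "pvar i = (0 :: 'a mpol)"
  then have "lookup (pvar i :: 'a mpol) (single i 1) = 0" by simp
  then show False by (simp add: pvar_def)
qed

text \<open>The operator x_i d/dx_i multiplies each coefficient by the exponent of x_i, so its
  Leibniz rule is additivity of exponents. The factor x_i is cancelled afterwards.\<close>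

lemma partial_deriv_mult:
  "partial_deriv i (f * g :: 'a::field mpol) = partial_deriv i f * g + f * partial_deriv i g"
proof -
  have "pvar i * partial_deriv i (f * g) =
      (pvar i * partial_deriv i f) * g + f * (pvar i * partial_deriv i g)"
  proof (rule poly_mapping_eqI)
    fix m
    have "lookup (pvar i * partial_deriv i (f * g)) m =
        (\<Sum>(a, b) | a + b = m. of_nat (lookup m i) * (lookup f a * lookup g b))"
      by (simp only: lookup_pvar_deriv lookup_times[of f g] sum_distrib_left case_prod_unfold)
    also have "\<dots> = (\<Sum>(a, b) | a + b = m. (of_nat (lookup a i) * lookup f a) * lookup g b +
        lookup f a * (of_nat (lookup b i) * lookup g b))"
      by (rule sum.cong[OF refl]) (auto simp: lookup_add algebra_simps)
    also have "\<dots> = lookup ((pvar i * partial_deriv i f) * g + f * (pvar i * partial_deriv i g)) m"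
      by (simp only: lookup_add lookup_times[of "pvar i * _" g] lookup_times[of f] lookup_pvar_deriv
          sum.distrib case_prod_unfold)
    finally show "lookup (pvar i * partial_deriv i (f * g)) m =
      lookup ((pvar i * partial_deriv i f) * g + f * (pvar i * partial_deriv i g)) m" .
  qed
  then have "pvar i * partial_deriv i (f * g) = pvar i * (partial_deriv i f * g + f * partial_deriv i g)"
    by (simp add: algebra_simps)
  then show ?thesis by (simp add: pvar_nonzero)
qed

definition dlog :: "nat \<Rightarrow> 'a::field mpol \<Rightarrow> 'a mpol fract" where
  "dlog i f = to_fract (partial_deriv i f) / to_fract f"

text \<open>The second derivative of log f. Unlike f''/f it is additive on products, which leaves
  the square of \<open>dlog\<close> as the only nonlinear part of D_2 f / f.\<close>

definition d2log :: "nat \<Rightarrow> 'a::field mpol \<Rightarrow> 'a mpol fract" where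
  "d2log i f = to_fract (partial_deriv i (partial_deriv i f)) / to_fract f - (dlog i f)\<^sup>2"

lemma dlog_mult:
  assumes "f \<noteq> 0" "g \<noteq> 0"
  shows "dlog i (f * g) = dlog i f + dlog i g"
  using assms by (simp add: dlog_def partial_deriv_mult field_simps)

lemma d2log_mult:
  assumes "f \<noteq> 0" "g \<noteq> 0"
  shows "d2log i (f * g) = d2log i f + d2log i g"
proof -
  have alg: "(f2 * g0 + f1 * g1 + (f1 * g1 + f0 * g2)) / (f0 * g0) - (f1 / f0 + g1 / g0)\<^sup>2 =
      (f2 / f0 - (f1 / f0)\<^sup>2) + (g2 / g0 - (g1 / g0)\<^sup>2)" if "f0 \<noteq> 0" "g0 \<noteq> 0"
    for f0 f1 f2 g0 g1 g2 :: "'a mpol fract"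
    using that by (simp add: power2_eq_square add_divide_distrib algebra_simps)
  show ?thesis
    unfolding d2log_def dlog_mult[OF assms] unfolding dlog_def partial_deriv_mult partial_deriv_add
      to_fract_add to_fract_mult
    by (rule alg) (use assms in auto)
qed

lemma dlog_one: "dlog i 1 = 0"
proof -
  have "partial_deriv i (1 :: 'a mpol) = 0"
    by (rule poly_mapping_eqI) (auto simp: lookup_partial_deriv lookup_one when_def
        dest: arg_cong[of _ _ "\<lambda>m. lookup m i"] simp: lookup_add)
  then show ?thesis by (simp add: dlog_def)
qed

lemma d2log_one: "d2log i 1 = 0"
  using d2log_mult[OF one_neq_zero one_neq_zero, of i] unfolding mult_1 by (metis add_cancel_right_right)

lemma dlog_prod: "(\<And>x. x \<in> A \<Longrightarrow> f x \<noteq> 0) \<Longrightarrow> dlog i (prod f A) = (\<Sum>x\<in>A. dlog i (f x))"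
  by (induction A rule: infinite_finite_induct) (auto simp: dlog_one dlog_mult)

lemma d2log_prod: "(\<And>x. x \<in> A \<Longrightarrow> f x \<noteq> 0) \<Longrightarrow> d2log i (prod f A) = (\<Sum>x\<in>A. d2log i (f x))"
  by (induction A rule: infinite_finite_induct) (auto simp: d2log_one d2log_mult)

lemma coeffs_in_partial_deriv: "coeffs_in (vanishing k) f \<Longrightarrow> coeffs_in (vanishing k) (partial_deriv i f)"
  unfolding coeffs_in_def lookup_partial_deriv by (blast intro: vanishing_mult_left no_pole_of_nat)

text \<open>Over the common denominator f g the numerator is (p - q) g - (f - g) q.\<close>

lemma gauss_quotient_diff:
  assumes "primitive f" "primitive g" "coeffs_in (vanishing k) (f - g)"
    and "coeffs_in (vanishing k) (p - q)" "coeffs_in (vanishing 0) q"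
  shows "to_fract p / to_fract f - to_fract q / to_fract g \<in> gauss k"
proof -
  have "coeffs_in (vanishing (k + 0)) ((p - q) * g)" "coeffs_in (vanishing (k + 0)) ((f - g) * q)"
    using assms by (blast intro: coeffs_in_mult primitive_coeffs)+
  then have "to_fract ((p - q) * g - (f - g) * q) / to_fract (f * g) \<in> gauss k"
    using assms by (intro gaussI coeffs_in_diff primitive_mult) simp_all
  moreover have "to_fract f \<noteq> 0" "to_fract g \<noteq> 0" using assms by (auto simp: primitive_nonzero)
  ultimately show ?thesis by (simp add: field_simps)
qed

lemma dlog_gauss_diff:
  assumes "primitive f" "primitive g" "coeffs_in (vanishing k) (f - g)"
  shows "dlog i f - dlog i g \<in> gauss k"
  unfolding dlog_def using assms
  by (intro gauss_quotient_diff) (auto simp flip: partial_deriv_diff intro: coeffs_in_partial_deriv primitive_coeffs)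

lemma dlog_gauss: "primitive f \<Longrightarrow> dlog i f \<in> gauss 0"
  unfolding dlog_def by (intro gaussI coeffs_in_partial_deriv primitive_coeffs)

lemma d2log_gauss_diff:
  assumes "primitive f" "primitive g" "coeffs_in (vanishing k) (f - g)"
  shows "d2log i f - d2log i g \<in> gauss k"
proof -
  have "to_fract (partial_deriv i (partial_deriv i f)) / to_fract f -
      to_fract (partial_deriv i (partial_deriv i g)) / to_fract g \<in> gauss k"
    using assms
    by (intro gauss_quotient_diff) (auto simp flip: partial_deriv_diff intro: coeffs_in_partial_deriv primitive_coeffs)
  moreover have "(dlog i f + dlog i g) * (dlog i f - dlog i g) \<in> gauss k"
    using assms by (intro gauss_mult_left gauss_add dlog_gauss dlog_gauss_diff)
  ultimately have "(to_fract (partial_deriv i (partial_deriv i f)) / to_fract f -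
      to_fract (partial_deriv i (partial_deriv i g)) / to_fract g) -
      (dlog i f + dlog i g) * (dlog i f - dlog i g) \<in> gauss k"
    by (rule gauss_diff)
  then show ?thesis by (simp add: d2log_def power2_eq_square algebra_simps)
qed

lemma d2log_gauss: "primitive f \<Longrightarrow> d2log i f \<in> gauss 0"
  using d2log_gauss_diff[OF _ primitive_one, of f 0 i]
  by (simp add: d2log_one coeffs_in_diff primitive_coeffs coeffs_in_one)

definition D1_weight :: "nat \<Rightarrow> nat \<Rightarrow> 'a::field mpol fract" where
  "D1_weight N i = (\<Sum>j\<in>{..<N} - {i}. to_fract (pvar i) ^ 2 / (to_fract (pvar i) - to_fract (pvar j)))"

text \<open>D_1 f / f. As D_1 is a first-order derivation, this turns products into sums.\<close>

definition D1_log :: "nat \<Rightarrow> 'a::field mpol \<Rightarrow> 'a mpol fract" where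
  "D1_log N f = (\<Sum>i<N. D1_weight N i * dlog i f)"

lemma D1_op_log:
  assumes "f \<noteq> 0"
  shows "D1_op N f = D1_log N f * to_fract f"
proof -
  have "dlog i f * to_fract f = to_fract (partial_deriv i f)" for i
    using assms by (simp add: dlog_def)
  then show ?thesis
    unfolding D1_op_def D1_log_def D1_weight_def by (simp only: sum_distrib_right mult.assoc)
qed

lemma D1_log_prod: "(\<And>x. x \<in> A \<Longrightarrow> f x \<noteq> 0) \<Longrightarrow> D1_log N (prod f A) = (\<Sum>x\<in>A. D1_log N (f x))"
  by (simp add: D1_log_def dlog_prod sum_distrib_left) (rule sum.swap)

lemma D1_op_diff: "D1_op N (f - g) = D1_op N f - D1_op N g"
  by (simp add: D1_op_def partial_deriv_diff right_diff_distrib sum_subtractf)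

lemma pvar_coeffs: "coeffs_in (vanishing 0) (pvar i)"
  by (auto simp: coeffs_in_def pvar_def lookup_single when_def vanishing_0_iff no_pole_intros)

lemma pvar_gauss: "to_fract (pvar i) \<in> gauss 0"
  by (rule gauss_to_fract[OF pvar_coeffs])

lemma pvar2_gauss: "to_fract (pvar i) ^ 2 \<in> gauss 0"
  unfolding power2_eq_square by (intro gauss_mult_left pvar_gauss)

definition D2_log :: "nat \<Rightarrow> 'a::field mpol \<Rightarrow> 'a mpol fract" where
  "D2_log N f = 1 / 2 * (\<Sum>i<N. to_fract (pvar i) ^ 2 * (d2log i f + (dlog i f)\<^sup>2))"

lemma D_alpha_log:
  fixes f :: "rat ratfun mpol"
  assumes "f \<noteq> 0"
  shows "D_alpha N f = (D1_log N f + to_fract (pconst alpha) * D2_log N f) * to_fract f"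
proof -
  have "to_fract (partial_deriv i (partial_deriv i f)) = (d2log i f + (dlog i f)\<^sup>2) * to_fract f" for i
    using assms by (simp add: d2log_def)
  then have "D2_op N f = D2_log N f * to_fract f"
    unfolding D2_op_def D2_log_def by (simp only: sum_distrib_right mult.assoc)
  then show ?thesis unfolding D_alpha_def D1_op_log[OF assms] by (simp only: distrib_right mult.assoc)
qed

section \<open>Strong factorization in finitely many variables\<close>

lemma sf_coeff_mult_support:
  assumes "\<And>m. sf_coeff f m \<noteq> 0 \<Longrightarrow> dom_by m \<mu>" "\<And>m. sf_coeff g m \<noteq> 0 \<Longrightarrow> dom_by m \<nu>"
    and "sf_coeff (f * g) m \<noteq> 0"
  shows "dom_by m (\<mu> + \<nu>)"
proof -
  have "(\<Sum>(a, b) | a + b = m. sf_coeff f a * sf_coeff g b) \<noteq> 0" using assms(3) by (simp add: sf_coeff_mult)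
  then obtain p where "p \<in> {(a, b). a + b = m}" "(case p of (a, b) \<Rightarrow> sf_coeff f a * sf_coeff g b) \<noteq> 0"
    by (rule sum.not_neutral_contains_not_neutral)
  then obtain a b where "a + b = m" "sf_coeff f a \<noteq> 0" "sf_coeff g b \<noteq> 0" by force
  then show ?thesis using assms(1,2) dom_by_add by metis
qed

lemma sf_coeff_mult_top:
  assumes "\<And>m. sf_coeff f m \<noteq> 0 \<Longrightarrow> dom_by m \<mu>" "\<And>m. sf_coeff g m \<noteq> 0 \<Longrightarrow> dom_by m \<nu>"
  shows "sf_coeff (f * g) (\<mu> + \<nu>) = sf_coeff f \<mu> * sf_coeff g \<nu>"
proof -
  have "sf_coeff (f * g) (\<mu> + \<nu>) = (\<Sum>p | fst p + snd p = \<mu> + \<nu>. sf_coeff f (fst p) * sf_coeff g (snd p))"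
    by (simp add: sf_coeff_mult case_prod_unfold)
  also have "\<dots> = (\<Sum>p\<in>{(\<mu>, \<nu>)}. sf_coeff f (fst p) * sf_coeff g (snd p))"
  proof (rule sum.mono_neutral_right)
    show "finite {p. fst p + snd p = \<mu> + \<nu>}"
      using finite_decompositions[of "\<mu> + \<nu>"] by (simp add: case_prod_unfold)
    show "\<forall>p\<in>{p. fst p + snd p = \<mu> + \<nu>} - {(\<mu>, \<nu>)}. sf_coeff f (fst p) * sf_coeff g (snd p) = 0"
    proof
      fix p assume p: "p \<in> {p. fst p + snd p = \<mu> + \<nu>} - {(\<mu>, \<nu>)}"
      then have "\<not> (dom_by (fst p) \<mu> \<and> dom_by (snd p) \<nu>)"
        using dom_by_add_top[of "fst p" \<mu> "snd p" \<nu>] by (cases p) auto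
      then show "sf_coeff f (fst p) * sf_coeff g (snd p) = 0"
        using assms(1)[of "fst p"] assms(2)[of "snd p"]
        by (cases "sf_coeff f (fst p) = 0"; cases "sf_coeff g (snd p) = 0") auto
    qed
  qed auto
  finally show ?thesis by simp
qed

lemma sf_coeff_one: "sf_coeff 1 m = (if m = 0 then 1 else 0)"
  by (simp add: one_symf.rep_eq)

lemma sf_coeff_prod:
  assumes "finite X" "\<And>x m. x \<in> X \<Longrightarrow> sf_coeff (f x) m \<noteq> 0 \<Longrightarrow> dom_by m (\<nu> x)"
  shows "sf_coeff (\<Prod>x\<in>X. f x) m \<noteq> 0 \<Longrightarrow> dom_by m (\<Sum>x\<in>X. \<nu> x)"
    and "sf_coeff (\<Prod>x\<in>X. f x) (\<Sum>x\<in>X. \<nu> x) = (\<Prod>x\<in>X. sf_coeff (f x) (\<nu> x))"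
proof -
  have "(\<forall>m. sf_coeff (\<Prod>x\<in>X. f x) m \<noteq> 0 \<longrightarrow> dom_by m (\<Sum>x\<in>X. \<nu> x)) \<and>
    sf_coeff (\<Prod>x\<in>X. f x) (\<Sum>x\<in>X. \<nu> x) = (\<Prod>x\<in>X. sf_coeff (f x) (\<nu> x))"
    using assms
  proof (induction X rule: finite_induct)
    case empty
    then show ?case by (auto simp: sf_coeff_one dom_by_refl[OF partition_zero])
  next
    case (insert x X)
    then have IH: "\<And>m. sf_coeff (\<Prod>x\<in>X. f x) m \<noteq> 0 \<Longrightarrow> dom_by m (\<Sum>x\<in>X. \<nu> x)"
      "sf_coeff (\<Prod>x\<in>X. f x) (\<Sum>x\<in>X. \<nu> x) = (\<Prod>x\<in>X. sf_coeff (f x) (\<nu> x))" by auto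
    have fx: "\<And>m. sf_coeff (f x) m \<noteq> 0 \<Longrightarrow> dom_by m (\<nu> x)" using insert by auto
    show ?case
      using sf_coeff_mult_support[of "f x" "\<nu> x" "prod f X" "sum \<nu> X", OF fx IH(1)]
        sf_coeff_mult_top[of "f x" "\<nu> x" "prod f X" "sum \<nu> X", OF fx IH(1)] insert.hyps IH(2)
      by auto
  qed
  then show "sf_coeff (\<Prod>x\<in>X. f x) m \<noteq> 0 \<Longrightarrow> dom_by m (\<Sum>x\<in>X. \<nu> x)"
    and "sf_coeff (\<Prod>x\<in>X. f x) (\<Sum>x\<in>X. \<nu> x) = (\<Prod>x\<in>X. sf_coeff (f x) (\<nu> x))" by auto
qed

lemma keys_sum_subset:
  fixes f :: "'b \<Rightarrow> exponent"
  shows "(\<And>i. i \<in> I \<Longrightarrow> keys (f i) \<subseteq> S) \<Longrightarrow> keys (sum f I) \<subseteq> S"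
  by (induction I rule: infinite_finite_induct) (auto simp: keys_add_exponent)

lemma gauss_sign: "x \<in> gauss k \<Longrightarrow> (-1) ^ n * x \<in> gauss k"
  by (cases "even n") (auto simp: gauss_uminus)

text \<open>In \<open>alt_sum_square\<close> two proper nonempty subsets give order at least |G| - 1
  + |H| - 1 \<ge> |K| - 2 \<ge> k. Pairs containing K use the bound \<open>top\<close>, and pairs
  containing the empty set vanish because \<open>f {} = 0\<close>.\<close>

lemma alt_sum_square_gauss:
  assumes K: "finite K" and e: "f {} = 0" and top: "alt_sum K f \<in> gauss k"
    and sub: "\<And>G. G \<subset> K \<Longrightarrow> G \<noteq> {} \<Longrightarrow> alt_sum G f \<in> gauss (card G - 1)" and k: "k + 2 \<le> card K"
  shows "alt_sum K (\<lambda>I. (f I)\<^sup>2) \<in> gauss k"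
proof -
  have zero: "alt_sum {} f = 0" using e by (simp add: alt_sum_def)
  have np: "alt_sum G f \<in> gauss 0" if "G \<subseteq> K" for G
    using that sub[of G] top zero gauss_antimono[of 0] gauss_zero by (cases "G = {}"; cases "G = K") auto
  have pair: "alt_sum G f * alt_sum H f \<in> gauss k" if GH: "G \<subseteq> K" "H \<subseteq> K" "G \<union> H = K" for G H
  proof -
    consider "G = {} \<or> H = {}" | "G = K" | "H = K" | "G \<noteq> {}" "H \<noteq> {}" "G \<subset> K" "H \<subset> K"
      using GH by blast
    then show ?thesis
    proof cases
      case 1
      then show ?thesis by (auto simp: zero gauss_zero)
    next
      case 2
      then show ?thesis using gauss_mult_left[OF np[OF GH(2)] top] by (simp add: mult.commute)
    next
      case 3
      then show ?thesis using gauss_mult_left[OF np[OF GH(1)] top] by simp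
    next
      case 4
      have "card G \<ge> 1" "card H \<ge> 1" using 4 GH K by (auto simp: Suc_le_eq card_gt_0_iff intro: finite_subset)
      moreover have "card K \<le> card G + card H" using card_Un_le[of G H] GH(3) by simp
      ultimately have "k \<le> (card G - 1) + (card H - 1)" using k by linarith
      then show ?thesis using gauss_mult[OF sub[of G] sub[of H]] 4 gauss_antimono by blast
    qed
  qed
  show ?thesis unfolding alt_sum_square[OF K] by (rule gauss_sum) (auto intro: gauss_sign pair)
qed

section \<open>Constants and alternating sums of eigenvalues\<close>

lemma pconst_add: "pconst (a + b) = pconst a + pconst b"
  by (simp add: pconst_def single_add)

lemma pconst_diff: "pconst (a - b :: 'a::ab_group_add) = pconst a - pconst b"
  by (simp add: pconst_def single_diff)

lemma pconst_sum: "pconst (sum f A) = (\<Sum>x\<in>A. pconst (f x))"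
  by (induction A rule: infinite_finite_induct) (auto simp: pconst_def single_add)

lemma alt_sum_pconst:
  "finite K \<Longrightarrow> alt_sum K (\<lambda>I. to_fract (pconst (e I))) = to_fract (pconst (alt_sum K e))"
  by (simp add: alt_sum_even_odd pconst_diff pconst_sum)

lemma gauss_pconst: "c \<in> vanishing k \<Longrightarrow> to_fract (pconst c) \<in> gauss k"
  by (intro gauss_to_fract) (auto simp: coeffs_in_def pconst_def lookup_single when_def)

lemma half_gauss: "(1 / 2 :: rat ratfun mpol fract) \<in> gauss 0"
proof -
  have 1: "2 * to_fract (pconst (1 / 2)) = (1 :: rat ratfun mpol fract)"
    using arg_cong[OF half_plus_half[of "1 :: rat ratfun mpol"], of to_fract]
    by (simp only: to_fract_add to_fract_1 mult_1_right mult_2)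
  have 2: "2 * (1 / 2) = (1 :: rat ratfun mpol fract)"
    by (simp only: times_divide_eq_right mult_1_right divide_self[OF two_nonzero])
  have "1 / (2 :: rat ratfun) \<in> vanishing 0" by (simp only: vanishing_0_iff half_no_pole)
  then show ?thesis unfolding two_cancel[OF 2 1] by (rule gauss_pconst)
qed

lemma lap_no_pole:
  assumes "no_pole_at_0 t" "\<And>m. no_pole_at_0 (F m)"
  shows "no_pole_at_0 (lap t N F m)"
proof -
  have "no_pole_at_0 (raise_sum F m)" unfolding raise_sum_def raise_pair_def using assms by (intro no_pole_intros)
  then have "no_pole_at_0 (eig t N m * F m + (1 / 2) * raise_sum F m)"
    using assms by (intro no_pole_add no_pole_mult no_pole_eig half_no_pole)
  then show ?thesis by (simp add: lap_def)
qed

lemma eig_zero_add: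
  "is_partition \<mu> \<Longrightarrow> is_partition \<nu> \<Longrightarrow> eig 0 N (\<mu> + \<nu>) = eig 0 N \<mu> + eig 0 N \<nu>"
  by (simp add: eig_def bstat_conjugate_add part_size_add algebra_simps)

lemma conjugate_zero: "conjugate 0 = 0"
  by (rule poly_mapping_eqI) (simp add: lookup_conjugate)

lemma eig_zero_zero: "eig t N 0 = 0"
  by (simp add: eig_def bstat_def conjugate_zero part_size_def)

lemma eig_zero_sum:
  "(\<And>i. i \<in> I \<Longrightarrow> is_partition (f i)) \<Longrightarrow> eig 0 N (sum f I) = (\<Sum>i\<in>I. eig 0 N (f i))"
  by (induction I rule: infinite_finite_induct) (auto simp: eig_zero_zero eig_zero_add partition_sum)

lemma eig_split: "eig t N m = t * of_nat (bstat m) + eig 0 N m"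
  by (simp add: eig_def)

lemma alt_sum_no_pole: "(\<And>I. no_pole_at_0 (f I)) \<Longrightarrow> no_pole_at_0 (alt_sum K f)"
  unfolding alt_sum_def by (intro no_pole_intros)

lemma alt_sum_bstat:
  fixes \<mu> :: "'b \<Rightarrow> exponent"
  assumes K: "finite K" "3 \<le> card K"
  shows "alt_sum K (\<lambda>I. of_nat (bstat (\<Sum>i\<in>I. \<mu> i)) :: rat ratfun) = 0"
proof -
  let ?S = "keys (\<Sum>i\<in>K. \<mu> i)"
  let ?s = "\<lambda>I j. \<Sum>i\<in>I. of_nat (lookup (\<mu> i) j) :: rat ratfun"
  have b: "2 * of_nat (bstat (\<Sum>i\<in>I. \<mu> i)) = (\<Sum>j\<in>?S. (?s I j)\<^sup>2 - ?s I j)" if I: "I \<subseteq> K" for I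
  proof -
    have "keys (\<Sum>i\<in>I. \<mu> i) \<subseteq> ?S"
    proof
      fix j assume "j \<in> keys (\<Sum>i\<in>I. \<mu> i)"
      then have "(\<Sum>i\<in>I. lookup (\<mu> i) j) \<noteq> 0" unfolding in_keys_iff lookup_sum .
      moreover have "(\<Sum>i\<in>I. lookup (\<mu> i) j) \<le> (\<Sum>i\<in>K. lookup (\<mu> i) j)"
        using K I by (intro sum_mono2) auto
      ultimately have "(\<Sum>i\<in>K. lookup (\<mu> i) j) \<noteq> 0" by linarith
      then show "j \<in> ?S" unfolding in_keys_iff lookup_sum .
    qed
    then have "2 * bstat (\<Sum>i\<in>I. \<mu> i) = (\<Sum>j\<in>?S. 2 * (lookup (\<Sum>i\<in>I. \<mu> i) j choose 2))"
      by (simp add: bstat_superset[of ?S] sum_distrib_left)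
    then have "of_nat (2 * bstat (\<Sum>i\<in>I. \<mu> i)) = (of_nat (\<Sum>j\<in>?S. 2 * (lookup (\<Sum>i\<in>I. \<mu> i) j choose 2)) :: rat ratfun)"
      by (simp only:)
    also have "\<dots> = (\<Sum>j\<in>?S. of_nat (2 * (lookup (\<Sum>i\<in>I. \<mu> i) j choose 2)))" by (rule of_nat_sum)
    also have "\<dots> = (\<Sum>j\<in>?S. (?s I j)\<^sup>2 - ?s I j)"
    proof (rule sum.cong[OF refl])
      fix j
      have "of_nat (2 * (n choose 2)) = (of_nat n)\<^sup>2 - (of_nat n :: rat ratfun)" for n
        unfolding two_choose_two by (cases n) (simp_all add: power2_eq_square algebra_simps)
      then show "of_nat (2 * (lookup (\<Sum>i\<in>I. \<mu> i) j choose 2)) = (?s I j)\<^sup>2 - ?s I j"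
        by (simp only: lookup_sum of_nat_sum)
    qed
    finally show ?thesis by simp
  qed
  have "2 * alt_sum K (\<lambda>I. of_nat (bstat (\<Sum>i\<in>I. \<mu> i)) :: rat ratfun) =
      alt_sum K (\<lambda>I. \<Sum>j\<in>?S. (?s I j)\<^sup>2 - ?s I j)"
    unfolding alt_sum_mult_left[symmetric] by (rule alt_sum_cong[OF b])
  also have "\<dots> = 0"
    using K by (simp add: alt_sum_sum alt_sum_diff alt_sum_linear alt_sum_quadratic)
  finally show ?thesis by simp
qed

text \<open>The part of the eigenvalue without \<alpha> is additive and cancels, since |K| \<ge> 2.
  The rest is \<alpha> times a quadratic function, which cancels for |K| \<ge> 3; for |K| = 2 only k
  = 0 occurs, where the factor \<alpha> suffices.\<close>

lemma alt_sum_eig: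
  assumes K: "finite K" and part: "\<And>i. i \<in> K \<Longrightarrow> is_partition (\<mu> i)" and k: "k + 2 \<le> card K"
  shows "alt_sum K (\<lambda>I. eig alpha N (\<Sum>i\<in>I. \<mu> i)) \<in> vanishing (Suc k)"
proof -
  have "alt_sum K (\<lambda>I. eig alpha N (\<Sum>i\<in>I. \<mu> i)) =
      alt_sum K (\<lambda>I. alpha * of_nat (bstat (\<Sum>i\<in>I. \<mu> i)) + (\<Sum>i\<in>I. eig 0 N (\<mu> i)))"
  proof (rule alt_sum_cong)
    fix I assume "I \<subseteq> K"
    then show "eig alpha N (\<Sum>i\<in>I. \<mu> i) = alpha * of_nat (bstat (\<Sum>i\<in>I. \<mu> i)) + (\<Sum>i\<in>I. eig 0 N (\<mu> i))"
      using part by (subst eig_split) (simp add: eig_zero_sum subset_eq)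
  qed
  also have "\<dots> = alpha * alt_sum K (\<lambda>I. of_nat (bstat (\<Sum>i\<in>I. \<mu> i)))"
    unfolding alt_sum_add alt_sum_mult_left using K k by (simp add: alt_sum_linear)
  also have "\<dots> \<in> vanishing (Suc k)"
  proof (cases "3 \<le> card K")
    case True
    then show ?thesis using K by (simp add: alt_sum_bstat)
  next
    case False
    then have "k = 0" using k by simp
    then show ?thesis
      by (intro vanishingI[of "alt_sum K (\<lambda>I. of_nat (bstat (\<Sum>i\<in>I. \<mu> i)))"])
        (auto intro: alt_sum_no_pole no_pole_of_nat)
  qed
  finally show ?thesis .
qed

section \<open>The products over even and odd subsets\<close>

definition Jack_even :: "('b \<Rightarrow> exponent) \<Rightarrow> 'b set \<Rightarrow> rat ratfun symf" where
  "Jack_even \<mu> K = (\<Prod>I\<in>even_sets K. Jack (\<Sum>i\<in>I. \<mu> i))"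

definition Jack_odd :: "('b \<Rightarrow> exponent) \<Rightarrow> 'b set \<Rightarrow> rat ratfun symf" where
  "Jack_odd \<mu> K = (\<Prod>I\<in>odd_sets K. Jack (\<Sum>i\<in>I. \<mu> i))"

text \<open>Every index lies in equally many even and odd subsets, so the two products share their
  leading partition. The count passes through the integers because alternating sums need
  signs.\<close>

lemma sum_even_odd_sets:
  fixes \<mu> :: "'b \<Rightarrow> exponent"
  assumes "finite K" "2 \<le> card K"
  shows "(\<Sum>I\<in>even_sets K. \<Sum>i\<in>I. \<mu> i) = (\<Sum>I\<in>odd_sets K. \<Sum>i\<in>I. \<mu> i)"
proof (rule poly_mapping_eqI)
  fix j
  have "(\<Sum>I\<in>even_sets K. \<Sum>i\<in>I. int (lookup (\<mu> i) j)) - (\<Sum>I\<in>odd_sets K. \<Sum>i\<in>I. int (lookup (\<mu> i) j)) = 0"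
    using alt_sum_linear[OF assms, of "\<lambda>i. int (lookup (\<mu> i) j)"] by (simp add: alt_sum_even_odd assms)
  then have "int (\<Sum>I\<in>even_sets K. \<Sum>i\<in>I. lookup (\<mu> i) j) = int (\<Sum>I\<in>odd_sets K. \<Sum>i\<in>I. lookup (\<mu> i) j)"
    by (simp only: of_nat_sum right_minus_eq)
  then show "lookup (\<Sum>I\<in>even_sets K. \<Sum>i\<in>I. \<mu> i) j = lookup (\<Sum>I\<in>odd_sets K. \<Sum>i\<in>I. \<mu> i) j"
    by (simp only: lookup_sum of_nat_eq_iff)
qed

text \<open>The leading coefficient \<open>hook_alpha\<close> is a unit of the local ring, and the
  bound on the keys keeps the leading monomial alive in N variables.\<close>

lemma Jack_primitive:
  assumes "is_partition \<mu>" "keys \<mu> \<subseteq> {..<N}"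
  shows "primitive (restrict_vars N (Jack \<mu>))"
proof -
  have "lookup (mpol_res (restrict_vars N (Jack \<mu>))) \<mu> \<noteq> 0"
    using assms by (simp add: lookup_mpol_res lookup_restrict_vars Jack_top hook_alpha_res0)
  then have "mpol_res (restrict_vars N (Jack \<mu>)) \<noteq> 0" by force
  then show ?thesis
    using Jack_coeff_no_pole[OF assms(1)]
    by (auto simp: primitive_def coeffs_in_def lookup_restrict_vars vanishing_0_iff no_pole_0)
qed

lemma Jack_log_equation:
  assumes "is_partition \<mu>" "keys \<mu> \<subseteq> {..<N}"
  defines "F \<equiv> restrict_vars N (Jack \<mu>)"
  shows "D1_log N F + to_fract (pconst alpha) * D2_log N F = to_fract (pconst (eig alpha N \<mu>))"
proof -
  have "F \<noteq> 0" unfolding F_def by (intro primitive_nonzero Jack_primitive assms)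
  then show ?thesis
    using D_alpha_Jack[OF assms(1), of N] D_alpha_log[of F N] by (simp add: F_def)
qed

text \<open>Both \<alpha> D_2 and the \<alpha>-part of the eigenvalue have order 1, so modulo
  \<alpha> a Jack polynomial is an eigenfunction of D_1.\<close>

lemma Jack_D1_log:
  assumes "is_partition \<mu>" "keys \<mu> \<subseteq> {..<N}"
  shows "D1_log N (restrict_vars N (Jack \<mu>)) - to_fract (pconst (eig 0 N \<mu>)) \<in> gauss 1"
proof -
  let ?F = "restrict_vars N (Jack \<mu>)"
  have pr: "primitive ?F" by (rule Jack_primitive[OF assms])
  have "D2_log N ?F \<in> gauss 0"
    unfolding D2_log_def power2_eq_square[of "dlog _ _"]
    by (intro gauss_mult_left half_gauss gauss_sum pvar2_gauss gauss_add d2log_gauss dlog_gauss pr)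
  then have a: "to_fract (pconst alpha) * D2_log N ?F \<in> gauss (1 + 0)"
    by (intro gauss_mult gauss_pconst alpha_in_vanishing)
  have b: "to_fract (pconst (alpha * of_nat (bstat \<mu>) :: rat ratfun)) \<in> gauss 1"
    using alpha_power_vanishing[of "of_nat (bstat \<mu>)" 1] by (intro gauss_pconst) (simp add: no_pole_of_nat)
  have "to_fract (pconst (eig alpha N \<mu>)) =
      to_fract (pconst (alpha * of_nat (bstat \<mu>))) + to_fract (pconst (eig 0 N \<mu>))"
    by (subst eig_split) (simp add: pconst_add)
  then have c: "D1_log N ?F - to_fract (pconst (eig 0 N \<mu>)) =
      to_fract (pconst (alpha * of_nat (bstat \<mu>))) - to_fract (pconst alpha) * D2_log N ?F"
    using Jack_log_equation[OF assms] by (simp add: algebra_simps)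
  show ?thesis unfolding c by (rule gauss_diff[OF b a[unfolded add_0_right]])
qed

lemma Jack_parts_support:
  assumes K: "finite K" and part: "\<And>i. i \<in> K \<Longrightarrow> is_partition (\<mu> i)" and S: "S \<subseteq> Pow K"
  shows "sf_coeff (\<Prod>I\<in>S. Jack (\<Sum>i\<in>I. \<mu> i)) m \<noteq> 0 \<Longrightarrow> dom_by m (\<Sum>I\<in>S. \<Sum>i\<in>I. \<mu> i)"
    and "sf_coeff (\<Prod>I\<in>S. Jack (\<Sum>i\<in>I. \<mu> i)) (\<Sum>I\<in>S. \<Sum>i\<in>I. \<mu> i) = (\<Prod>I\<in>S. hook_alpha (\<Sum>i\<in>I. \<mu> i))"
    and "no_pole_at_0 (sf_coeff (\<Prod>I\<in>S. Jack (\<Sum>i\<in>I. \<mu> i)) m)"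
proof -
  have fS: "finite S" using K S by (meson finite_Pow_iff finite_subset)
  have p: "is_partition (\<Sum>i\<in>I. \<mu> i)" if "I \<in> S" for I
    using that S part by (intro partition_sum) auto
  note * = sf_coeff_prod[OF fS, of "\<lambda>I. Jack (\<Sum>i\<in>I. \<mu> i)" "\<lambda>I. \<Sum>i\<in>I. \<mu> i", OF Jack_support[OF p]]
  show "sf_coeff (\<Prod>I\<in>S. Jack (\<Sum>i\<in>I. \<mu> i)) m \<noteq> 0 \<Longrightarrow> dom_by m (\<Sum>I\<in>S. \<Sum>i\<in>I. \<mu> i)"
    by (rule *(1))
  show "sf_coeff (\<Prod>I\<in>S. Jack (\<Sum>i\<in>I. \<mu> i)) (\<Sum>I\<in>S. \<Sum>i\<in>I. \<mu> i) = (\<Prod>I\<in>S. hook_alpha (\<Sum>i\<in>I. \<mu> i))"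
    by (subst *(2)) (auto intro!: prod.cong Jack_top p)
  show "no_pole_at_0 (sf_coeff (\<Prod>I\<in>S. Jack (\<Sum>i\<in>I. \<mu> i)) m)"
    using fS p
  proof (induction S arbitrary: m rule: finite_induct)
    case empty
    then show ?case by (simp add: sf_coeff_one no_pole_0 no_pole_1)
  next
    case (insert I S)
    have "no_pole_at_0 (sf_coeff (Jack (\<Sum>i\<in>I. \<mu> i)) a * sf_coeff (\<Prod>I\<in>S. Jack (\<Sum>i\<in>I. \<mu> i)) b)" for a b
      using insert by (intro no_pole_mult Jack_coeff_no_pole) auto
    then show ?case
      using insert.hyps by (auto simp: sf_coeff_mult intro!: no_pole_sum)
  qed
qed

text \<open>With L = \<open>D1_log N\<close> the residual is A (L A - L B) + (A - B)(L B - e). The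
  first summand is small by the comparison of L A and L B; in the second, L B - e adds one power of
  \<alpha> to the order of A - B.\<close>

lemma Jack_approximate_eigenfunction:
  fixes A B :: "rat ratfun mpol"
  assumes pA: "primitive A" and pB: "primitive B" and AB: "coeffs_in (vanishing k) (A - B)"
    and D: "D1_log N A - D1_log N B \<in> gauss (Suc k)"
    and e: "D1_log N B - to_fract (pconst e) \<in> gauss 1"
    and P: "D1_op N (A - B) = to_fract P" and reg: "coeffs_in (vanishing 0) (P - pconst e * (A - B))"
  shows "coeffs_in (vanishing (Suc k)) (P - pconst e * (A - B))"
proof (rule coeffs_in_if_gauss[OF _ reg])
  have nz: "A \<noteq> 0" "B \<noteq> 0" using pA pB by (auto simp: primitive_nonzero)
  have "to_fract (P - pconst e * (A - B)) =
      D1_log N A * to_fract A - D1_log N B * to_fract B - to_fract (pconst e) * (to_fract A - to_fract B)"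
    unfolding to_fract_diff to_fract_mult P[symmetric] D1_op_diff D1_op_log[OF nz(1)] D1_op_log[OF nz(2)] ..
  also have "\<dots> = to_fract A * (D1_log N A - D1_log N B) + to_fract (A - B) * (D1_log N B - to_fract (pconst e))"
    by (simp add: algebra_simps)
  also have "\<dots> \<in> gauss (Suc k)"
  proof (rule gauss_add)
    show "to_fract A * (D1_log N A - D1_log N B) \<in> gauss (Suc k)"
      using pA by (intro gauss_mult_left gauss_to_fract primitive_coeffs D)
    show "to_fract (A - B) * (D1_log N B - to_fract (pconst e)) \<in> gauss (Suc k)"
      using gauss_mult[OF gauss_to_fract[OF AB] e] by simp
  qed
  finally show "to_fract (P - pconst e * (A - B)) \<in> gauss (Suc k)" .
qed

text \<open>The outer induction bounds the alternating sums over proper subsets. The inner one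
  raises the order of A_K - B_K by one at a time, since the squares also involve the alternating sum
  over K itself.\<close>

theorem Jack_strong_factorization:
  fixes \<mu> :: "'b \<Rightarrow> exponent"
  assumes "finite K" "\<And>i. i \<in> K \<Longrightarrow> is_partition (\<mu> i)" "\<And>i. i \<in> K \<Longrightarrow> keys (\<mu> i) \<subseteq> {..<N}"
  shows "coeffs_in (vanishing (card K - 1)) (restrict_vars N (Jack_even \<mu> K - Jack_odd \<mu> K))"
  using assms
proof (induction K rule: finite_psubset_induct)
  case (psubset K)
  define F where "F I = restrict_vars N (Jack (\<Sum>i\<in>I. \<mu> i))" for I
  let ?A = "\<lambda>G. restrict_vars N (Jack_even \<mu> G)" and ?B = "\<lambda>G. restrict_vars N (Jack_odd \<mu> G)"
  have A: "?A G = (\<Prod>I\<in>even_sets G. F I)" and B: "?B G = (\<Prod>I\<in>odd_sets G. F I)" for G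
    by (simp_all add: Jack_even_def Jack_odd_def F_def restrict_vars_prod)
  have part: "is_partition (\<Sum>i\<in>I. \<mu> i)" if "I \<subseteq> K" for I
    using that psubset.prems by (intro partition_sum) auto
  have keysI: "keys (\<Sum>i\<in>I. \<mu> i) \<subseteq> {..<N}" if "I \<subseteq> K" for I
    using that psubset.prems by (intro keys_sum_subset) blast
  have prF: "primitive (F I)" if "I \<subseteq> K" for I
    unfolding F_def using that by (intro Jack_primitive part keysI)
  then have nzF: "F I \<noteq> 0" if "I \<subseteq> K" for I using that by (simp add: primitive_nonzero)
  have prAB: "primitive (?A G)" "primitive (?B G)" if "G \<subseteq> K" for G
    unfolding A B using that by (intro primitive_prod prF; auto)+
  have reg: "no_pole_at_0 (sf_coeff (Jack_even \<mu> K) m)" "no_pole_at_0 (sf_coeff (Jack_odd \<mu> K) m)" for m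
    unfolding Jack_even_def Jack_odd_def
    by (rule Jack_parts_support(3)[OF psubset.hyps psubset.prems(1)]; auto)+
  have alt_dlog: "alt_sum G (\<lambda>I. dlog i (F I)) = dlog i (?A G) - dlog i (?B G)"
    and alt_d2log: "alt_sum G (\<lambda>I. d2log i (F I)) = d2log i (?A G) - d2log i (?B G)"
    and alt_D1_log: "alt_sum G (\<lambda>I. D1_log N (F I)) = D1_log N (?A G) - D1_log N (?B G)"
    if "G \<subseteq> K" for G i
  proof -
    have fG: "finite G" using that psubset.hyps finite_subset by blast
    have p: "dlog i (prod F S) = (\<Sum>I\<in>S. dlog i (F I))" "d2log i (prod F S) = (\<Sum>I\<in>S. d2log i (F I))"
      "D1_log N (prod F S) = (\<Sum>I\<in>S. D1_log N (F I))" if "S \<subseteq> Pow G" for S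
      using that \<open>G \<subseteq> K\<close> nzF by (intro dlog_prod d2log_prod D1_log_prod; blast)+
    have "even_sets G \<subseteq> Pow G" "odd_sets G \<subseteq> Pow G" by auto
    note pe = p[OF this(1)] and po = p[OF this(2)]
    show "alt_sum G (\<lambda>I. dlog i (F I)) = dlog i (?A G) - dlog i (?B G)"
      unfolding alt_sum_even_odd[OF fG] A B pe po ..
    show "alt_sum G (\<lambda>I. d2log i (F I)) = d2log i (?A G) - d2log i (?B G)"
      unfolding alt_sum_even_odd[OF fG] A B pe po ..
    show "alt_sum G (\<lambda>I. D1_log N (F I)) = D1_log N (?A G) - D1_log N (?B G)"
      unfolding alt_sum_even_odd[OF fG] A B pe po ..
  qed
  have F_empty: "dlog i (F {}) = 0" for i
    by (simp add: F_def Jack_zero restrict_vars_one dlog_one)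
  have sub: "alt_sum G (\<lambda>I. dlog i (F I)) \<in> gauss (card G - 1)" if "G \<subset> K" for G i
  proof -
    have "coeffs_in (vanishing (card G - 1)) (restrict_vars N (Jack_even \<mu> G - Jack_odd \<mu> G))"
      using that psubset.prems by (intro psubset.IH) auto
    then show ?thesis
      using that alt_dlog[of G i] prAB[of G] by (auto simp: restrict_vars_diff intro!: dlog_gauss_diff)
  qed
  \<comment> \<open>The leading partition of the odd product; for |K| \<ge> 2 it is that of the even
    product too.\<close>
  define \<Lambda> where "\<Lambda> = (\<Sum>I\<in>odd_sets K. \<Sum>i\<in>I. \<mu> i)"
  have part\<Lambda>: "is_partition \<Lambda>" unfolding \<Lambda>_def using part by (rule partition_sum) auto
  have eB: "D1_log N (?B K) - to_fract (pconst (eig 0 N \<Lambda>)) \<in> gauss 1"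
  proof -
    have "eig 0 N \<Lambda> = (\<Sum>I\<in>odd_sets K. eig 0 N (\<Sum>i\<in>I. \<mu> i))"
      unfolding \<Lambda>_def using part by (rule eig_zero_sum) auto
    moreover have "D1_log N (?B K) = (\<Sum>I\<in>odd_sets K. D1_log N (F I))"
      unfolding B using nzF by (intro D1_log_prod) auto
    ultimately have "D1_log N (?B K) - to_fract (pconst (eig 0 N \<Lambda>)) =
        (\<Sum>I\<in>odd_sets K. D1_log N (F I) - to_fract (pconst (eig 0 N (\<Sum>i\<in>I. \<mu> i))))"
      by (simp add: pconst_sum sum_subtractf)
    also have "\<dots> \<in> gauss 1"
      unfolding F_def using part keysI by (intro gauss_sum Jack_D1_log) auto
    finally show ?thesis .
  qed
  let ?H = "Jack_even \<mu> K - Jack_odd \<mu> K"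
  \<comment> \<open>For |K| \<le> 1 the truncated bound is 0 and only the base case is called
    for.\<close>
  have "k \<le> card K - 1 \<Longrightarrow> coeffs_in (vanishing k) (restrict_vars N ?H)" for k
  proof (induction k)
    case 0
    show ?case
      using prAB[of K] unfolding restrict_vars_diff by (auto intro: coeffs_in_diff primitive_coeffs)
  next
    case (Suc k)
    then have k: "k + 2 \<le> card K" and AB: "coeffs_in (vanishing k) (?A K - ?B K)"
      by (auto simp: restrict_vars_diff)
    let ?a = "to_fract (pconst (alpha :: rat ratfun))"
    \<comment> \<open>The alternating sum of the logarithmic eigenvalue equations; it expresses L
      A_K - L B_K, with L = \<open>D1_log N\<close>, through the eigenvalues and \<alpha> times the
      D_2 parts.\<close>
    have "alt_sum K (\<lambda>I. D1_log N (F I) + ?a * D2_log N (F I)) =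
        alt_sum K (\<lambda>I. to_fract (pconst (eig alpha N (\<Sum>i\<in>I. \<mu> i))))"
      unfolding F_def by (intro alt_sum_cong Jack_log_equation part keysI)
    then have "D1_log N (?A K) - D1_log N (?B K) = to_fract (pconst (alt_sum K (\<lambda>I. eig alpha N (\<Sum>i\<in>I. \<mu> i)))) -
        ?a * alt_sum K (\<lambda>I. D2_log N (F I))"
      unfolding alt_sum_add alt_sum_mult_left alt_D1_log[OF order_refl] alt_sum_pconst[OF psubset.hyps]
      by (simp only: eq_diff_eq)
    moreover have "to_fract (pconst (alt_sum K (\<lambda>I. eig alpha N (\<Sum>i\<in>I. \<mu> i)))) \<in> gauss (Suc k)"
      using psubset k by (intro gauss_pconst alt_sum_eig) auto
    moreover have "alt_sum K (\<lambda>I. D2_log N (F I)) \<in> gauss k"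
      unfolding D2_log_def alt_sum_mult_left alt_sum_sum alt_sum_add alt_d2log[OF order_refl]
    proof (intro gauss_mult_left half_gauss gauss_sum pvar2_gauss gauss_add)
      show "d2log i (?A K) - d2log i (?B K) \<in> gauss k" for i
        using prAB[of K] AB by (intro d2log_gauss_diff) auto
      show "alt_sum K (\<lambda>I. (dlog i (F I))\<^sup>2) \<in> gauss k" for i
      proof (rule alt_sum_square_gauss[OF psubset.hyps F_empty _ sub k])
        show "alt_sum K (\<lambda>I. dlog i (F I)) \<in> gauss k"
          unfolding alt_dlog[OF order_refl] using prAB[of K] AB by (intro dlog_gauss_diff) auto
      qed
    qed
    \<comment> \<open>The explicit factor \<alpha> of D_2 turns order k into order k + 1.\<close>
    then have "?a * alt_sum K (\<lambda>I. D2_log N (F I)) \<in> gauss (1 + k)"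
      by (intro gauss_mult gauss_pconst alpha_in_vanishing)
    ultimately have D: "D1_log N (?A K) - D1_log N (?B K) \<in> gauss (Suc k)"
      by (simp only: gauss_diff plus_1_eq_Suc)
    obtain P where P: "D1_op N (restrict_vars N ?H) = to_fract P"
      "\<And>m. lookup P m = (if keys m \<subseteq> {..<N} then lap 0 N (sf_coeff ?H) m else 0)"
      using D1_op_symf[of N ?H] by blast
    have regH: "no_pole_at_0 (sf_coeff ?H m)" for m using reg by (simp add: no_pole_diff)
    have resid: "lookup (P - pconst e * restrict_vars N ?H) m =
        (if keys m \<subseteq> {..<N} then lap 0 N (sf_coeff ?H) m - e * sf_coeff ?H m else 0)" for m e
      by (simp add: lookup_minus P(2) lookup_pconst_times lookup_restrict_vars del: sf_coeff_diff)
    have "coeffs_in (vanishing 0) (P - pconst (eig 0 N \<Lambda>) * restrict_vars N ?H)"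
      unfolding coeffs_in_def resid vanishing_0_iff
      using regH by (auto intro!: no_pole_diff no_pole_mult lap_no_pole no_pole_eig no_pole_0 simp del: sf_coeff_diff)
    then have res: "coeffs_in (vanishing (Suc k)) (P - pconst (eig 0 N \<Lambda>) * restrict_vars N ?H)"
      using Jack_approximate_eigenfunction[OF prAB(1)[OF order_refl] prAB(2)[OF order_refl] AB D eB] P(1)
      unfolding restrict_vars_diff by blast
    have \<Lambda>: "(\<Sum>I\<in>even_sets K. \<Sum>i\<in>I. \<mu> i) = \<Lambda>"
      unfolding \<Lambda>_def using k by (intro sum_even_odd_sets psubset.hyps) simp
    have "even_sets K \<subseteq> Pow K" "odd_sets K \<subseteq> Pow K" by auto
    note even = Jack_parts_support[where \<mu> = \<mu> and S = "even_sets K", OF psubset.hyps psubset.prems(1) this(1),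
        unfolded \<Lambda>, folded Jack_even_def]
      and odd = Jack_parts_support[where \<mu> = \<mu> and S = "odd_sets K", OF psubset.hyps psubset.prems(1) this(2),
        folded \<Lambda>_def Jack_odd_def]
    have top: "sf_coeff ?H \<Lambda> \<in> vanishing (Suc k)"
    proof -
      let ?h = "\<lambda>S. \<Prod>I\<in>S. hook_alpha (\<Sum>i\<in>I. \<mu> i)"
      have "sf_coeff (Jack_even \<mu> K) \<Lambda> = ?h (even_sets K)" "sf_coeff (Jack_odd \<mu> K) \<Lambda> = ?h (odd_sets K)"
        by (rule even(2) odd(2); assumption)+
      \<comment> \<open>Clearing the denominator of the alternating hook product multiplies its
        error term by a regular factor, so the order |K| - 1 is kept.\<close>
      moreover have "?h (odd_sets K) \<noteq> 0"
        using hook_alpha_res0 psubset.hyps by (auto simp: prod_zero_iff) (metis res0_0)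
      then have "?h (even_sets K) - ?h (odd_sets K) =
          ?h (odd_sets K) * (alt_prod K (\<lambda>I. hook_alpha (\<Sum>i\<in>I. \<mu> i)) - 1)"
        by (simp add: alt_prod_even_odd[OF psubset.hyps] algebra_simps)
      moreover have "?h (odd_sets K) * (alt_prod K (\<lambda>I. hook_alpha (\<Sum>i\<in>I. \<mu> i)) - 1) \<in> vanishing (card K - 1)"
        using psubset k
        by (intro vanishing_mult_left no_pole_prod hook_alpha_no_pole hook_factorization) auto
      ultimately have "sf_coeff ?H \<Lambda> \<in> vanishing (card K - 1)" by simp
      moreover have "Suc k \<le> card K - 1" using k by simp
      ultimately show ?thesis using vanishing_antimono by blast
    qed
    have "sf_coeff ?H m \<in> vanishing (Suc k)" if "keys m \<subseteq> {..<N}" for m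
    \<comment> \<open>Triangularity of D_1, hence parameter 0, with M the elements of order k +
      1.\<close>
    proof (rule triangular_solution_in[of \<Lambda> 0 "sf_coeff ?H" _ N m])
      show "dom_by m \<Lambda>" if "sf_coeff ?H m \<noteq> 0" for m using that even(1)[of m] odd(1)[of m] by (cases "sf_coeff (Jack_odd \<mu> K) m = 0") auto
      show "sf_coeff ?H m \<in> vanishing (Suc k)" if "perm_of m \<Lambda>" for m
        using symf_coeff_perm[OF that, of ?H] top by (simp only:)
      show "lap 0 N (sf_coeff ?H) m - eig 0 N \<Lambda> * sf_coeff ?H m \<in> vanishing (Suc k)" if "keys m \<subseteq> {..<N}" for m
        using res that unfolding coeffs_in_def resid by metis
    qed (use that part\<Lambda> in \<open>auto intro: vanishing_add vanishing_mult_left\<close>)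
    then show ?case by (simp add: coeffs_in_def lookup_restrict_vars del: sf_coeff_diff)
  qed
  then show ?case by blast
qed

section \<open>Symmetric functions as rational functions of \<open>\<alpha>\<close>\<close>

definition degree_le :: "nat \<Rightarrow> 'a::zero symf \<Rightarrow> bool" where
  "degree_le d f \<longleftrightarrow> (\<forall>m. sf_coeff f m \<noteq> 0 \<longrightarrow> part_size m \<le> d)"

lemma degree_le_exists: "\<exists>d. degree_le d f"
  using sf_coeff[of f] by (auto simp: bounded_degree_def degree_le_def)

lemma symf_msym_expansion:
  fixes f :: "'a::comm_ring_1 symf"
  assumes "degree_le d f"
  shows "f = (\<Sum>\<nu>\<in>partitions_upto d. sf_const (sf_coeff f \<nu>) * msym \<nu>)"
proof (rule symf_eqI)
  fix m
  obtain \<nu> where \<nu>: "is_partition \<nu>" "perm_of m \<nu>" using exists_sorted perm_of_sym by metis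
  have "sf_coeff f m = sf_coeff f \<nu>" by (rule symf_coeff_perm[OF \<nu>(2)])
  also have "\<dots> = (if \<nu> \<in> partitions_upto d then sf_coeff f \<nu> else 0)"
    using assms \<nu>(1) by (auto simp: partitions_upto_def degree_le_def)
  also have "\<dots> = sf_coeff (\<Sum>\<nu>\<in>partitions_upto d. sf_const (sf_coeff f \<nu>) * msym \<nu>) m"
    by (rule sf_coeff_msym_combination[symmetric])
      (use \<nu> finite_partitions_upto in \<open>auto simp: partitions_upto_def\<close>)
  finally show "sf_coeff f m = sf_coeff (\<Sum>\<nu>\<in>partitions_upto d. sf_const (sf_coeff f \<nu>) * msym \<nu>) m" .
qed

section \<open>The embedding of Q(\<alpha>) into rational functions over symmetric functions\<close>

definition const_embed :: "rat \<Rightarrow> symfield" where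
  "const_embed c = to_fract (sf_const c)"

lemma sf_const_add: "sf_const (a + b :: 'a::comm_ring_1) = sf_const a + sf_const b"
  by (rule symf_eqI) (simp add: sf_const.rep_eq)

lemma sf_const_mult: "sf_const (a * b :: 'a::comm_ring_1) = sf_const a * sf_const b"
  by (rule symf_eqI) (simp add: sf_coeff_const_mult, simp add: sf_const.rep_eq)

lemma sf_const_0: "sf_const (0 :: 'a::comm_ring_1) = 0"
  by (rule symf_eqI) (simp add: sf_const.rep_eq)

lemma sf_const_1: "sf_const (1 :: 'a::comm_ring_1) = 1"
  by (rule symf_eqI) (simp add: sf_const.rep_eq sf_coeff_one)

lemma const_embed_add: "const_embed (a + b) = const_embed a + const_embed b"
  and const_embed_mult: "const_embed (a * b) = const_embed a * const_embed b"
  and const_embed_0: "const_embed 0 = 0"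
  and const_embed_1: "const_embed 1 = 1"
  by (simp_all add: const_embed_def sf_const_add sf_const_mult sf_const_0 sf_const_1)

lemma const_embed_eq_0_iff: "const_embed a = 0 \<longleftrightarrow> a = 0"
proof
  assume "const_embed a = 0"
  then have "sf_coeff (sf_const a) 0 = 0" by (simp add: const_embed_def)
  then show "a = 0" by (simp add: sf_const.rep_eq)
qed (simp add: const_embed_0)

lemma const_embed_sum: "const_embed (sum f A) = (\<Sum>x\<in>A. const_embed (f x))"
  by (induction A rule: infinite_finite_induct) (auto simp: const_embed_0 const_embed_add)

lemma const_embed_divide: "b \<noteq> 0 \<Longrightarrow> const_embed (a / b) = const_embed a / const_embed b"
  using const_embed_mult[of "a / b" b] by (simp add: const_embed_eq_0_iff eq_divide_eq)

definition poly_embed :: "rat poly \<Rightarrow> symfield poly" where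
  "poly_embed = map_poly const_embed"

lemma coeff_poly_embed: "coeff (poly_embed p) n = const_embed (coeff p n)"
  by (simp add: poly_embed_def coeff_map_poly const_embed_0)

lemma poly_embed_add: "poly_embed (p + q) = poly_embed p + poly_embed q"
  by (rule poly_eqI) (simp add: coeff_poly_embed const_embed_add)

lemma poly_embed_mult: "poly_embed (p * q) = poly_embed p * poly_embed q"
  by (rule poly_eqI) (simp add: coeff_poly_embed coeff_mult const_embed_sum const_embed_mult)

lemma poly_embed_eq_0_iff: "poly_embed p = 0 \<longleftrightarrow> p = 0"
  by (simp add: poly_eq_iff coeff_poly_embed const_embed_eq_0_iff)

lemma poly_embed_pCons: "poly_embed (pCons a p) = pCons (const_embed a) (poly_embed p)"
  by (rule poly_eqI) (simp add: coeff_poly_embed coeff_pCons split: nat.split)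

lemma poly_embed_0: "poly_embed 0 = 0"
  by (simp add: poly_embed_def)

lemma poly_embed_at_0: "poly (poly_embed p) 0 = const_embed (poly p 0)"
  by (simp add: poly_0_coeff_0 coeff_poly_embed)

text \<open>Frees \<open>ratfun_embed\<close> from the normalized fraction in its definition:
  \<open>poly_embed\<close> is an injective ring homomorphism, so the cross-multiplied equation
  between two representations carries over.\<close>

lemma ratfun_embed_Fract:
  assumes "q \<noteq> 0"
  shows "ratfun_embed (Fraction_Field.Fract p q) = Fraction_Field.Fract (poly_embed p) (poly_embed q)"
proof -
  let ?x = "Fraction_Field.Fract p q"
  obtain p' q' where pq: "quot_of_fract ?x = (p', q')" by (cases "quot_of_fract ?x")
  have x: "Fraction_Field.Fract p' q' = ?x"
    using quot_to_fract_quot_of_fract[of ?x] by (simp add: pq quot_to_fract_def)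
  have "q' \<noteq> 0" using snd_quot_of_fract_nonzero[of ?x] by (simp add: pq)
  then have "p' * q = p * q'" using x assms by (simp add: eq_fract)
  then have "poly_embed p' * poly_embed q = poly_embed p * poly_embed q'"
    by (simp flip: poly_embed_mult)
  moreover have "ratfun_embed ?x = Fraction_Field.Fract (poly_embed p') (poly_embed q')"
    by (simp add: ratfun_embed_def pq poly_embed_def const_embed_def[abs_def])
  ultimately show ?thesis
    using assms \<open>q' \<noteq> 0\<close> by (simp add: eq_fract poly_embed_eq_0_iff)
qed

lemma ratfun_embed_add: "ratfun_embed (x + y) = ratfun_embed x + ratfun_embed y"
  by (cases x rule: Fract_cases, cases y rule: Fract_cases)
    (simp add: ratfun_embed_Fract poly_embed_add poly_embed_mult poly_embed_eq_0_iff)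

lemma ratfun_embed_mult: "ratfun_embed (x * y) = ratfun_embed x * ratfun_embed y"
  by (cases x rule: Fract_cases, cases y rule: Fract_cases)
    (simp add: ratfun_embed_Fract poly_embed_mult)

lemma ratfun_embed_const: "ratfun_embed (to_fract [:c:]) = to_fract [:const_embed c:]"
  by (simp add: to_fract_def ratfun_embed_Fract one_pCons poly_embed_pCons poly_embed_0 const_embed_1)

lemma ratfun_embed_0: "ratfun_embed 0 = 0" and ratfun_embed_1: "ratfun_embed 1 = 1"
  using ratfun_embed_const[of 0] ratfun_embed_const[of 1]
  by (simp_all add: const_embed_0 const_embed_1 one_pCons[symmetric])

lemma ratfun_embed_alpha: "ratfun_embed alpha = alpha"
  by (simp add: alpha_def to_fract_def ratfun_embed_Fract one_pCons poly_embed_pCons poly_embed_0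
      const_embed_0 const_embed_1)

lemma ratfun_embed_power: "ratfun_embed (x ^ n) = ratfun_embed x ^ n"
  by (induction n) (auto simp: ratfun_embed_1 ratfun_embed_mult)

lemma ratfun_embed_regular:
  assumes "no_pole_at_0 x"
  shows "no_pole_at_0 (ratfun_embed x)" "res0 (ratfun_embed x) = const_embed (res0 x)"
proof -
  obtain p q where pq: "poly q 0 \<noteq> 0" "q \<noteq> 0" "x = Fraction_Field.Fract p q"
    using assms by (rule no_poleE)
  have q0: "poly (poly_embed q) 0 \<noteq> 0" using pq by (simp add: poly_embed_at_0 const_embed_eq_0_iff)
  show "no_pole_at_0 (ratfun_embed x)"
    using pq q0 by (simp add: ratfun_embed_Fract no_pole_Fract)
  show "res0 (ratfun_embed x) = const_embed (res0 x)"
    using pq q0 by (simp add: ratfun_embed_Fract res0_Fract poly_embed_at_0 const_embed_divide)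
qed

lemma ratfun_embed_vanishing: "x \<in> vanishing k \<Longrightarrow> ratfun_embed x \<in> vanishing k"
  by (auto simp: vanishing_def ratfun_embed_mult ratfun_embed_power ratfun_embed_alpha
      intro: ratfun_embed_regular)

section \<open>\<open>as_ratfun\<close> as a ring homomorphism compatible with orders at \<alpha> =
  0\<close>

definition msym_ratfun :: "exponent \<Rightarrow> symfield ratfun" where
  "msym_ratfun \<nu> = to_fract [:to_fract (msym \<nu>):]"

lemma as_ratfun_expansion:
  assumes "degree_le d F"
  shows "as_ratfun F = (\<Sum>\<nu>\<in>partitions_upto d. ratfun_embed (sf_coeff F \<nu>) * msym_ratfun \<nu>)"
  unfolding as_ratfun_def msym_ratfun_def
  by (rule sum.mono_neutral_left[OF finite_partitions_upto])
    (use assms in \<open>auto simp: partitions_upto_def degree_le_def ratfun_embed_0\<close>)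

lemma as_ratfun_add: "as_ratfun (F + G) = as_ratfun F + as_ratfun G"
proof -
  obtain d e where "degree_le d F" "degree_le e G" using degree_le_exists by metis
  then have F: "degree_le (d + e) F" and G: "degree_le (d + e) G"
    by (fastforce simp: degree_le_def)+
  then have FG: "degree_le (d + e) (F + G)"
    unfolding degree_le_def by (metis add.right_neutral sf_coeff_add)
  show ?thesis
    unfolding as_ratfun_expansion[OF F] as_ratfun_expansion[OF G] as_ratfun_expansion[OF FG]
    by (simp add: ratfun_embed_add distrib_right sum.distrib)
qed

lemma as_ratfun_scale: "as_ratfun (sf_const c * F) = ratfun_embed c * as_ratfun F"
proof -
  obtain d where F: "degree_le d F" using degree_le_exists by blast
  then have cF: "degree_le d (sf_const c * F)"
    by (auto simp: degree_le_def sf_coeff_const_mult)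
  show ?thesis
    unfolding as_ratfun_expansion[OF F] as_ratfun_expansion[OF cF]
    by (simp add: sf_coeff_const_mult ratfun_embed_mult sum_distrib_left mult.assoc)
qed

lemma as_ratfun_zero: "as_ratfun 0 = 0"
  by (simp add: as_ratfun_def)

lemma as_ratfun_sum: "as_ratfun (sum f A) = (\<Sum>x\<in>A. as_ratfun (f x))"
  by (induction A rule: infinite_finite_induct) (auto simp: as_ratfun_zero as_ratfun_add)

text \<open>Extension of scalars from Q to Q(\<alpha>). Products of monomial symmetric functions lie
  in its image, and on the image \<open>as_ratfun\<close> yields constants in \<alpha>; this makes
  products of monomial functions computable over Q.\<close>

lift_definition symf_embed :: "rat symf \<Rightarrow> rat ratfun symf" is "\<lambda>f m. to_fract [:f m:]"
  by (auto simp: bounded_degree_def symmetric_series_def)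

lemma sf_coeff_symf_embed: "sf_coeff (symf_embed f) m = to_fract [:sf_coeff f m:]"
  by (simp add: symf_embed.rep_eq)

lemma const_ratfun_sum: "to_fract [:sum f A:] = (\<Sum>x\<in>A. to_fract [:f x :: 'a::field:])"
proof (induction A rule: infinite_finite_induct)
  case (insert x A)
  have "[:f x + sum f A:] = [:f x:] + [:sum f A:]" by simp
  then have "to_fract [:f x + sum f A:] = to_fract [:f x:] + to_fract [:sum f A:]" by (simp only: to_fract_add)
  then show ?case using insert by simp
qed simp_all

lemma const_ratfun_mult: "to_fract [:a * b :: 'a::field:] = to_fract [:a:] * to_fract [:b:]"
proof -
  have "[:a * b:] = [:a:] * [:b:]" by simp
  then show ?thesis by (simp only: to_fract_mult)
qed

lemma symf_embed_mult: "symf_embed (f * g) = symf_embed f * symf_embed g"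
  by (rule symf_eqI)
    (simp only: sf_coeff_symf_embed sf_coeff_mult const_ratfun_sum const_ratfun_mult case_prod_unfold)

lemma symf_embed_msym: "symf_embed (msym \<nu>) = msym \<nu>"
  by (rule symf_eqI) (simp add: sf_coeff_symf_embed sf_coeff_msym flip: one_pCons)

lemma as_ratfun_symf_embed: "as_ratfun (symf_embed f) = to_fract [:to_fract f:]"
proof -
  obtain d where f: "degree_le d f" using degree_le_exists by blast
  then have ef: "degree_le d (symf_embed f)"
    by (auto simp: degree_le_def sf_coeff_symf_embed)
  have "as_ratfun (symf_embed f) = (\<Sum>\<nu>\<in>partitions_upto d. to_fract [:const_embed (sf_coeff f \<nu>):] * to_fract [:to_fract (msym \<nu>):])"
    unfolding as_ratfun_expansion[OF ef] by (simp only: sf_coeff_symf_embed ratfun_embed_const msym_ratfun_def)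
  also have "\<dots> = to_fract [:to_fract (\<Sum>\<nu>\<in>partitions_upto d. sf_const (sf_coeff f \<nu>) * msym \<nu>):]"
    by (simp only: const_embed_def const_ratfun_sum const_ratfun_mult to_fract_sum to_fract_mult)
  finally show ?thesis using symf_msym_expansion[OF f] by simp
qed

lemma as_ratfun_msym_mult: "as_ratfun (msym \<nu> * msym \<rho>) = msym_ratfun \<nu> * msym_ratfun \<rho>"
proof -
  have "msym \<nu> * msym \<rho> = symf_embed (msym \<nu> * msym \<rho>)" by (simp only: symf_embed_mult symf_embed_msym)
  then show ?thesis by (simp only: as_ratfun_symf_embed msym_ratfun_def const_ratfun_mult to_fract_mult)
qed

text \<open>Both sides are bilinear over Q(\<alpha>), so monomial symmetric functions
  suffice.\<close>

lemma as_ratfun_mult: "as_ratfun (F * G) = as_ratfun F * as_ratfun G"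
proof -
  obtain d e where F: "degree_le d F" and G: "degree_le e G" using degree_le_exists by metis
  have "F * G = (\<Sum>\<nu>\<in>partitions_upto d. sf_const (sf_coeff F \<nu>) * msym \<nu>) *
      (\<Sum>\<rho>\<in>partitions_upto e. sf_const (sf_coeff G \<rho>) * msym \<rho>)"
    using symf_msym_expansion[OF F] symf_msym_expansion[OF G] by (rule arg_cong2)
  also have "\<dots> = (\<Sum>\<nu>\<in>partitions_upto d. \<Sum>\<rho>\<in>partitions_upto e.
      sf_const (sf_coeff F \<nu> * sf_coeff G \<rho>) * (msym \<nu> * msym \<rho>))"
    by (simp only: sum_product sf_const_mult mult_ac)
  finally have "as_ratfun (F * G) = (\<Sum>\<nu>\<in>partitions_upto d. \<Sum>\<rho>\<in>partitions_upto e.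
      ratfun_embed (sf_coeff F \<nu> * sf_coeff G \<rho>) * (msym_ratfun \<nu> * msym_ratfun \<rho>))"
    by (simp only: as_ratfun_sum as_ratfun_scale as_ratfun_msym_mult)
  also have "\<dots> = as_ratfun F * as_ratfun G"
    unfolding as_ratfun_expansion[OF F] as_ratfun_expansion[OF G]
    by (simp only: sum_product ratfun_embed_mult mult_ac)
  finally show ?thesis .
qed

lemma as_ratfun_one: "as_ratfun 1 = 1"
proof -
  have "symf_embed 1 = 1" by (rule symf_eqI) (simp add: sf_coeff_symf_embed sf_coeff_one flip: one_pCons)
  then show ?thesis using as_ratfun_symf_embed[of 1] by (simp flip: one_pCons)
qed

lemma as_ratfun_prod: "as_ratfun (prod f A) = (\<Prod>x\<in>A. as_ratfun (f x))"
  by (induction A rule: infinite_finite_induct) (auto simp: as_ratfun_one as_ratfun_mult)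

lemma as_ratfun_diff: "as_ratfun (F - G) = as_ratfun F - as_ratfun G"
  using as_ratfun_add[of "F - G" G] by simp

lemma msym_ratfun_regular: "no_pole_at_0 (msym_ratfun \<nu>)" "res0 (msym_ratfun \<nu>) = to_fract (msym \<nu>)"
  by (simp_all add: msym_ratfun_def no_pole_to_fract res0_to_fract)

lemma as_ratfun_vanishing:
  assumes "\<And>m. sf_coeff F m \<in> vanishing k"
  shows "as_ratfun F \<in> vanishing k"
  unfolding as_ratfun_def
  by (intro vanishing_sum, subst mult.commute)
    (intro vanishing_mult_left no_pole_to_fract ratfun_embed_vanishing assms)

text \<open>The value at \<alpha> = 0 is the symmetric function over Q whose coefficients are the
  residues of those of F, and its coefficient at \<Lambda> is nonzero. This makes the odd product an
  invertible denominator.\<close>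

lemma as_ratfun_unit:
  assumes reg: "\<And>m. no_pole_at_0 (sf_coeff F m)" and \<Lambda>: "is_partition \<Lambda>" "res0 (sf_coeff F \<Lambda>) \<noteq> 0"
  shows "no_pole_at_0 (as_ratfun F)" "res0 (as_ratfun F) \<noteq> 0"
proof -
  show "no_pole_at_0 (as_ratfun F)"
    using as_ratfun_vanishing[of F 0] reg by (simp add: vanishing_0_iff)
  obtain d where F: "degree_le d F" using degree_le_exists by blast
  let ?r = "\<lambda>\<nu>. res0 (sf_coeff F \<nu>)"
  have "res0 (as_ratfun F) = (\<Sum>\<nu>\<in>partitions_upto d. const_embed (?r \<nu>) * to_fract (msym \<nu>))"
    unfolding as_ratfun_expansion[OF F]
    by (simp add: res0_sum res0_mult no_pole_mult ratfun_embed_regular reg msym_ratfun_regular)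
  also have "\<dots> = to_fract (\<Sum>\<nu>\<in>partitions_upto d. sf_const (?r \<nu>) * msym \<nu>)"
    by (simp add: const_embed_def)
  finally have res: "res0 (as_ratfun F) = \<dots>" .
  have "sf_coeff F \<Lambda> \<noteq> 0" using \<Lambda>(2) by force
  then have "\<Lambda> \<in> partitions_upto d" using F \<Lambda>(1) by (simp add: partitions_upto_def degree_le_def)
  then have "sf_coeff (\<Sum>\<nu>\<in>partitions_upto d. sf_const (?r \<nu>) * msym \<nu>) \<Lambda> = ?r \<Lambda>"
    using sf_coeff_msym_combination[OF finite_partitions_upto _ \<Lambda>(1) perm_of_refl, of d ?r]
    by (simp add: partitions_upto_def)
  then have "(\<Sum>\<nu>\<in>partitions_upto d. sf_const (?r \<nu>) * msym \<nu>) \<noteq> 0" using \<Lambda>(2) by force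
  then show "res0 (as_ratfun F) \<noteq> 0" by (simp only: res to_fract_eq_0_iff not_False_eq_True)
qed

theorem theorem1p3:
  fixes r :: nat and \<mu> :: "nat \<Rightarrow> (nat \<Rightarrow>\<^sub>0 nat)"
  assumes "r \<ge> 1" and "\<And>i. i \<in> {1..r} \<Longrightarrow> is_partition (\<mu> i)"
  shows "(\<Prod>I\<in>Pow {1..r}. as_ratfun (Jack (\<Sum>i\<in>I. \<mu> i)) powi ((-1) ^ card I)) - 1
           \<in> O_alpha (int r - 1)"
proof -
  define K where "K = {1..r}"
  have K: "finite K" "card K = r" by (simp_all add: K_def)
  have part: "is_partition (\<mu> i)" if "i \<in> K" for i using that assms(2) by (simp add: K_def)
  let ?E = "as_ratfun (Jack_even \<mu> K)" and ?O = "as_ratfun (Jack_odd \<mu> K)"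
  have prod: "(\<Prod>I\<in>Pow K. as_ratfun (Jack (\<Sum>i\<in>I. \<mu> i)) powi ((-1) ^ card I)) = ?E / ?O"
    unfolding Jack_even_def Jack_odd_def as_ratfun_prod
    by (rule alt_prod_even_odd[OF K(1), unfolded alt_prod_def])
  have diff: "sf_coeff (Jack_even \<mu> K - Jack_odd \<mu> K) m \<in> vanishing (r - 1)" for m
  proof -
    \<comment> \<open>Enough variables for m and for all the given partitions at once.\<close>
    obtain N where "keys (m + (\<Sum>i\<in>K. \<mu> i)) \<subseteq> {..<N}" using keys_below_bound by blast
    then have N: "keys m \<subseteq> {..<N}" "keys (\<Sum>i\<in>K. \<mu> i) \<subseteq> {..<N}" by (simp_all add: keys_add_exponent)
    have "keys (\<mu> i) \<subseteq> {..<N}" if "i \<in> K" for i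
    proof -
      have "(\<Sum>i\<in>K. \<mu> i) = \<mu> i + (\<Sum>i\<in>K - {i}. \<mu> i)" using K(1) that by (rule sum.remove)
      then show ?thesis using N(2) by (simp add: keys_add_exponent)
    qed
    then have "coeffs_in (vanishing (r - 1)) (restrict_vars N (Jack_even \<mu> K - Jack_odd \<mu> K))"
      using Jack_strong_factorization[where \<mu> = \<mu> and N = N, OF K(1) part] K(2) by simp
    then show ?thesis using N(1) unfolding coeffs_in_def lookup_restrict_vars by metis
  qed
  have num: "?E - ?O \<in> vanishing (r - 1)"
    unfolding as_ratfun_diff[symmetric] by (rule as_ratfun_vanishing[OF diff])
  let ?\<Lambda> = "\<Sum>I\<in>odd_sets K. \<Sum>i\<in>I. \<mu> i"
  have "odd_sets K \<subseteq> Pow K" by auto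
  note odd = Jack_parts_support[where \<mu> = \<mu> and S = "odd_sets K", OF K(1) part this, folded Jack_odd_def]
  have "is_partition (\<Sum>i\<in>I. \<mu> i)" if "I \<subseteq> K" for I using that part by (intro partition_sum) auto
  then have "is_partition ?\<Lambda>" by (intro partition_sum[of "odd_sets K"]) auto
  moreover have "res0 (sf_coeff (Jack_odd \<mu> K) ?\<Lambda>) \<noteq> 0"
  proof -
    have "sf_coeff (Jack_odd \<mu> K) ?\<Lambda> = (\<Prod>I\<in>odd_sets K. hook_alpha (\<Sum>i\<in>I. \<mu> i))"
      by (rule odd(2))
    moreover have "res0 (\<Prod>I\<in>odd_sets K. hook_alpha (\<Sum>i\<in>I. \<mu> i)) =
        (\<Prod>I\<in>odd_sets K. res0 (hook_alpha (\<Sum>i\<in>I. \<mu> i)))"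
      by (intro res0_prod hook_alpha_no_pole)
    ultimately show ?thesis using K(1) by (simp add: hook_alpha_res0)
  qed
  ultimately have O: "no_pole_at_0 ?O" "res0 ?O \<noteq> 0"
    using as_ratfun_unit[of "Jack_odd \<mu> K" ?\<Lambda>, OF odd(3)] by blast+
  then have "?O \<noteq> 0" by force
  \<comment> \<open>The denominator is a unit of the local ring, so the quotient inherits the order
    of the difference.\<close>
  then have "?E / ?O - 1 = inverse ?O * (?E - ?O)" by (simp add: field_simps)
  also have "\<dots> \<in> vanishing (r - 1)" by (intro vanishing_mult_left no_pole_inverse O num)
  finally obtain y where y: "no_pole_at_0 y" "?E / ?O - 1 = alpha ^ (r - 1) * y"
    by (auto simp: vanishing_def)
  \<comment> \<open>As r \<ge> 1, the truncated exponent r - 1 agrees with the integer exponent of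
    \<open>O_alpha\<close>.\<close>
  have "- (int r - 1) = - int (r - 1)" using assms(1) by simp
  then have "alpha ^ (r - 1) * y * alpha powi (- (int r - 1)) = y"
    by (simp only: power_int_minus power_int_of_nat) simp
  then show ?thesis
    unfolding K_def[symmetric] prod y(2) O_alpha_def mem_Collect_eq using y(1) by (simp only:)
qed

end
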